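(* For every $\gamma>1$ there is a constant $C_\gamma>0$, depending only on $\gamma$, such that the following holds. Let $T:[-1,1]\to[-1,1]$ be the Pikovsky map with parameter $\gamma$ (see context), let $\lambda$ be Lebesgue measure on $M=[-1,1]$ normalized to probability, let $f:M\to\mathbb R$ be Lipschitz continuous, and set $X_n=f\circ T^n$, regarded as a random process on $(M,\mathcal F,\mu)$ with $\mathcal F$ the Borel $\sigma$-algebra and $\mu=\lambda$. Then, for all $N\ge1$, $(X_n)_{0\le n<N}$ satisfies the functional correlation bound (see context, with $L=\|f\|_\infty$) with constant and rate function $$C_*=(\|f\|_{\mathrm{Lip}}+1)\,C_\gamma,\qquad R(n)=n^{-1/(\gamma-1)}.$$
   Context: Pikovsky map: for $\gamma>1$, $T:M\to M$, $M=[-1,1]$, is defined implicitly by $$x=\begin{cases}\frac1{2\gamma}(1+T(x))^\gamma,&0\le x\le\frac1{2\gamma},\\ T(x)+\frac1{2\gamma}(1-T(x))^\gamma,&\frac1{2\gamma}\le x\le1,\end{cases}$$ and $T(x)=-T(-x)$ for $x\in[-1,0)$. $T$ preserves $\lambda$. $T^n=T^{n-1}\circ T$ and $T^0$ is the identity. $\|f\|_{\mathrm{Lip}}=\|f\|_\infty+\sup_{x\ne y}|f(x)-f(y)|/|x-y|$. Functional correlation bound. Let $|X_n|\le L$. For a finite nonempty set $I=\{i_1<\dots<i_n\}\subset\{0,\dots,N-1\}$, $\nu_I$ is the joint law of $(X_{i_1},\dots,X_{i_n})$ under $\mu$ on $[-L,L]^n$. For $F:[-L,L]^k\to\mathbb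 R$ let $[F]_1=\max_{1\le i\le k}\sup_{x\in[-L,L]^k}\sup_{a\ne a'\in[-L,L]}|F(x(a/i))-F(x(a'/i))|/|a-a'|$, where $x(a/i)$ is $x$ with its $i$th component replaced by $a$; $F$ is separately Lipschitz continuous if $[F]_1<\infty$, and $\|F\|_{\mathrm{Lip}}=\|F\|_\infty+[F]_1$. $(X_n)_{0\le n<N}$ satisfies the functional correlation bound with rate function $R:\{1,2,\dots\}\to[0,\infty)$ and constant $C_*$ if, whenever $I=I_1\cup I_2\subset\{0,\dots,N-1\}$ with $I_1,I_2$ nonempty and gap $g_1=\min I_2-\max I_1>0$, and $F:[-L,L]^{|I|}\to\mathbb R$ is separately Lipschitz continuous, $$\Big|\int F\,d\nu_I-\int F\,d(\nu_{I_1}\otimes\nu_{I_2})\Big|\le C_*\|F\|_{\mathrm{Lip}}R(g_1).$$ *)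

theory Defs
  imports "HOL-Probability.Probability"
begin

text \<open>On the second branch the value is sought in \<open>[0, 1]\<close>: the map is increasing there, from
  \<open>T (1 / (2 \<gamma>)) = 0\<close> to \<open>T 1 = 1\<close>. For large \<open>\<gamma>\<close> the implicit equation alone also has
  solutions in \<open>[-1, 0)\<close>.\<close>

definition pikovsky_pos :: "real \<Rightarrow> real \<Rightarrow> real" where
  "pikovsky_pos \<gamma> x =
     (if x \<le> 1 / (2 * \<gamma>)
      then (THE y. y \<in> {-1..1} \<and> x = 1 / (2 * \<gamma>) * (1 + y) powr \<gamma>)
      else (THE y. y \<in> {0..1} \<and> x = y + 1 / (2 * \<gamma>) * (1 - y) powr \<gamma>))"

definition pikovsky :: "real \<Rightarrow> real \<Rightarrow> real" where
  "pikovsky \<gamma> x = (if x < 0 then - pikovsky_pos \<gamma> (- x) else pikovsky_pos \<gamma> x)"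

definition pikovsky_space :: "real measure" where
  "pikovsky_space = scale_measure (1 / 2) (restrict_space lborel {-1..1})"

text \<open>Suprema are taken in \<^typ>\<open>ennreal\<close>, so that an unbounded family has supremum \<open>\<infinity>\<close> and the
  empty family has supremum \<open>0\<close>; the latter occurs below when \<open>L = 0\<close>.\<close>

definition sup_norm_on :: "'a set \<Rightarrow> ('a \<Rightarrow> real) \<Rightarrow> ennreal" where
  "sup_norm_on S f = (SUP x\<in>S. ennreal \<bar>f x\<bar>)"

definition lip_norm_on :: "real set \<Rightarrow> (real \<Rightarrow> real) \<Rightarrow> ennreal" where
  "lip_norm_on S f = sup_norm_on S f
     + (SUP x\<in>S. SUP y\<in>S - {x}. ennreal (\<bar>f x - f y\<bar> / \<bar>x - y\<bar>))"

text \<open>Coordinates of \<open>[-L, L]^|I|\<close> are indexed by the elements of \<open>I\<close> themselves instead of by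
  \<open>1, \<dots>, |I|\<close>; the two are identified by the increasing enumeration of \<open>I\<close>. Points are thus
  elements of \<open>I \<rightarrow>\<^sub>E {-L..L}\<close>, and only the values of \<open>F\<close> on this set matter.\<close>

definition sep_lip :: "real \<Rightarrow> nat set \<Rightarrow> ((nat \<Rightarrow> real) \<Rightarrow> real) \<Rightarrow> ennreal" where
  "sep_lip L I F =
     (SUP i\<in>I. SUP x\<in>I \<rightarrow>\<^sub>E {-L..L}. SUP a\<in>{-L..L}. SUP a'\<in>{-L..L} - {a}.
        ennreal (\<bar>F (x(i := a)) - F (x(i := a'))\<bar> / \<bar>a - a'\<bar>))"

definition separately_lipschitz :: "real \<Rightarrow> nat set \<Rightarrow> ((nat \<Rightarrow> real) \<Rightarrow> real) \<Rightarrow> bool" where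
  "separately_lipschitz L I F \<longleftrightarrow> sep_lip L I F < \<infinity>"

definition sep_lip_norm :: "real \<Rightarrow> nat set \<Rightarrow> ((nat \<Rightarrow> real) \<Rightarrow> real) \<Rightarrow> ennreal" where
  "sep_lip_norm L I F = sup_norm_on (I \<rightarrow>\<^sub>E {-L..L}) F + sep_lip L I F"

definition joint_law ::
    "'a measure \<Rightarrow> real \<Rightarrow> (nat \<Rightarrow> 'a \<Rightarrow> real) \<Rightarrow> nat set \<Rightarrow> (nat \<Rightarrow> real) measure" where
  "joint_law M L X I =
     distr M (\<Pi>\<^sub>M i\<in>I. restrict_space borel {-L..L}) (\<lambda>\<omega>. \<lambda>i\<in>I. X i \<omega>)"

text \<open>The first conjunct is the standing assumption that the \<open>X n\<close> are random variables with
  \<open>|X n| \<le> L\<close>. For \<open>I1\<close> lying to the left of \<open>I2\<close>, \<^const>\<open>merge\<close> is the concatenation of vectors.\<close>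

definition functional_correlation_bound ::
    "'a measure \<Rightarrow> nat \<Rightarrow> real \<Rightarrow> (nat \<Rightarrow> 'a \<Rightarrow> real) \<Rightarrow> (nat \<Rightarrow> real) \<Rightarrow> real \<Rightarrow> bool" where
  "functional_correlation_bound M N L X R C \<longleftrightarrow>
     (\<forall>n<N. X n \<in> measurable M (restrict_space borel {-L..L})) \<and>
     (\<forall>I1 I2 F.
        I1 \<noteq> {} \<and> I2 \<noteq> {} \<and> I1 \<union> I2 \<subseteq> {..<N} \<and> Max I1 < Min I2 \<and>
        separately_lipschitz L (I1 \<union> I2) F \<longrightarrow>
        ennreal \<bar>(\<integral>x. F x \<partial>joint_law M L X (I1 \<union> I2))
           - (\<integral>p. F (merge I1 I2 p) \<partial>(joint_law M L X I1 \<Otimes>\<^sub>M joint_law M L X I2))\<bar>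
        \<le> ennreal C * sep_lip_norm L (I1 \<union> I2) F * ennreal (R (Min I2 - Max I1)))"

subsection \<open>Well-definedness\<close>

lemma pikovsky_branch1:
  fixes \<gamma> x :: real
  assumes "\<gamma> > 1" "0 \<le> x" "x \<le> 1 / (2 * \<gamma>)"
  shows "\<exists>!y. y \<in> {-1..1} \<and> x = 1 / (2 * \<gamma>) * (1 + y) powr \<gamma>"
proof (rule ex1I)
  let ?y = "(2 * \<gamma> * x) powr (1 / \<gamma>) - 1"
  have "0 \<le> 2 * \<gamma> * x" "2 * \<gamma> * x \<le> 1" using assms by (auto simp: field_simps)
  then have "(2 * \<gamma> * x) powr (1 / \<gamma>) \<le> 1"
    using assms by (intro powr_le1) auto
  moreover have "((2 * \<gamma> * x) powr (1 / \<gamma>)) powr \<gamma> = 2 * \<gamma> * x"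
    using assms \<open>0 \<le> 2 * \<gamma> * x\<close> by (simp add: powr_powr)
  ultimately show "?y \<in> {-1..1} \<and> x = 1 / (2 * \<gamma>) * (1 + ?y) powr \<gamma>"
    using assms by auto
next
  fix y :: real
  assume y: "y \<in> {-1..1} \<and> x = 1 / (2 * \<gamma>) * (1 + y) powr \<gamma>"
  then have "(2 * \<gamma> * x) powr (1 / \<gamma>) = ((1 + y) powr \<gamma>) powr (1 / \<gamma>)"
    using assms by simp
  also have "\<dots> = 1 + y" using y assms by (simp add: powr_powr)
  finally show "y = (2 * \<gamma> * x) powr (1 / \<gamma>) - 1" by simp
qed

lemma pikovsky_branch2:
  fixes \<gamma> x :: real
  assumes g: "\<gamma> > 1" and x: "1 / (2 * \<gamma>) \<le> x" "x \<le> 1"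
  shows "\<exists>!y. y \<in> {0..1} \<and> x = y + 1 / (2 * \<gamma>) * (1 - y) powr \<gamma>"
proof -
  define h where "h y = y + 1 / (2 * \<gamma>) * (1 - y) powr \<gamma>" for y :: real
  have cont: "continuous_on {0..1} h"
    unfolding h_def using g by (intro continuous_intros continuous_on_powr') auto
  have mono: "h a < h b" if ab: "0 \<le> a" "a < b" "b \<le> 1" for a b
  proof (rule DERIV_pos_imp_increasing_open[OF ab(2)])
    fix t assume t: "a < t" "t < b"
    have d: "(h has_real_derivative 1 - 1 / 2 * (1 - t) powr (\<gamma> - 1)) (at t)"
      unfolding h_def using t ab g
      by (auto intro!: derivative_eq_intros simp: field_simps powr_diff)
    have "(1 - t) powr (\<gamma> - 1) \<le> 1" using t ab g by (intro powr_le1) auto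
    then have "1 - 1 / 2 * (1 - t) powr (\<gamma> - 1) > 0" by linarith
    with d show "\<exists>y. (h has_real_derivative y) (at t) \<and> y > 0" by blast
  next
    show "continuous_on {a..b} h"
      by (rule continuous_on_subset[OF cont]) (use ab in auto)
  qed
  have "\<exists>y\<ge>0. y \<le> 1 \<and> h y = x"
    by (rule IVT'[OF _ _ _ cont]) (use x g in \<open>auto simp: h_def\<close>)
  then obtain y where y: "0 \<le> y" "y \<le> 1" "h y = x" by blast
  show ?thesis
  proof (rule ex1I[of _ y])
    show "y \<in> {0..1} \<and> x = y + 1 / (2 * \<gamma>) * (1 - y) powr \<gamma>"
      using y by (auto simp: h_def)
  next
    fix z assume "z \<in> {0..1} \<and> x = z + 1 / (2 * \<gamma>) * (1 - z) powr \<gamma>"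
    then have "0 \<le> z" "z \<le> 1" "h z = x" by (auto simp: h_def)
    then show "z = y" using y mono[of z y] mono[of y z] by (cases z y rule: linorder_cases) auto
  qed
qed

lemma pikovsky_eq1:
  assumes "\<gamma> > 1" "0 \<le> x" "x \<le> 1 / (2 * \<gamma>)"
  shows "pikovsky \<gamma> x \<in> {-1..1} \<and> x = 1 / (2 * \<gamma>) * (1 + pikovsky \<gamma> x) powr \<gamma>"
  using theI'[OF pikovsky_branch1[OF assms]] assms
  by (simp add: pikovsky_def pikovsky_pos_def)

lemma pikovsky_eq2:
  assumes g: "\<gamma> > 1" and x: "1 / (2 * \<gamma>) \<le> x" "x \<le> 1"
  shows "pikovsky \<gamma> x \<in> {0..1} \<and> x = pikovsky \<gamma> x + 1 / (2 * \<gamma>) * (1 - pikovsky \<gamma> x) powr \<gamma>"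
proof (cases "x = 1 / (2 * \<gamma>)")
  case True
  have x0: "0 \<le> x" "x \<le> 1 / (2 * \<gamma>)" using True g by auto
  have "0 \<in> {-1..1::real} \<and> x = 1 / (2 * \<gamma>) * (1 + 0) powr \<gamma>" using True by simp
  then have "pikovsky \<gamma> x = 0"
    using pikovsky_eq1[OF g x0] pikovsky_branch1[OF g x0] by blast
  then show ?thesis using True by simp
next
  case False
  moreover have "\<not> x < 0" using x g by (smt (verit) divide_nonneg_pos)
  ultimately show ?thesis
    using theI'[OF pikovsky_branch2[OF assms]] x by (simp add: pikovsky_def pikovsky_pos_def)
qed

lemma pikovsky_odd: "x < 0 \<Longrightarrow> pikovsky \<gamma> x = - pikovsky \<gamma> (- x)"
  by (simp add: pikovsky_def)

lemma pikovsky_maps: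
  assumes "\<gamma> > 1" "x \<in> {-1..1}"
  shows "pikovsky \<gamma> x \<in> {-1..1}"
proof -
  have *: "pikovsky \<gamma> x \<in> {-1..1}" if "0 \<le> x" "x \<le> 1" for x
    using pikovsky_eq1[of \<gamma> x] pikovsky_eq2[of \<gamma> x] assms(1) that
    by (cases "x \<le> 1 / (2 * \<gamma>)") auto
  show ?thesis
    using *[of x] *[of "- x"] pikovsky_odd[of x \<gamma>] assms(2) by (cases "x < 0") auto
qed

lemma prob_space_pikovsky_space: "prob_space pikovsky_space"
proof
  have "emeasure pikovsky_space {-1..1} = 1 / 2 * emeasure lborel {-1..1::real}"
    unfolding pikovsky_space_def by (simp add: emeasure_restrict_space)
  also have "\<dots> = 1" using ennreal_divide_times[of 1 2 2] by simp
  finally show "emeasure pikovsky_space (space pikovsky_space) = 1"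
    by (simp add: pikovsky_space_def space_scale_measure space_restrict_space)
qed

end

theory Submission
  imports Defs
begin

text \<open>Run backwards, the orbit of a Lebesgue-distributed point is a Markov chain: from \<open>y\<close> it moves to
  the preimage \<open>gR y \<ge> 0\<close> with probability \<open>p y = gR' y\<close> and to \<open>gL y \<le> 0\<close> with probability
  \<open>1 - p y = gL' y\<close>; these add up to \<open>1\<close> because Lebesgue measure is preserved. Conditioning on the
  value \<open>z\<close> of the orbit at time \<open>min I2\<close>, the coordinates in \<open>I1\<close> are read off the chain started at
  \<open>z\<close>, while in the product measure they are read off the chain started at an independent point \<open>z'\<close>.
  So it suffices to couple the chains from \<open>z\<close> and \<open>z'\<close>.

  As \<open>p\<close>, \<open>gR\<close>, \<open>gL\<close> are increasing, one uniform variable drives both copies in an order preserving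
  way. Let \<open>\<phi>\<close> be odd with \<open>\<phi>' = w = (1 - |y|) powr (- \<kappa>)\<close> and \<open>max 1 (\<gamma> - 1) < \<kappa> < \<gamma>\<close>. For suitable \<open>A\<close>
  the bounded distance \<open>W = 1 - exp (- A |\<phi> y' - \<phi> y|)\<close> never increases on average, even if it is set
  to \<open>1\<close> when the two copies choose different branches, and it contracts by a fixed factor wherever
  \<open>V = w y + w y'\<close> is bounded. With \<open>Q\<close>
  the coupled transition operator, \<open>V\<close> satisfies \<open>Q V \<le> V - c V powr (1 - 1/\<beta>) + 2\<close>
  with \<open>\<beta> = \<kappa> / (\<gamma> - 1) > 1\<close>. By Young's inequality \<open>(n + M V powr (1/\<beta>)) powr (\<beta> (1 - \<epsilon>)) * W powr \<epsilon>\<close>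
  is then a supermartingale, hence after \<open>n\<close> steps the expectation of \<open>W\<close> is
  \<open>O((V / n powr \<beta>) powr (1 - \<epsilon>))\<close>. Since \<open>\<beta> (1 - \<epsilon>) > 1 / (\<gamma> - 1)\<close> for small \<open>\<epsilon>\<close>, integrating the
  minimum of this and \<open>1\<close> over \<open>z\<close>, \<open>z'\<close> gives \<open>O(n powr (- 1 / (\<gamma> - 1)))\<close>.\<close>

section \<open>The inverse branches and the coupled transition operator\<close>

lemma powr_Bernoulli:
  fixes x a :: real
  assumes "1 \<le> a" "0 \<le> x" "x \<le> 1"
  shows "1 - a * x \<le> (1 - x) powr a"
proof (cases "x = 1")
  case False
  define h where "h t = (1 - t) powr a + a * t" for t :: real
  have "h 0 \<le> h x"
  proof (rule DERIV_nonneg_imp_nondecreasing[OF assms(2)])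
    fix t assume t: "0 \<le> t" "t \<le> x"
    then have t1: "1 - t > 0" using False assms by linarith
    have "(h has_real_derivative - (a * (1 - t) powr (a - 1)) + a) (at t)"
      unfolding h_def using t1 by (auto intro!: derivative_eq_intros)
    moreover have "(1 - t) powr (a - 1) \<le> 1"
      using t t1 assms by (intro powr_le1) auto
    ultimately show "\<exists>D. (h has_real_derivative D) (at t) \<and> 0 \<le> D"
      using assms by (intro exI[of _ "- (a * (1 - t) powr (a - 1)) + a"])
        (auto intro: mult_left_le)
  qed
  then show ?thesis by (simp add: h_def)
qed (use assms in auto)

text \<open>\<open>gR\<close> and \<open>\<phi>\<close> change their formula at 0. Both formulas are
  differentiable there with the same slope, so the left and right difference quotients have the same
  limit.\<close>

lemma has_real_derivative_glue:
  fixes f g :: "real \<Rightarrow> real"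
  assumes "(f has_real_derivative D) (at a)" "(g has_real_derivative D) (at a)" "f a = g a"
  shows "((\<lambda>x. if x \<le> a then f x else g x) has_real_derivative D) (at a)"
proof -
  let ?h = "\<lambda>x. if x \<le> a then f x else g x"
  have f: "((\<lambda>y. (f y - f a) / (y - a)) \<longlongrightarrow> D) (at a)"
    and g: "((\<lambda>y. (g y - g a) / (y - a)) \<longlongrightarrow> D) (at a)"
    using assms by (auto simp: has_field_derivative_iff)
  have "((\<lambda>y. (?h y - ?h a) / (y - a)) \<longlongrightarrow> D) (at a)"
  proof (rule filterlim_split_at)
    show "((\<lambda>y. (?h y - ?h a) / (y - a)) \<longlongrightarrow> D) (at_left a)"
      using tendsto_within_subset[OF f, of "{..<a}"]
      by (rule tendsto_cong[THEN iffD1, rotated]) (auto simp: eventually_at_filter)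
    show "((\<lambda>y. (?h y - ?h a) / (y - a)) \<longlongrightarrow> D) (at_right a)"
      using tendsto_within_subset[OF g, of "{a<..}"]
      by (rule tendsto_cong[THEN iffD1, rotated]) (auto simp: eventually_at_filter assms(3))
  qed
  then show ?thesis by (simp add: has_field_derivative_iff)
qed

text \<open>Isabelle's \<^const>\<open>powr\<close> is even in its base, so the derivative at \<open>0\<close> is two-sided.\<close>

lemma has_real_derivative_powr_0:
  fixes a :: real
  assumes "a > 1"
  shows "((\<lambda>x. x powr a) has_real_derivative 0) (at 0)"
proof -
  have lim: "((\<lambda>x::real. \<bar>x\<bar> powr (a - 1)) \<longlongrightarrow> 0) (at 0)"
  proof -
    have "((\<lambda>x::real. \<bar>x\<bar> powr (a - 1)) \<longlongrightarrow> \<bar>0\<bar> powr (a - 1)) (at 0)"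
      using assms by (intro tendsto_powr' tendsto_rabs tendsto_ident_at tendsto_const) auto
    then show ?thesis by simp
  qed
  have le: "norm (x powr a / x) \<le> \<bar>x\<bar> powr (a - 1)" for x :: real
  proof -
    have "x powr a = \<bar>x\<bar> powr a" by (simp add: powr_def abs_if ln_minus)
    then show ?thesis by (simp add: powr_diff)
  qed
  have "((\<lambda>x::real. x powr a / x) \<longlongrightarrow> 0) (at 0)"
    by (rule Lim_null_comparison[OF _ lim]) (simp only: le eventually_True)
  then show ?thesis using assms by (simp add: has_field_derivative_iff)
qed

lemma has_real_derivative_powr_nonneg:
  fixes a :: real
  assumes "a > 1" "x \<ge> 0"
  shows "((\<lambda>x. x powr a) has_real_derivative a * x powr (a - 1)) (at x)"
  using assms has_real_derivative_powr_0[of a] has_real_derivative_powr[of x a]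
  by (cases "x = 0") auto

section \<open>The inverse branches and their slopes\<close>

locale pikovsky_map =
  fixes \<gamma> :: real
  assumes \<gamma>: "\<gamma> > 1"
begin

text \<open>At \<open>y\<close> one inverse branch has slope \<open>\<rho> y / 2\<close> and the
  other \<open>1 - \<rho> y / 2\<close>; the sign of \<open>y\<close> decides which.
  \<open>\<rho>\<close> vanishes at the endpoints, which are the neutral fixed points of the
  map.\<close>

definition \<rho> :: "real \<Rightarrow> real" where
  "\<rho> y = (1 - \<bar>y\<bar>) powr (\<gamma> - 1)"

definition p :: "real \<Rightarrow> real" where
  "p y = (if y \<le> 0 then \<rho> y / 2 else 1 - \<rho> y / 2)"

text \<open>The implicit equations of the map give the preimage in [0, 1] explicitly; the sign of
  the image \<open>y\<close> decides which of them applies.\<close>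

definition gR :: "real \<Rightarrow> real" where
  "gR y = (if y \<le> 0 then (1 + y) powr \<gamma> / (2 * \<gamma>) else y + (1 - y) powr \<gamma> / (2 * \<gamma>))"

definition gL :: "real \<Rightarrow> real" where
  "gL y = - gR (- y)"

lemma \<rho>_minus [simp]: "\<rho> (- y) = \<rho> y"
  by (simp add: \<rho>_def)

lemma \<rho>_0 [simp]: "\<rho> 0 = 1"
  by (simp add: \<rho>_def)

lemma p_minus: "p (- y) = 1 - p y"
  by (simp add: p_def)

lemma \<rho>_le_1: "y \<in> {-1..1} \<Longrightarrow> \<rho> y \<le> 1"
  unfolding \<rho>_def using \<gamma> by (intro powr_le1) auto

lemma \<rho>_nonneg: "0 \<le> \<rho> y"
  by (simp add: \<rho>_def)

lemma \<rho>_pos: "y \<in> {-1<..<1} \<Longrightarrow> 0 < \<rho> y"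
  by (auto simp: \<rho>_def)

lemma p_bounds: "y \<in> {-1..1} \<Longrightarrow> 0 \<le> p y \<and> p y \<le> 1"
  using \<rho>_le_1[of y] \<rho>_nonneg[of y] by (auto simp: p_def)

lemma p_nonneg: "0 \<le> y \<Longrightarrow> p y = 1 - \<rho> y / 2"
  by (simp add: p_def)

lemma p_mono:
  assumes "-1 \<le> x" "x \<le> y" "y \<le> 1"
  shows "p x \<le> p y"
proof -
  have *: "\<rho> b \<le> \<rho> a" if "\<bar>a\<bar> \<le> \<bar>b\<bar>" "\<bar>b\<bar> \<le> 1" for a b
    unfolding \<rho>_def using that \<gamma> by (intro powr_mono2) auto
  consider "y \<le> 0" | "x \<le> 0" "y > 0" | "x > 0" by linarith
  then show ?thesis
  proof cases
    case 1 then show ?thesis using *[of y x] assms by (auto simp: p_def)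
  next
    case 2 then show ?thesis using \<rho>_le_1[of x] \<rho>_le_1[of y] assms by (auto simp: p_def)
  next
    case 3 then show ?thesis using *[of x y] assms by (auto simp: p_def)
  qed
qed

lemma p_cont: "continuous_on {-1..1} p"
proof -
  have "continuous_on {-1..0} (\<lambda>y. \<rho> y / 2)" "continuous_on {0..1} (\<lambda>y. 1 - \<rho> y / 2)"
    unfolding \<rho>_def using \<gamma> by (intro continuous_intros continuous_on_powr'; auto)+
  then have "continuous_on ({-1..0} \<union> {0..1}) (\<lambda>y. if y \<le> 0 then \<rho> y / 2 else 1 - \<rho> y / 2)"
    by (intro continuous_on_If) auto
  moreover have "{-1..0} \<union> {0..1} = {-1..1::real}" by auto
  ultimately show ?thesis by (simp add: p_def[abs_def])
qed

lemma gR_deriv: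
  assumes "y \<in> {-1..1}"
  shows "(gR has_real_derivative p y) (at y)"
proof -
  let ?f = "\<lambda>y. (1 + y) powr \<gamma> / (2 * \<gamma>)" and ?g = "\<lambda>y. y + (1 - y) powr \<gamma> / (2 * \<gamma>)"
  have f: "(?f has_real_derivative \<rho> y / 2) (at y)" if "-1 \<le> y" "y \<le> 0" for y
  proof -
    have "((\<lambda>y. (1 + y) powr \<gamma>) has_real_derivative \<gamma> * (1 + y) powr (\<gamma> - 1) * 1) (at y)"
      using that \<gamma>
      by (intro DERIV_chain2[OF has_real_derivative_powr_nonneg, where g = "\<lambda>y. 1 + y"])
        (auto intro!: derivative_eq_intros)
    from DERIV_cdivide[OF this, of "2 * \<gamma>"] show ?thesis
      using that \<gamma> by (simp add: \<rho>_def)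
  qed
  have g: "(?g has_real_derivative 1 - \<rho> y / 2) (at y)" if "0 \<le> y" "y \<le> 1" for y
  proof -
    have "((\<lambda>y. (1 - y) powr \<gamma>) has_real_derivative \<gamma> * (1 - y) powr (\<gamma> - 1) * (-1)) (at y)"
      using that \<gamma>
      by (intro DERIV_chain2[OF has_real_derivative_powr_nonneg, where g = "\<lambda>y. 1 - y"])
        (auto intro!: derivative_eq_intros)
    from DERIV_add[OF DERIV_ident DERIV_cdivide[OF this, of "2 * \<gamma>"]] show ?thesis
      using that \<gamma> by (simp add: \<rho>_def)
  qed
  consider "y < 0" | "y = 0" | "y > 0" by linarith
  then show ?thesis
  proof cases
    case 1
    have "(gR has_real_derivative \<rho> y / 2) (at y)"
      by (rule has_field_derivative_transform_within_open[OF f, of _ "{..<0}"])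
        (use 1 assms in \<open>auto simp: gR_def\<close>)
    then show ?thesis using 1 by (simp add: p_def)
  next
    case 2
    show ?thesis
      using has_real_derivative_glue[of ?f "1/2" 0 ?g] f[of 0] g[of 0]
      by (simp add: 2 p_def gR_def[abs_def])
  next
    case 3
    have "(gR has_real_derivative 1 - \<rho> y / 2) (at y)"
      by (rule has_field_derivative_transform_within_open[OF g, of _ "{0<..}"])
        (use 3 assms in \<open>auto simp: gR_def\<close>)
    then show ?thesis using 3 by (simp add: p_def)
  qed
qed

lemma gL_deriv:
  assumes "y \<in> {-1..1}"
  shows "(gL has_real_derivative 1 - p y) (at y)"
proof -
  have "((\<lambda>y. gR (- y)) has_real_derivative p (- y) * (-1)) (at y)"
    using assms by (intro DERIV_chain2[OF gR_deriv]) (auto intro!: derivative_eq_intros)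
  from DERIV_minus[OF this] show ?thesis
    by (simp add: p_minus gL_def[abs_def])
qed

lemma gR_ends [simp]: "gR (-1) = 0" "gR 0 = 1 / (2 * \<gamma>)" "gR 1 = 1"
  by (auto simp: gR_def)

lemma gL_ends [simp]: "gL (-1) = -1" "gL 0 = - 1 / (2 * \<gamma>)" "gL 1 = 0"
  by (auto simp: gL_def)

lemma gR_mono:
  assumes "-1 \<le> x" "x \<le> y" "y \<le> 1"
  shows "gR x \<le> gR y"
proof (rule DERIV_nonneg_imp_nondecreasing[OF assms(2)])
  fix t assume "x \<le> t" "t \<le> y"
  then have "t \<in> {-1..1}" using assms by auto
  then show "\<exists>D. (gR has_real_derivative D) (at t) \<and> 0 \<le> D"
    using gR_deriv p_bounds by blast
qed

lemma gR_strict_mono: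
  assumes "-1 \<le> x" "x < y" "y \<le> 1"
  shows "gR x < gR y"
\<comment> \<open>The slope \<open>p\<close> vanishes at -1, so it is known to be positive in the
  open interval only.\<close>
proof (rule DERIV_pos_imp_increasing_open[OF assms(2)])
  fix t assume "x < t" "t < y"
  then have t: "t \<in> {-1<..<1}" using assms by auto
  then have "p t > 0" using \<rho>_pos[of t] \<rho>_le_1[of t] by (auto simp: p_def)
  then show "\<exists>D. (gR has_real_derivative D) (at t) \<and> 0 < D"
    using gR_deriv[of t] t by auto
next
  show "continuous_on {x..y} gR"
  proof (rule DERIV_continuous_on)
    fix t assume "t \<in> {x..y}"
    then show "(gR has_real_derivative p t) (at t within {x..y})"
      using assms by (intro has_field_derivative_at_within[OF gR_deriv]) auto
  qed
qed

lemma gR_range: "y \<in> {-1<..<1} \<Longrightarrow> 0 < gR y \<and> gR y < 1"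
  using gR_strict_mono[of "-1" y] gR_strict_mono[of y 1] by auto

lemma gR_range_closed: "y \<in> {-1..1} \<Longrightarrow> 0 \<le> gR y \<and> gR y \<le> 1"
  using gR_mono[of "-1" y] gR_mono[of y 1] by auto

lemma gL_range: "y \<in> {-1<..<1} \<Longrightarrow> -1 < gL y \<and> gL y < 0"
  using gR_range[of "- y"] by (auto simp: gL_def)

lemma gL_range_closed: "y \<in> {-1..1} \<Longrightarrow> -1 \<le> gL y \<and> gL y \<le> 0"
  using gR_range_closed[of "- y"] by (auto simp: gL_def)

lemma gL_mono: "-1 \<le> x \<Longrightarrow> x \<le> y \<Longrightarrow> y \<le> 1 \<Longrightarrow> gL x \<le> gL y"
  using gR_mono[of "- y" "- x"] by (auto simp: gL_def)

lemma pikovsky_gR: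
  assumes y: "y \<in> {-1..1}"
  shows "pikovsky \<gamma> (gR y) = y"
proof (cases "y \<le> 0")
  case True
  have b: "0 \<le> gR y" "gR y \<le> 1 / (2 * \<gamma>)"
    using gR_range_closed[OF y] gR_mono[of y 0] y True by auto
  have "y \<in> {-1..1} \<and> gR y = 1 / (2 * \<gamma>) * (1 + y) powr \<gamma>"
    using True y by (simp add: gR_def)
  then show ?thesis
    using pikovsky_eq1[OF \<gamma> b] pikovsky_branch1[OF \<gamma> b] by blast
next
  case False
  have b: "1 / (2 * \<gamma>) \<le> gR y" "gR y \<le> 1"
    using gR_range_closed[OF y] gR_mono[of 0 y] y False by auto
  have "y \<in> {0..1} \<and> gR y = y + 1 / (2 * \<gamma>) * (1 - y) powr \<gamma>"
    using False y by (simp add: gR_def)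
  then show ?thesis
    using pikovsky_eq2[OF \<gamma> b] pikovsky_branch2[OF \<gamma> b] by blast
qed

text \<open>The endpoint 1 has to be excluded: \<open>gL 1 = 0\<close>, but the map sends 0 to
  -1.\<close>

lemma pikovsky_gL: "y \<in> {-1<..<1} \<Longrightarrow> pikovsky \<gamma> (gL y) = y"
  using pikovsky_gR[of "- y"] gR_range[of "- y"] by (simp add: gL_def pikovsky_odd)

text \<open>The Perron-Frobenius operator of the map for Lebesgue measure: every preimage is
  weighted by the slope of its inverse branch. As the weights sum to 1, it is also an averaging
  operator.\<close>

definition P :: "(real \<Rightarrow> real) \<Rightarrow> real \<Rightarrow> real" where
  "P h y = p y * h (gR y) + (1 - p y) * h (gL y)"

text \<open>The Markov chain with transition operator \<open>P\<close> runs the orbit of a Lebesgue-distributed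
  point backwards. Driving two copies \<open>y \<le> y'\<close> of it by the same uniform variable keeps them
  ordered; \<open>Q\<close> is the transition operator of this coupling.\<close>

definition Q :: "(real \<Rightarrow> real \<Rightarrow> real) \<Rightarrow> real \<Rightarrow> real \<Rightarrow> real" where
  "Q G y y' = p y * G (gR y) (gR y') + (1 - p y') * G (gL y) (gL y')
     + (p y' - p y) * G (gL y) (gR y')"

end

section \<open>The contracting distance\<close>

text \<open>Roles of the bounds on \<open>\<kappa>\<close>: \<open>\<kappa> < \<gamma>\<close> makes
  the drift constant \<open>c\<close> positive, \<open>\<kappa> > \<gamma> - 1\<close> makes the
  exponent \<open>\<beta>\<close> exceed 1, and \<open>\<kappa> > 1\<close> leaves room for an
  exponent \<open>\<eta>\<close> between 1 and \<open>\<kappa>\<close>.\<close>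

locale pikovsky_weight = pikovsky_map +
  fixes \<kappa> :: real
  assumes \<kappa>_gt: "1 < \<kappa>" "\<gamma> - 1 < \<kappa>" and \<kappa>_lt: "\<kappa> < \<gamma>"
begin

definition w :: "real \<Rightarrow> real" where
  "w y = (1 - \<bar>y\<bar>) powr (- \<kappa>)"

definition \<phi> :: "real \<Rightarrow> real" where
  "\<phi> y = (if y \<le> 0 then (1 - (1 + y) powr (1 - \<kappa>)) / (\<kappa> - 1)
     else ((1 - y) powr (1 - \<kappa>) - 1) / (\<kappa> - 1))"

text \<open>This is 1/2 - \<open>\<kappa> / (2 * \<gamma>)\<close>: for small
  \<open>s = \<rho> y >= 0\<close>, the branch probability \<open>1 - s / 2\<close> falls faster
  than the weight at the preimage grows, by \<open>c * s\<close> to first order.\<close>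

definition c :: real where
  "c = (\<gamma> - \<kappa>) / (2 * \<gamma>)"

text \<open>Normalized by \<open>A * c = 2 * (\<gamma> - 1)\<close>. The factor 2 lets one
  contraction of distances pay for two things: the loss of probability and the gain
  \<open>(\<gamma> - 1) * (y' - y)\<close>.\<close>

definition A :: real where
  "A = 2 * (\<gamma> - 1) / c"

definition W :: "real \<Rightarrow> real \<Rightarrow> real" where
  "W y y' = 1 - exp (- A * (\<phi> y' - \<phi> y))"

lemma c_pos: "c > 0"
  using \<gamma> \<kappa>_lt by (simp add: c_def)

lemma A_pos: "A > 0"
  using \<gamma> c_pos by (simp add: A_def)

lemma A_c: "A * c = 2 * (\<gamma> - 1)"
  using c_pos by (simp add: A_def)

lemma w_minus [simp]: "w (- y) = w y"
  by (simp add: w_def)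

lemma \<phi>_minus [simp]: "\<phi> (- y) = - \<phi> y"
  by (auto simp: \<phi>_def minus_divide_left)

lemma \<phi>_0 [simp]: "\<phi> 0 = 0"
  by (simp add: \<phi>_def)

lemma w_ge_1:
  assumes "y \<in> {-1<..<1}"
  shows "1 \<le> w y"
proof -
  have "(1 - \<bar>y\<bar>) powr \<kappa> \<le> 1"
    using assms \<kappa>_gt by (intro powr_le1) auto
  moreover have "\<bar>y\<bar> < 1" using assms by auto
  ultimately show ?thesis
    by (simp add: w_def powr_minus one_le_inverse_iff)
qed

lemma w_pos: "y \<in> {-1<..<1} \<Longrightarrow> 0 < w y"
  using w_ge_1[of y] by linarith

lemma \<rho>_w: "\<rho> y * w y = (1 - \<bar>y\<bar>) powr (\<gamma> - 1 - \<kappa>)"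
  by (simp add: \<rho>_def w_def flip: powr_add)

lemma \<phi>_deriv:
  assumes "y \<in> {-1<..<1}"
  shows "(\<phi> has_real_derivative w y) (at y)"
proof -
  let ?f = "\<lambda>y. (1 - (1 + y) powr (1 - \<kappa>)) / (\<kappa> - 1)"
  let ?g = "\<lambda>y. ((1 - y) powr (1 - \<kappa>) - 1) / (\<kappa> - 1)"
  have f: "(?f has_real_derivative w y) (at y)" if "-1 < y" "y \<le> 0" for y
  proof -
    have "((\<lambda>y. 1 - (1 + y) powr (1 - \<kappa>)) has_real_derivative (\<kappa> - 1) * w y) (at y)"
      using that by (auto intro!: derivative_eq_intros simp: w_def algebra_simps)
    from DERIV_cdivide[OF this, of "\<kappa> - 1"] show ?thesis using \<kappa>_gt by simp
  qed
  have g: "(?g has_real_derivative w y) (at y)" if "0 \<le> y" "y < 1" for y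
  proof -
    have "((\<lambda>y. (1 - y) powr (1 - \<kappa>) - 1) has_real_derivative (\<kappa> - 1) * w y) (at y)"
      using that by (auto intro!: derivative_eq_intros simp: w_def algebra_simps)
    from DERIV_cdivide[OF this, of "\<kappa> - 1"] show ?thesis using \<kappa>_gt by simp
  qed
  consider "y < 0" | "y = 0" | "y > 0" by linarith
  then show ?thesis
  proof cases
    case 1
    show ?thesis
      by (rule has_field_derivative_transform_within_open[OF f, of _ "{..<0}"])
        (use 1 assms in \<open>auto simp: \<phi>_def\<close>)
  next
    case 2
    show ?thesis
      using has_real_derivative_glue[of ?f "w 0" 0 ?g] f[of 0] g[of 0]
      by (simp add: 2 \<phi>_def[abs_def])
  next
    case 3
    show ?thesis
      by (rule has_field_derivative_transform_within_open[OF g, of _ "{0<..}"])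
        (use 3 assms in \<open>auto simp: \<phi>_def\<close>)
  qed
qed

section \<open>Drift of the weight along the inverse branches\<close>

lemma powr_\<gamma>: "0 \<le> y \<Longrightarrow> y < 1 \<Longrightarrow> (1 - y) powr \<gamma> = (1 - y) * \<rho> y"
  by (simp add: \<rho>_def powr_diff)

lemma powr_minus_Bernoulli:
  assumes "0 \<le> x" "x \<le> 1"
  shows "(1 - x / (2 * \<gamma>)) powr (- \<kappa>) \<le> 1 / (1 - \<kappa> * x / (2 * \<gamma>))"
proof -
  have x: "0 \<le> x / (2 * \<gamma>)" "x / (2 * \<gamma>) \<le> 1"
    using assms \<gamma> by (auto simp: field_simps)
  have "\<kappa> * x \<le> \<kappa> * 1" using assms \<kappa>_gt by (intro mult_left_mono) auto
  then have "\<kappa> * x < 2 * \<gamma>" using \<gamma> \<kappa>_lt by linarith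
  then have "0 < 1 - \<kappa> * x / (2 * \<gamma>)" using \<gamma> by (simp add: field_simps)
  moreover have "1 - \<kappa> * x / (2 * \<gamma>) \<le> (1 - x / (2 * \<gamma>)) powr \<kappa>"
    using powr_Bernoulli[of \<kappa> "x / (2 * \<gamma>)"] x \<kappa>_gt by simp
  ultimately show ?thesis
    by (simp add: powr_minus inverse_eq_divide frac_le)
qed

text \<open>With \<open>s = \<rho> y\<close>, the branch multiplies the distance to 1 by
  \<open>1 - s / (2 * \<gamma>)\<close>, so by Bernoulli the weight grows at most by the factor
  \<open>1 / (1 - \<kappa> * s / (2 * \<gamma>))\<close>. The probability \<open>1 - s / 2\<close>
  outweighs this because \<open>c + \<kappa> / (2 * \<gamma>) = 1 / 2\<close>.\<close>

lemma w_gR: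
  assumes "0 \<le> y" "y < 1"
  shows "p y * w (gR y) \<le> (1 - c * \<rho> y) * w y"
proof -
  define s where "s = \<rho> y"
  have s: "0 < s" "s \<le> 1" using \<rho>_pos[of y] \<rho>_le_1[of y] assms by (auto simp: s_def)
  have py: "p y = 1 - s / 2" using assms by (auto simp: p_def s_def)
  have g: "gR y = y + (1 - y) * s / (2 * \<gamma>)"
  proof (cases "y = 0")
    case False
    then show ?thesis using assms by (simp add: gR_def powr_\<gamma> s_def)
  qed (simp add: s_def)
  have "1 - \<bar>gR y\<bar> = (1 - y) * (1 - s / (2 * \<gamma>))"
    using gR_range[of y] assms by (simp add: g field_simps)
  then have "w (gR y) = w y * (1 - s / (2 * \<gamma>)) powr (- \<kappa>)"
    using assms by (simp add: w_def powr_mult)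
  also have "\<dots> \<le> w y * (1 / (1 - \<kappa> * s / (2 * \<gamma>)))"
    using s w_pos[of y] assms by (intro mult_left_mono powr_minus_Bernoulli) auto
  finally have "p y * w (gR y) \<le> (1 - s / 2) * (w y * (1 / (1 - \<kappa> * s / (2 * \<gamma>))))"
    unfolding py using s by (intro mult_left_mono) auto
  also have "\<dots> \<le> (1 - c * s) * w y"
  proof -
    have "\<kappa> * s \<le> \<kappa> * 1" using s \<kappa>_gt by (intro mult_left_mono) auto
    then have "\<kappa> * s < 2 * \<gamma>" using \<gamma> \<kappa>_lt by linarith
    then have pos: "0 < 1 - \<kappa> * s / (2 * \<gamma>)" using \<gamma> by (simp add: field_simps)
    have "c + \<kappa> / (2 * \<gamma>) = 1 / 2" using \<gamma> by (simp add: c_def field_simps)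
    then have "1 - s / 2 = 1 - (c + \<kappa> / (2 * \<gamma>)) * s" by simp
    also have "\<dots> \<le> (1 - c * s) * (1 - \<kappa> / (2 * \<gamma>) * s)"
    proof -
      have "0 \<le> (c * s) * (\<kappa> / (2 * \<gamma>) * s)" using c_pos s \<kappa>_gt \<gamma> by simp
      then show ?thesis by (simp add: left_diff_distrib right_diff_distrib distrib_right del: times_divide_eq_left times_divide_eq_right)
    qed
    also have "\<kappa> / (2 * \<gamma>) * s = \<kappa> * s / (2 * \<gamma>)" by simp
    finally have "(1 - s / 2) / (1 - \<kappa> * s / (2 * \<gamma>)) \<le> 1 - c * s"
      using pos by (simp add: pos_divide_le_eq)
    then have "(1 - s / 2) / (1 - \<kappa> * s / (2 * \<gamma>)) * w y \<le> (1 - c * s) * w y"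
      using w_pos[of y] assms by (intro mult_right_mono) auto
    then show ?thesis by simp
  qed
  finally show ?thesis by (simp add: s_def)
qed

text \<open>For \<open>y >= 0\<close> the left preimage lies within
  \<open>1 / (2 * \<gamma>)\<close> of 0, where the weight is bounded, and it is chosen with
  probability at most 1/2.\<close>

lemma w_gL:
  assumes "0 \<le> y" "y < 1"
  shows "(1 - p y) * w (gL y) \<le> 1 - c"
proof -
  define s where "s = \<rho> y"
  have s: "0 < s" "s \<le> 1" using \<rho>_pos[of y] \<rho>_le_1[of y] assms by (auto simp: s_def)
  have py: "1 - p y = s / 2" using assms by (auto simp: p_def s_def)
  define x where "x = (1 - y) * s"
  have x: "0 \<le> x" "x \<le> 1" using assms s by (auto simp: x_def mult_le_one)
  have "1 - \<bar>gL y\<bar> = 1 - x / (2 * \<gamma>)"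
    using gL_range[of y] assms s \<gamma> by (simp add: gL_def gR_def powr_\<gamma> x_def s_def)
  then have "w (gL y) \<le> 1 / (1 - \<kappa> * x / (2 * \<gamma>))"
    using x by (simp add: w_def powr_minus_Bernoulli)
  also have "\<dots> \<le> 1 / (1 - \<kappa> / (2 * \<gamma>))"
  proof -
    have "\<kappa> * x \<le> \<kappa>" using x \<kappa>_gt mult_left_mono[of x 1 \<kappa>] by simp
    then have "\<kappa> * x / (2 * \<gamma>) \<le> \<kappa> / (2 * \<gamma>)" using \<gamma> by (intro divide_right_mono) auto
    moreover have "\<kappa> / (2 * \<gamma>) < 1" using \<kappa>_lt \<gamma> by (simp add: field_simps)
    ultimately show ?thesis by (intro frac_le) auto
  qed
  finally have "(1 - p y) * w (gL y) \<le> 1 / 2 * (1 / (1 - \<kappa> / (2 * \<gamma>)))"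
    unfolding py using s w_pos[of "gL y"] gL_range[of y] assms by (intro mult_mono) auto
  also have "\<dots> \<le> 1 - c"
  proof -
    \<comment> \<open>The right side is (1 - c)(1/2 + c) = 1/2 + c/2 - c^2, so
      \<open>c <= 1/2\<close> suffices.\<close>
    have "1 / 2 \<le> (1 - c) * (1 - \<kappa> / (2 * \<gamma>))"
    proof -
      have k: "\<kappa> / (2 * \<gamma>) = 1 / 2 - c" using \<gamma> by (simp add: c_def field_simps)
      have "c \<le> 1 / 2" using \<gamma> \<kappa>_gt by (simp add: c_def field_simps)
      then have "c * c \<le> c * (1 / 2)" using c_pos by (intro mult_left_mono) auto
      then show ?thesis unfolding k by (simp add: field_simps)
    qed
    moreover have "0 < 1 - \<kappa> / (2 * \<gamma>)" using \<kappa>_lt \<gamma> by (simp add: field_simps)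
    ultimately show ?thesis by (simp add: divide_simps)
  qed
  finally show ?thesis .
qed

text \<open>For \<open>y >= 0\<close> the loss comes from \<open>gR\<close>, and \<open>gL\<close>
  contributes at most 1. Reflection exchanges the branches and preserves \<open>w\<close>, which
  gives the other half.\<close>

lemma P_w:
  assumes "y \<in> {-1<..<1}"
  shows "P w y \<le> w y - c * (\<rho> y * w y) + 1"
proof -
  have *: "P w y \<le> w y - c * (\<rho> y * w y) + 1" if "0 \<le> y" "y < 1" for y
    using w_gR[OF that] w_gL[OF that] c_pos by (simp add: P_def algebra_simps)
  have "P w (- y) = P w y"
    using w_minus[of "gR y"] w_minus[of "gL y"]
    by (simp add: P_def p_minus gL_def algebra_simps del: w_minus)
  then show ?thesis using *[of y] *[of "- y"] assms by (cases "0 \<le> y") auto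
qed

text \<open>The integrated form of \<open>w_gR\<close>. The comparison function \<open>K\<close> is
  left free, so that the loss of distance can be bounded below in several shapes.\<close>

lemma \<phi>_gR:
  assumes ab: "0 \<le> a" "a \<le> b" "b < 1"
    and K: "\<And>t. a \<le> t \<Longrightarrow> t \<le> b \<Longrightarrow> (K has_real_derivative k t) (at t)"
    and k: "\<And>t. a \<le> t \<Longrightarrow> t \<le> b \<Longrightarrow> k t \<le> \<rho> t * w t"
  shows "c * (K b - K a) \<le> \<phi> b - \<phi> a - (\<phi> (gR b) - \<phi> (gR a))"
proof -
  define f where "f t = \<phi> t - \<phi> (gR t) - c * K t" for t
  have "f a \<le> f b"
  proof (rule DERIV_nonneg_imp_nondecreasing[OF ab(2)])
    fix t assume t: "a \<le> t" "t \<le> b"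
    have "((\<lambda>t. \<phi> (gR t)) has_real_derivative w (gR t) * p t) (at t)"
      using t ab gR_range[of t] by (intro DERIV_chain2[OF \<phi>_deriv gR_deriv]) auto
    then have "(f has_real_derivative w t - w (gR t) * p t - c * k t) (at t)"
      unfolding f_def using t ab by (intro DERIV_diff DERIV_cmult \<phi>_deriv K) auto
    moreover have "c * k t \<le> c * (\<rho> t * w t)"
      using k[OF t] c_pos by (intro mult_left_mono) auto
    ultimately show "\<exists>D. (f has_real_derivative D) (at t) \<and> 0 \<le> D"
      using w_gR[of t] t ab
      by (intro exI[of _ "w t - w (gR t) * p t - c * k t"]) (auto simp: algebra_simps)
  qed
  then show ?thesis by (simp add: f_def algebra_simps)
qed

text \<open>As for \<open>gR\<close>, but the loss has density at least \<open>c * w\<close> instead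
  of \<open>c * \<rho> * w\<close>, because the weight at the left preimage stays bounded while
  \<open>w >= 1\<close>. This stronger density admits a logarithmic \<open>K\<close>.\<close>

lemma \<phi>_gL:
  assumes ab: "0 \<le> a" "a \<le> b" "b < 1"
    and K: "\<And>t. a \<le> t \<Longrightarrow> t \<le> b \<Longrightarrow> (K has_real_derivative k t) (at t)"
    and k: "\<And>t. a \<le> t \<Longrightarrow> t \<le> b \<Longrightarrow> k t \<le> w t"
  shows "c * (K b - K a) \<le> \<phi> b - \<phi> a - (\<phi> (gL b) - \<phi> (gL a))"
proof -
  define f where "f t = \<phi> t - \<phi> (gL t) - c * K t" for t
  have "f a \<le> f b"
  proof (rule DERIV_nonneg_imp_nondecreasing[OF ab(2)])
    fix t assume t: "a \<le> t" "t \<le> b"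
    have "((\<lambda>t. \<phi> (gL t)) has_real_derivative w (gL t) * (1 - p t)) (at t)"
      using t ab gL_range[of t] by (intro DERIV_chain2[OF \<phi>_deriv gL_deriv]) auto
    then have "(f has_real_derivative w t - w (gL t) * (1 - p t) - c * k t) (at t)"
      unfolding f_def using t ab by (intro DERIV_diff DERIV_cmult \<phi>_deriv K) auto
    moreover have "c * k t \<le> c * w t"
      using k[OF t] c_pos by (intro mult_left_mono) auto
    moreover have "1 - c \<le> (1 - c) * w t"
    proof -
      have "c \<le> 1" using \<gamma> \<kappa>_gt by (simp add: c_def field_simps)
      then show ?thesis using w_ge_1[of t] t ab mult_left_mono[of 1 "w t" "1 - c"] by auto
    qed
    ultimately show "\<exists>D. (f has_real_derivative D) (at t) \<and> 0 \<le> D"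
      using w_gL[of t] t ab
      by (intro exI[of _ "w t - w (gL t) * (1 - p t) - c * k t"]) (auto simp: algebra_simps)
  qed
  then show ?thesis by (simp add: f_def algebra_simps)
qed

lemma \<rho>_w_ge:
  assumes "0 \<le> t" "t < 1"
  shows "1 \<le> \<rho> t * w t" "(1 - t) powr (\<gamma> - 2) \<le> \<rho> t * w t" "\<rho> t * w t \<le> w t" "1 / (1 - t) \<le> w t"
proof -
  have "(1 - t) powr 0 \<le> (1 - t) powr (\<gamma> - 1 - \<kappa>)"
    using assms \<kappa>_gt by (intro powr_mono') auto
  then show "1 \<le> \<rho> t * w t" using assms by (simp add: \<rho>_w)
  have "(1 - t) powr (\<gamma> - 2) \<le> (1 - t) powr (\<gamma> - 1 - \<kappa>)"
    using assms \<kappa>_gt by (intro powr_mono') auto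
  then show "(1 - t) powr (\<gamma> - 2) \<le> \<rho> t * w t" using assms by (simp add: \<rho>_w)
  show "\<rho> t * w t \<le> w t"
    using assms \<rho>_le_1[of t] w_pos[of t] by (intro mult_left_le_one_le) (auto simp: \<rho>_nonneg)
  have "(1 - t) powr (-1) \<le> (1 - t) powr (- \<kappa>)"
    using assms \<kappa>_gt by (intro powr_mono') auto
  then show "1 / (1 - t) \<le> w t"
    using assms by (simp add: w_def powr_minus_divide)
qed

text \<open>The bounds by \<open>b - a\<close> pay for the gain in the coupling inequality, those by
  \<open>\<rho> a - \<rho> b\<close> for the probability that the copies separate, and the
  logarithmic one for a small branch probability when the copies lie on different sides of
  0.\<close>

lemma \<phi>_contr_nonneg:
  assumes ab: "0 \<le> a" "a \<le> b" "b < 1"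
  defines "dR \<equiv> \<phi> b - \<phi> a - (\<phi> (gR b) - \<phi> (gR a))"
    and "dL \<equiv> \<phi> b - \<phi> a - (\<phi> (gL b) - \<phi> (gL a))"
  shows "c * (b - a) \<le> dR" "c * (b - a) \<le> dL"
    "c * ((\<rho> a - \<rho> b) / (\<gamma> - 1)) \<le> dR" "c * ((\<rho> a - \<rho> b) / (\<gamma> - 1)) \<le> dL"
    "c * (ln (1 - a) - ln (1 - b)) \<le> dL"
proof -
  have r: "((\<lambda>t. - ((1 - t) powr (\<gamma> - 1) / (\<gamma> - 1))) has_real_derivative (1 - t) powr (\<gamma> - 2)) (at t)"
    if "a \<le> t" "t \<le> b" for t
    using that ab \<gamma> by (auto intro!: derivative_eq_intros)
  have l: "((\<lambda>t. - ln (1 - t)) has_real_derivative 1 / (1 - t)) (at t)" if "a \<le> t" "t \<le> b" for t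
    using that ab by (auto intro!: derivative_eq_intros)
  have \<rho>: "\<rho> a = (1 - a) powr (\<gamma> - 1)" "\<rho> b = (1 - b) powr (\<gamma> - 1)"
    using ab by (auto simp: \<rho>_def)
  show "c * (b - a) \<le> dR" unfolding dR_def
    by (rule \<phi>_gR[OF ab DERIV_ident]) (use \<rho>_w_ge ab in auto)
  show "c * (b - a) \<le> dL" unfolding dL_def
    by (rule \<phi>_gL[OF ab DERIV_ident]) (use w_ge_1 ab in auto)
  show "c * ((\<rho> a - \<rho> b) / (\<gamma> - 1)) \<le> dR" unfolding dR_def
    using \<phi>_gR[OF ab r] \<rho>_w_ge(2) ab by (simp add: \<rho> diff_divide_distrib)
  have "(1 - t) powr (\<gamma> - 2) \<le> w t" if "a \<le> t" "t \<le> b" for t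
    using \<rho>_w_ge(2,3)[of t] that ab by linarith
  then show "c * ((\<rho> a - \<rho> b) / (\<gamma> - 1)) \<le> dL" unfolding dL_def
    using \<phi>_gL[OF ab r] by (simp add: \<rho> diff_divide_distrib)
  show "c * (ln (1 - a) - ln (1 - b)) \<le> dL" unfolding dL_def
    using \<phi>_gL[OF ab l] \<rho>_w_ge(4) ab by simp
qed

text \<open>This is the one-step inequality for \<open>W\<close>, multiplied by
  \<open>exp (A * (\<phi> y' - \<phi> y))\<close>. On one side of 0, the exponents make up for the
  separation probability \<open>q\<close>. On different sides, each of the two summands alone
  reaches \<open>exp D / 2\<close>.\<close>

lemma coupling_gain:
  assumes y: "-1 < y" "y \<le> y'" "y' < 1"
  shows "1 + (\<gamma> - 1) * (y' - y)
    \<le> p y * exp (A * (\<phi> y' - \<phi> y - (\<phi> (gR y') - \<phi> (gR y))))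
     + (1 - p y') * exp (A * (\<phi> y' - \<phi> y - (\<phi> (gL y') - \<phi> (gL y))))"
    (is "_ \<le> ?E y y'")
proof -
  have nonneg: "1 + (\<gamma> - 1) * (y' - y) \<le> ?E y y'" if y: "0 \<le> y" "y \<le> y'" "y' < 1" for y y'
  proof -
    define q where "q = (\<rho> y - \<rho> y') / 2"
    define D where "D = (\<gamma> - 1) * (y' - y)"
    have pp: "1 - q = p y + (1 - p y')"
      using y by (simp add: p_nonneg q_def field_simps)
    have "q = p y' - p y" using pp by linarith
    then have q: "0 \<le> q" using p_mono[of y y'] y by simp
    have q2: "q \<le> 1 / 2"
      using \<rho>_le_1[of y] \<rho>_nonneg[of y'] y by (auto simp: q_def)
    \<comment> \<open>The two lower bounds for \<open>A * d\<close> are \<open>2 * D\<close> and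
      \<open>4 * q\<close>; their mean is taken.\<close>
    have half: "D + 2 * q \<le> A * d" if "c * (y' - y) \<le> d" "c * ((\<rho> y - \<rho> y') / (\<gamma> - 1)) \<le> d" for d
    proof -
      have "A * (c * (y' - y)) \<le> A * d" "A * (c * ((\<rho> y - \<rho> y') / (\<gamma> - 1))) \<le> A * d"
        using that A_pos by (simp_all only: mult_left_mono less_imp_le)
      then have "2 * (\<gamma> - 1) * (y' - y) \<le> A * d" "2 * (\<gamma> - 1) * ((\<rho> y - \<rho> y') / (\<gamma> - 1)) \<le> A * d"
        by (simp_all only: mult.assoc[symmetric] A_c)
      moreover have "2 * (\<gamma> - 1) * ((\<rho> y - \<rho> y') / (\<gamma> - 1)) = 4 * q"
        using \<gamma> by (simp add: q_def field_simps)
      moreover have "2 * (\<gamma> - 1) * (y' - y) = 2 * D" by (simp add: D_def)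
      ultimately show ?thesis by linarith
    qed
    \<comment> \<open>Expanded, the right side is 1 + q - 2 q^2, which is at least 1 as
      \<open>q <= 1/2\<close>.\<close>
    have "1 * 1 \<le> (1 - q) * (1 + 2 * q)"
      using mult_mono[of q "1/2" q q] q q2 by (simp add: algebra_simps)
    also have "\<dots> \<le> (1 - q) * exp (2 * q)"
      using q2 by (intro mult_left_mono exp_ge_add_one_self) auto
    finally have "exp D * 1 \<le> exp D * ((1 - q) * exp (2 * q))"
      by (intro mult_left_mono) auto
    then have "1 + D \<le> exp D * ((1 - q) * exp (2 * q))"
      using exp_ge_add_one_self[of D] by linarith
    also have "\<dots> = p y * exp (D + 2 * q) + (1 - p y') * exp (D + 2 * q)"
      by (simp add: pp exp_add algebra_simps)
    also have "\<dots> \<le> ?E y y'"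
      using p_bounds[of y] p_bounds[of y'] y \<phi>_contr_nonneg[OF y]
      by (intro add_mono mult_left_mono) (auto intro!: half)
    finally show ?thesis by (simp add: D_def)
  qed
  have E_minus: "?E (- y') (- y) = ?E y y'" for y y'
  proof -
    have "gR (- y) = - gL y" "gL (- y) = - gR y" for y by (auto simp: gL_def)
    then show ?thesis by (simp add: p_minus algebra_simps)
  qed
  consider "0 \<le> y" | "y' \<le> 0" | "y < 0" "0 < y'" by linarith
  then show ?thesis
  proof cases
    case 1
    then show ?thesis using nonneg y by auto
  next
    case 2
    then show ?thesis using nonneg[of "- y'" "- y"] y by (simp only: E_minus) (simp add: algebra_simps)
  next
    case 3
    define D where "D = (\<gamma> - 1) * (y' - y)"
    have half: "exp D / 2 \<le> p y * exp (A * (\<phi> y' - \<phi> y - (\<phi> (gR y') - \<phi> (gR y))))"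
      if y: "-1 < y" "y < 0" "0 < y'" "y' < 1" and D: "D = (\<gamma> - 1) * (y' - y)" for y y'
    proof -
      have "gR (- t) = - gL t" "gL (- t) = - gR t" for t by (auto simp: gL_def)
      \<comment> \<open>The segment is split at 0. On \<open>[y, 0]\<close>, reflection turns
        \<open>gR\<close> into \<open>gL\<close>, so the logarithmic bound applies;
        \<open>[0, y']\<close> needs only the linear one.\<close>
      then have "c * (- ln (1 + y)) \<le> - \<phi> y - (\<phi> (gR 0) - \<phi> (gR y))"
        using \<phi>_contr_nonneg(5)[of 0 "- y"] y by (simp add: gL_def)
      moreover have "c * y' \<le> \<phi> y' - (\<phi> (gR y') - \<phi> (gR 0))"
        using \<phi>_contr_nonneg(1)[of 0 y'] y by simp
      ultimately have "c * (y' - ln (1 + y)) \<le> \<phi> y' - \<phi> y - (\<phi> (gR y') - \<phi> (gR y))"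
        by (simp add: algebra_simps)
      then have "A * (c * (y' - ln (1 + y))) \<le> A * (\<phi> y' - \<phi> y - (\<phi> (gR y') - \<phi> (gR y)))"
        using A_pos by (intro mult_left_mono) auto
      then have *: "2 * (\<gamma> - 1) * (y' - ln (1 + y)) \<le> A * (\<phi> y' - \<phi> y - (\<phi> (gR y') - \<phi> (gR y)))"
        by (simp only: mult.assoc[symmetric] A_c)
      have "ln (1 + y) \<le> y" using ln_add_one_self_le_self2[of y] y by auto
      then have "(\<gamma> - 1) * (y' - y) \<le> (\<gamma> - 1) * (2 * y' - ln (1 + y))"
        using y \<gamma> by (intro mult_left_mono) auto
      then have "D \<le> (\<gamma> - 1) * ln (1 + y) + 2 * (\<gamma> - 1) * (y' - ln (1 + y))"
        unfolding D by (simp add: algebra_simps)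
      \<comment> \<open>Half of the logarithmic gain is spent here:
        \<open>exp ((\<gamma> - 1) * ln (1 + y))\<close> is \<open>\<rho> y\<close>, that is,
        \<open>2 * p y\<close>.\<close>
      with * have "exp D \<le> exp ((\<gamma> - 1) * ln (1 + y) + A * (\<phi> y' - \<phi> y - (\<phi> (gR y') - \<phi> (gR y))))"
        by simp
      also have "\<dots> = 2 * p y * exp (A * (\<phi> y' - \<phi> y - (\<phi> (gR y') - \<phi> (gR y))))"
        using y by (simp add: exp_add p_def \<rho>_def powr_def)
      finally show ?thesis by simp
    qed
    have "1 + D \<le> exp D / 2 + exp D / 2"
      using exp_ge_add_one_self[of D] by simp
    also have "\<dots> \<le> ?E y y'"
    proof (rule add_mono)
      have "gR (- y) = - gL y" for y by (simp add: gL_def)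
      then show "exp D / 2 \<le> (1 - p y') * exp (A * (\<phi> y' - \<phi> y - (\<phi> (gL y') - \<phi> (gL y))))"
        using half[of "- y'" "- y"] 3 y by (simp add: D_def p_minus algebra_simps)
    qed (use half[of y y'] 3 y in \<open>simp add: D_def\<close>)
    finally show ?thesis by (simp add: D_def)
  qed
qed

section \<open>The bounded distance W and its one-step inequality\<close>

lemma \<phi>_mono:
  assumes "-1 < y" "y \<le> y'" "y' < 1"
  shows "y' - y \<le> \<phi> y' - \<phi> y"
proof -
  have "\<phi> y - y \<le> \<phi> y' - y'"
  proof (rule DERIV_nonneg_imp_nondecreasing[OF assms(2)])
    fix t assume "y \<le> t" "t \<le> y'"
    then have t: "t \<in> {-1<..<1}" using assms by auto
    have "((\<lambda>t. \<phi> t - t) has_real_derivative w t - 1) (at t)"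
      by (intro DERIV_diff \<phi>_deriv[OF t] DERIV_ident)
    then show "\<exists>D. ((\<lambda>t. \<phi> t - t) has_real_derivative D) (at t) \<and> 0 \<le> D"
      using w_ge_1[OF t] by auto
  qed
  then show ?thesis by simp
qed

lemma W_bounds:
  assumes "-1 < y" "y \<le> y'" "y' < 1"
  shows "0 \<le> W y y'" "W y y' \<le> 1" "y < y' \<Longrightarrow> 0 < W y y'" "W y y' \<le> A * (\<phi> y' - \<phi> y)"
proof -
  have "0 \<le> A * (\<phi> y' - \<phi> y)" using \<phi>_mono[OF assms] A_pos assms by simp
  then show "0 \<le> W y y'" "W y y' \<le> 1" by (auto simp: W_def)
  show "0 < W y y'" if "y < y'" using \<phi>_mono[OF assms] A_pos that by (auto simp: W_def)
  show "W y y' \<le> A * (\<phi> y' - \<phi> y)"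
    using exp_ge_add_one_self[of "- A * (\<phi> y' - \<phi> y)"] unfolding W_def by linarith
qed

text \<open>The summand \<open>p y' - p y\<close> bounds the event that the two copies choose different branches,
  where \<open>W\<close> is estimated by \<open>1\<close>.\<close>

lemma W_step:
  assumes "-1 < y" "y \<le> y'" "y' < 1"
  shows "p y * W (gR y) (gR y') + (1 - p y') * W (gL y) (gL y') + (p y' - p y)
    \<le> W y y' - (\<gamma> - 1) * (y' - y) * exp (- A * (\<phi> y' - \<phi> y))"
proof -
  let ?x = "A * (\<phi> y' - \<phi> y)"
  have "exp (- ?x) * (1 + (\<gamma> - 1) * (y' - y))
      \<le> exp (- ?x) * (p y * exp (A * (\<phi> y' - \<phi> y - (\<phi> (gR y') - \<phi> (gR y))))
     + (1 - p y') * exp (A * (\<phi> y' - \<phi> y - (\<phi> (gL y') - \<phi> (gL y)))))"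
    using coupling_gain[OF assms] by (intro mult_left_mono) auto
  also have "\<dots> = p y * (1 - W (gR y) (gR y')) + (1 - p y') * (1 - W (gL y) (gL y'))"
    by (simp add: W_def algebra_simps flip: exp_add)
  finally show ?thesis by (simp add: W_def algebra_simps)
qed

end

section \<open>A supermartingale for the coupled chain\<close>

lemma powr_add_le:
  fixes a b s :: real
  assumes "0 < a" "0 < b" "0 \<le> s" "s \<le> 1"
  shows "(a + b) powr s \<le> a powr s + b powr s"
proof -
  have *: "x * (a + b) powr (s - 1) \<le> x powr s" if "0 < x" "x \<le> a + b" for x
  proof -
    have "x * (a + b) powr (s - 1) \<le> x * x powr (s - 1)"
      using that assms by (intro mult_left_mono powr_mono2') auto
    also have "\<dots> = x powr s" using that by (simp add: powr_diff)
    finally show ?thesis .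
  qed
  have "(a + b) powr s = a * (a + b) powr (s - 1) + b * (a + b) powr (s - 1)"
    using assms by (simp add: powr_diff flip: distrib_right add_divide_distrib)
  with *[of a] *[of b] assms show ?thesis by simp
qed

text \<open>Convexity of the power function between 1 and \<open>y / x\<close>. It bounds a power of
  an affine function of \<open>y\<close> by an affine function of \<open>y powr b\<close>, on which
  \<open>Q\<close> acts linearly.\<close>

lemma powr_tangent:
  fixes b :: real
  assumes "1 \<le> b" "0 < x" "0 < y" "0 \<le> t" "t \<le> 1"
  shows "(1 - t + t * (y / x)) powr b \<le> 1 - t + t * (y powr b / x powr b)"
proof -
  have "((1 - t) *\<^sub>R 1 + t *\<^sub>R (y / x)) powr b \<le> (1 - t) * 1 powr b + t * (y / x) powr b"
    using assms by (intro convex_onD[OF powr_convex]) auto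
  then show ?thesis by (simp add: powr_divide)
qed

section \<open>Drift of the Lyapunov function and of its time-dependent transform\<close>

context pikovsky_weight
begin

definition \<beta> :: real where
  "\<beta> = \<kappa> / (\<gamma> - 1)"

definition V :: "real \<Rightarrow> real \<Rightarrow> real" where
  "V y y' = w y + w y'"

definition L :: "real \<Rightarrow> real \<Rightarrow> real" where
  "L y y' = V y y' powr (1 / \<beta>)"

text \<open>Under the drift v' = -(c/2) v^(1 - 1/\<beta>), the quantity v^(1/\<beta>) decreases at
  the constant rate \<open>1 / M\<close>.\<close>

definition M :: real where
  "M = 2 * \<beta> / c"

text \<open>Because of this rate, \<open>n + M * L\<close> is conserved under that drift; the power
  \<open>\<beta>\<close> brings it back to the scale of \<open>V\<close>.\<close>

definition h :: "real \<Rightarrow> real \<Rightarrow> real \<Rightarrow> real" where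
  "h n y y' = (n + M * L y y') powr \<beta>"

lemma \<beta>_gt_1: "1 < \<beta>"
  using \<gamma> \<kappa>_gt by (simp add: \<beta>_def)

lemma M_pos: "0 < M"
  using \<beta>_gt_1 c_pos by (simp add: M_def)

lemma V_ge_2: "y \<in> {-1<..<1} \<Longrightarrow> y' \<in> {-1<..<1} \<Longrightarrow> 2 \<le> V y y'"
  using w_ge_1[of y] w_ge_1[of y'] by (simp add: V_def)

lemma L_ge_1: "y \<in> {-1<..<1} \<Longrightarrow> y' \<in> {-1<..<1} \<Longrightarrow> 1 \<le> L y y'"
  using V_ge_2[of y y'] \<beta>_gt_1 by (auto simp: L_def intro!: ge_one_powr_ge_zero)

lemma L_powr_\<beta>: "y \<in> {-1<..<1} \<Longrightarrow> y' \<in> {-1<..<1} \<Longrightarrow> L y y' powr \<beta> = V y y'"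
  using V_ge_2[of y y'] \<beta>_gt_1 by (simp add: L_def powr_powr)

text \<open>\<open>\<beta>\<close> is chosen so that \<open>\<rho>\<close> is
  \<open>w powr (- 1 / \<beta>)\<close>.\<close>

lemma \<rho>_L:
  assumes "y \<in> {-1<..<1}" "w y \<le> x"
  shows "1 \<le> \<rho> y * x powr (1 / \<beta>)"
proof -
  have y: "\<bar>y\<bar> < 1" using assms by auto
  have "\<rho> y * w y powr (1 / \<beta>) = 1"
    using y \<kappa>_gt by (simp add: \<rho>_def w_def powr_powr \<beta>_def flip: powr_add)
  moreover have "\<rho> y * w y powr (1 / \<beta>) \<le> \<rho> y * x powr (1 / \<beta>)"
    using assms w_pos[of y] \<beta>_gt_1 by (intro mult_left_mono powr_mono2) (auto simp: \<rho>_nonneg)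
  ultimately show ?thesis by simp
qed

text \<open>The coupling property: each coordinate by itself moves according to
  \<open>P\<close>.\<close>

lemma Q_sum: "Q (\<lambda>y y'. f y + g y') y y' = P f y + P g y'"
  by (simp add: Q_def P_def algebra_simps)

text \<open>Comparison on ordered pairs is enough, since all three outcomes of a coupled step are
  ordered; separated copies have \<open>gL y < 0 < gR y'\<close>.\<close>

lemma Q_mono:
  assumes "-1 < y" "y \<le> y'" "y' < 1"
    and "\<And>a b. -1 < a \<Longrightarrow> a \<le> b \<Longrightarrow> b < 1 \<Longrightarrow> F a b \<le> G a b"
  shows "Q F y y' \<le> Q G y y'"
proof -
  have "gL y \<le> gR y'" using gL_range[of y] gR_range[of y'] assms by auto
  then show ?thesis
    unfolding Q_def
    using assms p_bounds[of y] p_bounds[of y'] p_mono[of y y'] gR_range[of y] gR_range[of y']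
      gL_range[of y] gL_range[of y'] gR_mono[of y y'] gL_mono[of y y']
    by (intro add_mono mult_left_mono assms(4)) auto
qed

lemma Q_const: "Q (\<lambda>_ _. a) y y' = a"
  by (simp add: Q_def algebra_simps)

lemma Q_linear: "Q (\<lambda>y y'. a * F y y' + b * G y y') y y' = a * Q F y y' + b * Q G y y'"
  by (simp add: Q_def algebra_simps)

lemma Q_cmult: "Q (\<lambda>y y'. a * F y y') y y' = a * Q F y y'"
  by (simp add: Q_def algebra_simps)

text \<open>Both weights are at most \<open>V\<close>, so \<open>\<rho> >= 1 / L\<close> at both
  points, and the two drifts of \<open>w\<close> add up.\<close>

lemma Q_V:
  assumes "-1 < y" "y \<le> y'" "y' < 1"
  shows "Q V y y' \<le> V y y' - c * (V y y' / L y y') + 2"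
proof -
  have L: "0 < L y y'" using L_ge_1[of y y'] assms by auto
  have *: "c * (w t / L y y') \<le> c * (\<rho> t * w t)" if "t \<in> {y, y'}" for t
  proof -
    have t: "t \<in> {-1<..<1}" "w t \<le> V y y'"
      using that assms w_pos[of y] w_pos[of y'] by (auto simp: V_def)
    have "1 / L y y' \<le> \<rho> t"
      using \<rho>_L[OF t] L by (simp add: L_def divide_simps)
    then have "w t * (1 / L y y') \<le> w t * \<rho> t"
      using w_pos[OF t(1)] by (intro mult_left_mono) auto
    then show ?thesis using c_pos by (intro mult_left_mono) (auto simp: mult.commute)
  qed
  have "Q V y y' = P w y + P w y'"
    by (simp add: V_def[abs_def] Q_sum)
  also have "\<dots> \<le> (w y - c * (\<rho> y * w y) + 1) + (w y' - c * (\<rho> y' * w y') + 1)"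
    using assms by (intro add_mono P_w) auto
  also have "\<dots> \<le> V y y' - c * (V y y' / L y y') + 2"
    using *[of y] *[of y'] by (simp add: V_def add_divide_distrib algebra_simps)
  finally show ?thesis .
qed

lemma h_pos:
  assumes "0 \<le> n" "y \<in> {-1<..<1}" "y' \<in> {-1<..<1}"
  shows "0 < h n y y'"
proof -
  have "0 < n + M * L y y'"
    using L_ge_1[of y y'] M_pos assms by (intro add_nonneg_pos mult_pos_pos) auto
  then show ?thesis by (simp add: h_def)
qed

text \<open>With \<open>t\<close> the share of \<open>M * L\<close> in \<open>s\<close>, convexity
  bounds \<open>h (n + 1)\<close> after the step by a function affine in \<open>V\<close>; applying
  \<open>Q\<close> leaves only \<open>Q V\<close>.\<close>

lemma Q_h:
  assumes n: "0 \<le> n" and y: "-1 < y" "y \<le> y'" "y' < 1"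
  defines "s \<equiv> n + 1 + M * L y y'"
  shows "Q (h (n + 1)) y y' \<le> s powr \<beta> * ((n + 1) / s + M * L y y' / s * (Q V y y' / V y y'))"
proof -
  have yy: "y \<in> {-1<..<1}" "y' \<in> {-1<..<1}" using y by auto
  note Lp = L_ge_1[OF yy] and Mp = M_pos
  have s: "0 < s" using Lp Mp n by (auto simp: s_def intro!: add_nonneg_pos)
  define t where "t = M * L y y' / s"
  have t: "0 \<le> t" "t \<le> 1" "(n + 1) / s = 1 - t"
    using s n Lp Mp by (auto simp: t_def s_def field_simps)
  have "h (n + 1) a b \<le> (s powr \<beta> * ((n + 1) / s)) * 1 + (s powr \<beta> * (t / V y y')) * V a b"
    if ab: "-1 < a" "a \<le> b" "b < 1" for a b
  proof -
    have abin: "a \<in> {-1<..<1}" "b \<in> {-1<..<1}" using ab by auto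
    have "s * ((n + 1) / s) = n + 1" "s * (t * (L a b / L y y')) = M * L a b"
      using s Lp by (auto simp: t_def)
    then have "s * ((n + 1) / s + t * (L a b / L y y')) = n + 1 + M * L a b"
      by (simp only: distrib_left)
    then have "h (n + 1) a b = (s * (1 - t + t * (L a b / L y y'))) powr \<beta>"
      by (simp add: h_def t)
    also have "\<dots> = s powr \<beta> * (1 - t + t * (L a b / L y y')) powr \<beta>"
      by (simp add: powr_mult)
    also have "\<dots> \<le> s powr \<beta> * (1 - t + t * (L a b powr \<beta> / L y y' powr \<beta>))"
      using \<beta>_gt_1 Lp L_ge_1[OF abin] t by (intro mult_left_mono powr_tangent) auto
    also have "\<dots> = (s powr \<beta> * ((n + 1) / s)) * 1 + (s powr \<beta> * (t / V y y')) * V a b"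
      by (simp only: L_powr_\<beta>[OF yy] L_powr_\<beta>[OF abin] t(3)) (simp add: algebra_simps)
    finally show ?thesis .
  qed
  from Q_mono[OF y this]
  have "Q (h (n + 1)) y y' \<le> (s powr \<beta> * ((n + 1) / s)) * 1 + (s powr \<beta> * (t / V y y')) * Q V y y'"
    by (simp only: Q_linear Q_const)
  also have "\<dots> = s powr \<beta> * ((n + 1) / s + t * (Q V y y' / V y y'))"
    by (simp add: algebra_simps)
  finally show ?thesis by (simp add: t_def)
qed

text \<open>Bernoulli's inequality for the passage from \<open>s\<close> to \<open>s - 1\<close>:
  the price of one unit of time.\<close>

lemma shift_powr:
  assumes "0 \<le> n" "y \<in> {-1<..<1}" "y' \<in> {-1<..<1}"
  defines "s \<equiv> n + 1 + M * L y y'"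
  shows "s powr \<beta> * (1 - \<beta> / s) \<le> h n y y'"
proof -
  have s: "1 \<le> s" using L_ge_1[OF assms(2,3)] M_pos assms(1) by (simp add: s_def)
  have "s powr \<beta> * (1 - \<beta> * (1 / s)) \<le> s powr \<beta> * (1 - 1 / s) powr \<beta>"
    using s \<beta>_gt_1 by (intro mult_left_mono powr_Bernoulli) auto
  also have "\<dots> = (s * (1 - 1 / s)) powr \<beta>" by (simp add: powr_mult)
  also have "s * (1 - 1 / s) = n + M * L y y'" using s by (simp add: s_def right_diff_distrib)
  finally show ?thesis by (simp add: h_def)
qed

text \<open>Where \<open>V / L >= 4 / c\<close>, half of the drift absorbs the constant 2 of
  \<open>Q_V\<close>. The other half gives a relative loss \<open>\<beta> / s\<close>, because
  \<open>M * c / 2 = \<beta>\<close>, and this is exactly the price of one unit of time.\<close>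

lemma Q_h_outside:
  assumes n: "0 \<le> n" and y: "-1 < y" "y \<le> y'" "y' < 1"
    and far: "4 / c \<le> V y y' / L y y'"
  shows "Q (h (n + 1)) y y' \<le> h n y y'"
proof -
  have yy: "y \<in> {-1<..<1}" "y' \<in> {-1<..<1}" using y by auto
  note Lp = L_ge_1[OF yy] and Mp = M_pos and Vp = V_ge_2[OF yy]
  define s where "s = n + 1 + M * L y y'"
  have s: "0 < s" using Lp Mp n by (auto simp: s_def intro!: add_nonneg_pos)
  have "2 \<le> c / 2 * (V y y' / L y y')" using far c_pos by (simp add: field_simps)
  then have "Q V y y' \<le> V y y' - c / 2 * (V y y' / L y y')"
    using Q_V[OF y] by linarith
  then have "Q V y y' / V y y' \<le> (V y y' - c / 2 * (V y y' / L y y')) / V y y'"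
    using Vp by (intro divide_right_mono) auto
  also have "\<dots> = 1 - c / 2 / L y y'" using Vp by (simp add: diff_divide_distrib)
  finally have "Q (h (n + 1)) y y' \<le> s powr \<beta> * ((n + 1) / s + M * L y y' / s * (1 - c / 2 / L y y'))"
    using Lp Mp s by (intro order_trans[OF Q_h[OF n y, folded s_def]] mult_left_mono add_left_mono) auto
  also have "(n + 1) / s + M * L y y' / s * (1 - c / 2 / L y y') = (n + 1 + M * L y y') / s - M * c / 2 / s"
    using Lp by (simp add: right_diff_distrib add_divide_distrib)
  also have "\<dots> = s / s - \<beta> / s"
    using c_pos by (simp add: s_def M_def)
  also have "\<dots> = 1 - \<beta> / s" using s by simp
  also have "s powr \<beta> * (1 - \<beta> / s) \<le> h n y y'"
    using shift_powr[OF n yy] by (simp add: s_def)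
  finally show ?thesis .
qed

text \<open>Since \<open>V >= 2\<close>, one step at most doubles the mean of \<open>V\<close>. For
  large \<open>n\<close> the share of \<open>M * l\<close> in \<open>s\<close> is small, so
  \<open>h\<close> grows only by a factor close to 1.\<close>

lemma Q_h_inside:
  assumes a: "0 < a" and y: "-1 < y" "y \<le> y'" "y' < 1"
    and L: "L y y' \<le> l" and n: "(M * l + (1 + a) * \<beta>) / a \<le> n" and l: "0 \<le> l"
  shows "Q (h (n + 1)) y y' \<le> (1 + a) * h n y y'"
proof -
  have yy: "y \<in> {-1<..<1}" "y' \<in> {-1<..<1}" using y by auto
  note Lp = L_ge_1[OF yy] and Mp = M_pos and Vp = V_ge_2[OF yy]
  have an: "M * l + (1 + a) * \<beta> \<le> a * n"
    using n a by (simp add: pos_divide_le_eq mult.commute)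
  have n0: "0 \<le> n"
  proof -
    have "0 \<le> (M * l + (1 + a) * \<beta>) / a" using Mp l a \<beta>_gt_1 by simp
    with n show ?thesis by linarith
  qed
  define s where "s = n + 1 + M * L y y'"
  have MLp: "0 < M * L y y'" using Mp Lp by simp
  have s: "0 < s" "n \<le> s" using MLp n0 by (auto simp: s_def)
  have "Q V y y' \<le> V y y' + 2"
  proof -
    have "0 \<le> c * (V y y' / L y y')" using c_pos Vp Lp by simp
    then show ?thesis using Q_V[OF y] by linarith
  qed
  then have "Q V y y' / V y y' \<le> 2" using Vp by (simp add: pos_divide_le_eq)
  then have "Q (h (n + 1)) y y' \<le> s powr \<beta> * ((n + 1) / s + M * L y y' / s * 2)"
    using MLp s by (intro order_trans[OF Q_h[OF n0 y, folded s_def]] mult_left_mono add_left_mono) auto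
  also have "(n + 1) / s + M * L y y' / s * 2 = (n + 1 + M * L y y' * 2) / s"
    by (simp only: add_divide_distrib times_divide_eq_left)
  also have "n + 1 + M * L y y' * 2 = s + M * L y y'" by (simp add: s_def)
  also have "(s + M * L y y') / s = 1 + M * L y y' / s"
    using s by (simp add: add_divide_distrib)
  also have "\<dots> \<le> (1 + a) * (1 - \<beta> / s)"
  proof -
    have "M * L y y' \<le> M * l" using L Mp by simp
    moreover have "a * n \<le> a * s" using s a by simp
    ultimately have "M * L y y' + (1 + a) * \<beta> \<le> a * s" using an by linarith
    then have "(M * L y y' + (1 + a) * \<beta>) / s \<le> a" using s by (simp add: pos_divide_le_eq)
    then show ?thesis by (simp add: add_divide_distrib algebra_simps)
  qed
  also have "s powr \<beta> * ((1 + a) * (1 - \<beta> / s)) = (1 + a) * (s powr \<beta> * (1 - \<beta> / s))"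
    by simp
  also have "\<dots> \<le> (1 + a) * h n y y'"
    using shift_powr[OF n0 yy] a by (intro mult_left_mono) (auto simp: s_def)
  finally show ?thesis using s by (simp add: mult_left_mono)
qed

section \<open>Contraction of W where V is bounded, and the supermartingale\<close>

lemma W_le_1: "-1 < a \<Longrightarrow> a \<le> b \<Longrightarrow> b < 1 \<Longrightarrow> W a b \<le> 1"
  by (rule W_bounds)

lemma Q_W:
  assumes y: "-1 < y" "y \<le> y'" "y' < 1"
  shows "Q W y y' \<le> W y y' - (\<gamma> - 1) * (y' - y) * exp (- A * (\<phi> y' - \<phi> y))"
proof -
  have "(p y' - p y) * W (gL y) (gR y') \<le> (p y' - p y) * 1"
    using p_mono[of y y'] gL_range[of y] gR_range[of y'] y
    by (intro mult_left_mono W_le_1) auto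
  then show ?thesis using W_step[OF y] by (simp add: Q_def)
qed

text \<open>\<open>w\<close> increases away from 0, so on \<open>[y, y']\<close> it is bounded by
  its value at one of the ends.\<close>

lemma \<phi>_le:
  assumes y: "-1 < y" "y \<le> y'" "y' < 1"
  shows "\<phi> y' - \<phi> y \<le> V y y' * (y' - y)"
proof -
  have "V y y' * y - \<phi> y \<le> V y y' * y' - \<phi> y'"
  proof (rule DERIV_nonneg_imp_nondecreasing[OF y(2)])
    fix t assume t: "y \<le> t" "t \<le> y'"
    then have t1: "t \<in> {-1<..<1}" using y by auto
    have "w t \<le> w (if 0 \<le> t then y' else y)"
      unfolding w_def using t y \<kappa>_gt by (intro powr_mono2') auto
    then have "w t \<le> V y y'"
      using w_pos[of y] w_pos[of y'] y by (auto simp: V_def split: if_splits)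
    moreover have "((\<lambda>t. V y y' * t - \<phi> t) has_real_derivative V y y' * 1 - w t) (at t)"
      by (intro DERIV_diff \<phi>_deriv[OF t1] DERIV_ident DERIV_cmult)
    ultimately show "\<exists>D. ((\<lambda>t. V y y' * t - \<phi> t) has_real_derivative D) (at t) \<and> 0 \<le> D"
      by (intro exI[of _ "V y y' * 1 - w t"]) auto
  qed
  then show ?thesis by (simp add: algebra_simps)
qed

text \<open>For \<open>V <= R\<close> the \<open>\<phi>\<close>-distance is at most
  \<open>R * (y' - y)\<close>, hence at most \<open>2 * R\<close>. So \<open>y' - y\<close>
  dominates a multiple of \<open>W\<close>, and the exponential in the gain is bounded
  below.\<close>

lemma Q_W_inside:
  assumes y: "-1 < y" "y \<le> y'" "y' < 1" and V: "V y y' \<le> R"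
  shows "Q W y y' \<le> (1 - (\<gamma> - 1) * exp (- (2 * A * R)) / (A * R)) * W y y'"
proof -
  have R: "0 < R" using V_ge_2[of y y'] y V by auto
  have le: "\<phi> y' - \<phi> y \<le> R * (y' - y)"
    using \<phi>_le[OF y] mult_right_mono[OF V, of "y' - y"] y by auto
  have "W y y' \<le> A * (\<phi> y' - \<phi> y)" using W_bounds[OF y] by auto
  also have "\<dots> \<le> A * (R * (y' - y))" using le A_pos by (intro mult_left_mono) auto
  also have "\<dots> = (y' - y) * (A * R)" by simp
  finally have "W y y' / (A * R) \<le> y' - y" using A_pos R by (subst pos_divide_le_eq) auto
  then have "(\<gamma> - 1) * exp (- (2 * A * R)) * (W y y' / (A * R)) \<le> (\<gamma> - 1) * exp (- (2 * A * R)) * (y' - y)"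
    using \<gamma> by (intro mult_left_mono) auto
  also have "\<dots> \<le> (\<gamma> - 1) * exp (- A * (\<phi> y' - \<phi> y)) * (y' - y)"
  proof (intro mult_right_mono mult_left_mono)
    have "R * (y' - y) \<le> R * 2" using R y by (intro mult_left_mono) auto
    with le have "\<phi> y' - \<phi> y \<le> R * 2" by linarith
    from mult_left_mono[OF this, of A] show "exp (- (2 * A * R)) \<le> exp (- A * (\<phi> y' - \<phi> y))"
      using A_pos by (simp add: mult_ac)
  qed (use \<gamma> y in auto)
  also have "\<dots> = (\<gamma> - 1) * (y' - y) * exp (- A * (\<phi> y' - \<phi> y))" by simp
  finally have "Q W y y' \<le> W y y' - (\<gamma> - 1) * exp (- (2 * A * R)) * (W y y' / (A * R))"
    using Q_W[OF y] by linarith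
  also have "\<dots> = (1 - (\<gamma> - 1) * exp (- (2 * A * R)) / (A * R)) * W y y'"
    by (simp add: left_diff_distrib)
  finally show ?thesis .
qed

text \<open>\<open>V / L\<close> is a power of \<open>V\<close> with exponent
  \<open>1 - 1 / \<beta> > 0\<close>, so the region left over by \<open>Q_h_outside\<close> lies in
  a sublevel set of \<open>V\<close>.\<close>

lemma bounded_inside:
  obtains R where "0 < R"
    "\<And>y y'. y \<in> {-1<..<1} \<Longrightarrow> y' \<in> {-1<..<1} \<Longrightarrow> V y y' / L y y' < 4 / c \<Longrightarrow> V y y' \<le> R"
proof
  define s where "s = 1 - 1 / \<beta>"
  have s: "0 < s" using \<beta>_gt_1 by (simp add: s_def)
  show "0 < (4 / c) powr (1 / s)" using c_pos by simp
  fix y y' assume y: "y \<in> {-1<..<1}" "y' \<in> {-1<..<1}" and lt: "V y y' / L y y' < 4 / c"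
  have V: "2 \<le> V y y'" using V_ge_2[OF y] .
  have "V y y' powr s = V y y' / L y y'"
    using V by (simp add: s_def L_def powr_diff)
  with lt have "V y y' powr s \<le> 4 / c" by simp
  then have "(V y y' powr s) powr (1 / s) \<le> (4 / c) powr (1 / s)"
    using s by (intro powr_mono2) auto
  then show "V y y' \<le> (4 / c) powr (1 / s)" using s V by (simp add: powr_powr)
qed

definition H :: "real \<Rightarrow> real \<Rightarrow> real \<Rightarrow> real \<Rightarrow> real" where
  "H \<epsilon> n y y' = h n y y' powr (1 - \<epsilon>) * W y y' powr \<epsilon>"

text \<open>Young's inequality bounds the ratio of \<open>H\<close> by the weighted mean of the
  ratios of \<open>h\<close> and \<open>W\<close>. Growth of \<open>h\<close> at rate
  \<open>\<epsilon> * t\<close> and decay of \<open>W\<close> at rate \<open>t\<close> then combine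
  to the factor \<open>1 - \<epsilon> * \<epsilon> * t\<close>.\<close>

lemma Q_H_le:
  assumes \<epsilon>: "0 < \<epsilon>" "\<epsilon> < 1" and n: "0 \<le> n" and t: "0 \<le> t" and y: "-1 < y" "y \<le> y'" "y' < 1"
    and h: "Q (h (n + 1)) y y' \<le> (1 + \<epsilon> * t) * h n y y'" and W: "Q W y y' \<le> (1 - t) * W y y'"
  shows "Q (H \<epsilon> (n + 1)) y y' \<le> H \<epsilon> n y y'"
\<comment> \<open>The diagonal is preserved by the coupling, and \<open>W\<close> and
  \<open>H\<close> vanish there; off it, division by \<open>W\<close> is possible.\<close>
proof (cases "y = y'")
  case True
  then show ?thesis by (simp add: Q_def H_def W_def)
next
  case False
  have yy: "y \<in> {-1<..<1}" "y' \<in> {-1<..<1}" "y < y'" using y False by auto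
  have hp: "0 < h n y y'" using h_pos[OF n] yy by auto
  have Wp: "0 < W y y'" using W_bounds[OF y] yy by auto
  define k where "k = H \<epsilon> n y y'"
  have k: "0 < k" using hp Wp by (simp add: k_def H_def)
  have "H \<epsilon> (n + 1) a b \<le> (k * (1 - \<epsilon>) / h n y y') * h (n + 1) a b + (k * \<epsilon> / W y y') * W a b"
    if ab: "-1 < a" "a \<le> b" "b < 1" for a b
  proof (cases "a = b")
    case True
    then show ?thesis
      using h_pos[of "n + 1" a b] hp k \<epsilon> n ab by (simp add: H_def W_def)
  next
    case False
    have p: "0 < h (n + 1) a b / h n y y'" "0 < W a b / W y y'"
      using h_pos[of "n + 1" a b] hp W_bounds(3)[OF ab] Wp ab n False by auto
    have "H \<epsilon> (n + 1) a b
        = k * ((h (n + 1) a b / h n y y') powr (1 - \<epsilon>) * (W a b / W y y') powr \<epsilon>)"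
      using hp Wp by (simp add: H_def k_def powr_divide)
    also have "\<dots> \<le> k * ((1 - \<epsilon>) * (h (n + 1) a b / h n y y') + \<epsilon> * (W a b / W y y'))"
      using k \<epsilon> p by (intro mult_left_mono Youngs_inequality_0) auto
    finally show ?thesis by (simp add: algebra_simps)
  qed
  from Q_mono[OF y this]
  have "Q (H \<epsilon> (n + 1)) y y'
      \<le> (k * (1 - \<epsilon>) / h n y y') * Q (h (n + 1)) y y' + (k * \<epsilon> / W y y') * Q W y y'"
    by (simp only: Q_linear)
  also have "\<dots> \<le> (k * (1 - \<epsilon>) / h n y y') * ((1 + \<epsilon> * t) * h n y y')
      + (k * \<epsilon> / W y y') * ((1 - t) * W y y')"
    using k \<epsilon> hp Wp h W by (intro add_mono mult_left_mono) auto
  also have "\<dots> = k * ((1 - \<epsilon>) * (1 + \<epsilon> * t) + \<epsilon> * (1 - t))"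
    using hp Wp by (simp add: distrib_left mult.assoc)
  also have "(1 - \<epsilon>) * (1 + \<epsilon> * t) + \<epsilon> * (1 - t) = 1 - \<epsilon> * \<epsilon> * t"
    by (simp add: algebra_simps)
  finally have *: "Q (H \<epsilon> (n + 1)) y y' \<le> k * (1 - \<epsilon> * \<epsilon> * t)" .
  have "k * (1 - \<epsilon> * \<epsilon> * t) \<le> k * 1" using k \<epsilon> t by (intro mult_left_mono) auto
  with * show ?thesis by (simp add: k_def)
qed

lemma Q_H:
  assumes \<epsilon>: "0 < \<epsilon>" "\<epsilon> < 1"
  obtains n0 where "1 \<le> n0"
    "\<And>n y y'. n0 \<le> n \<Longrightarrow> -1 < y \<Longrightarrow> y \<le> y' \<Longrightarrow> y' < 1 \<Longrightarrow> Q (H \<epsilon> (n + 1)) y y' \<le> H \<epsilon> n y y'"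
proof -
  obtain R where R: "0 < R"
    "\<And>y y'. y \<in> {-1<..<1} \<Longrightarrow> y' \<in> {-1<..<1} \<Longrightarrow> V y y' / L y y' < 4 / c \<Longrightarrow> V y y' \<le> R"
    using bounded_inside by metis
  define t where "t = (\<gamma> - 1) * exp (- (2 * A * R)) / (A * R)"
  have t: "0 < t" using \<gamma> A_pos R by (simp add: t_def)
  define l where "l = R powr (1 / \<beta>)"
  \<comment> \<open>The time from which \<open>Q_h_inside\<close> applies with
    \<open>a = \<epsilon> * t\<close>, the growth rate that the contraction of \<open>W\<close> can
    compensate.\<close>
  define n0 where "n0 = max 1 ((M * l + (1 + \<epsilon> * t) * \<beta>) / (\<epsilon> * t))"
  show ?thesis
  proof (rule that[of n0])
    fix n y y' :: real
    assume n: "n0 \<le> n" and y: "-1 < y" "y \<le> y'" "y' < 1"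
    have n1: "0 \<le> n" "(M * l + (1 + \<epsilon> * t) * \<beta>) / (\<epsilon> * t) \<le> n" using n by (auto simp: n0_def)
    have yy: "y \<in> {-1<..<1}" "y' \<in> {-1<..<1}" using y by auto
    show "Q (H \<epsilon> (n + 1)) y y' \<le> H \<epsilon> n y y'"
    proof (cases "4 / c \<le> V y y' / L y y'")
      case True
      have "0 \<le> (\<gamma> - 1) * (y' - y) * exp (- A * (\<phi> y' - \<phi> y))" using \<gamma> y by simp
      then have "Q W y y' \<le> W y y'" using Q_W[OF y] by linarith
      then show ?thesis
        using Q_H_le[OF \<epsilon> n1(1) order.refl y] Q_h_outside[OF n1(1) y True] by simp
    next
      case False
      then have V: "V y y' \<le> R" using R(2)[OF yy] by simp
      then have "L y y' \<le> l"
        unfolding L_def l_def using V_ge_2[OF yy] \<beta>_gt_1 by (intro powr_mono2) auto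
      then have "Q (h (n + 1)) y y' \<le> (1 + \<epsilon> * t) * h n y y'"
        using n1 \<epsilon> t y by (intro Q_h_inside[of _ _ _ l]) (auto simp: l_def)
      then show ?thesis
        using Q_H_le[OF \<epsilon> n1(1) less_imp_le[OF t] y] Q_W_inside[OF y V] by (simp add: t_def)
    qed
  qed (simp add: n0_def)
qed

section \<open>Decay of the expected distance after many coupled steps\<close>

lemma Q_iter_mono:
  assumes "\<And>a b. -1 < a \<Longrightarrow> a \<le> b \<Longrightarrow> b < 1 \<Longrightarrow> F a b \<le> G a b"
  shows "-1 < y \<Longrightarrow> y \<le> y' \<Longrightarrow> y' < 1 \<Longrightarrow> (Q ^^ k) F y y' \<le> (Q ^^ k) G y y'"
proof (induction k arbitrary: y y')
  case (Suc k)
  then show ?case by (auto intro!: Q_mono)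
qed (use assms in auto)

lemma Q_iter_const: "(Q ^^ k) (\<lambda>_ _. a) y y' = a"
proof (induction k arbitrary: y y')
  case (Suc k)
  then have "(Q ^^ k) (\<lambda>_ _. a) = (\<lambda>_ _. a)" by blast
  then show ?case by (simp add: Q_const)
qed simp

lemma Q_iter_H:
  assumes n0: "\<And>n y y'. n0 \<le> n \<Longrightarrow> -1 < y \<Longrightarrow> y \<le> y' \<Longrightarrow> y' < 1 \<Longrightarrow> Q (H \<epsilon> (n + 1)) y y' \<le> H \<epsilon> n y y'"
    and a: "0 \<le> a" and y: "-1 < y" "y \<le> y'" "y' < 1"
  shows "(Q ^^ k) (\<lambda>y y'. a * H \<epsilon> (n0 + real k) y y') y y' \<le> a * H \<epsilon> n0 y y'"
proof (induction k)
  case (Suc k)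
  have "(Q ^^ Suc k) (\<lambda>y y'. a * H \<epsilon> (n0 + real (Suc k)) y y') y y'
      = (Q ^^ k) (Q (\<lambda>y y'. a * H \<epsilon> (n0 + real k + 1) y y')) y y'"
    by (simp add: funpow_swap1 add_ac)
  also have "\<dots> \<le> (Q ^^ k) (\<lambda>y y'. a * H \<epsilon> (n0 + real k) y y') y y'"
    using y a by (intro Q_iter_mono) (auto simp: Q_cmult intro!: mult_left_mono n0)
  also have "\<dots> \<le> a * H \<epsilon> n0 y y'" by (rule Suc.IH)
  finally show ?case .
qed simp

text \<open>The final exponent. Being above 1, it makes the mean of \<open>\<theta> k\<close> of the
  order of the claimed rate; being below \<open>\<kappa>\<close>, it leaves a positive
  \<open>\<epsilon> = 1 - \<eta> / \<kappa>\<close>.\<close>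

definition \<eta> :: real where
  "\<eta> = (1 + \<kappa>) / 2"

lemma \<eta>: "1 < \<eta>" "\<eta> < \<kappa>"
  using \<kappa>_gt by (auto simp: \<eta>_def)

text \<open>As \<open>W <= 1\<close>, it is at most \<open>W powr \<epsilon>\<close>, hence at most
  \<open>real k powr (- b)\<close> times \<open>H\<close> at time \<open>n0 + k\<close>. The
  supermartingale returns this to time \<open>n0\<close>, where \<open>L >= 1\<close> and
  subadditivity of the power \<open>\<eta> / \<kappa>\<close> separate the two points.\<close>

lemma Q_iter_W_le:
  obtains C where "0 < C"
    "\<And>k y y'. 1 \<le> k \<Longrightarrow> -1 < y \<Longrightarrow> y \<le> y' \<Longrightarrow> y' < 1 \<Longrightarrow>
      (Q ^^ k) W y y' \<le> C * (real k powr (- 1 / (\<gamma> - 1))) powr \<eta>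
        * ((1 - \<bar>y\<bar>) powr (- \<eta>) + (1 - \<bar>y'\<bar>) powr (- \<eta>))"
proof -
  define \<epsilon> where "\<epsilon> = 1 - \<eta> / \<kappa>"
  have \<epsilon>: "0 < \<epsilon>" "\<epsilon> < 1" using \<eta> by (auto simp: \<epsilon>_def)
  define b where "b = \<eta> / (\<gamma> - 1)"
  have b: "\<beta> * (1 - \<epsilon>) = b" "0 < b"
    using \<kappa>_gt \<gamma> \<eta> by (auto simp: \<epsilon>_def b_def \<beta>_def)
  obtain n0 where n0: "1 \<le> n0"
    "\<And>n y y'. n0 \<le> n \<Longrightarrow> -1 < y \<Longrightarrow> y \<le> y' \<Longrightarrow> y' < 1 \<Longrightarrow> Q (H \<epsilon> (n + 1)) y y' \<le> H \<epsilon> n y y'"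
    using Q_H[OF \<epsilon>] by metis
  have H: "H \<epsilon> n y y' = (n + M * L y y') powr b * W y y' powr \<epsilon>" for n y y'
    by (simp add: H_def h_def powr_powr b)
  show ?thesis
  proof (rule that[of "(n0 + M) powr b"])
    fix k :: nat and y y' :: real
    assume k: "1 \<le> k" and y: "-1 < y" "y \<le> y'" "y' < 1"
    have yy: "y \<in> {-1<..<1}" "y' \<in> {-1<..<1}" using y by auto
    define a where "a = real k powr (- b)"
    have W: "W u v \<le> a * H \<epsilon> (n0 + real k) u v" if uv: "-1 < u" "u \<le> v" "v < 1" for u v
    proof -
      have L: "1 \<le> L u v" using L_ge_1[of u v] uv by auto
      have "W u v = W u v powr 1" using W_bounds[OF uv] by simp
      also have "\<dots> \<le> W u v powr \<epsilon>" using W_bounds[OF uv] \<epsilon> by (intro powr_mono') auto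
      also have "\<dots> = (a * real k powr b) * W u v powr \<epsilon>"
        using k by (simp add: a_def flip: powr_add)
      also have "\<dots> \<le> (a * (n0 + real k + M * L u v) powr b) * W u v powr \<epsilon>"
        using n0 M_pos L b by (intro mult_right_mono mult_left_mono powr_mono2) (auto simp: a_def)
      finally show ?thesis by (simp add: H mult.assoc)
    qed
    have "(Q ^^ k) W y y' \<le> (Q ^^ k) (\<lambda>y y'. a * H \<epsilon> (n0 + real k) y y') y y'"
      by (intro Q_iter_mono W y)
    also have "\<dots> \<le> a * H \<epsilon> n0 y y'"
      by (intro Q_iter_H n0 y) (auto simp: a_def)
    also have "\<dots> \<le> a * ((n0 + M) powr b * (w y powr (\<eta> / \<kappa>) + w y' powr (\<eta> / \<kappa>)))"
    proof (intro mult_left_mono)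
      have L: "1 \<le> L y y'" using L_ge_1[of y y'] y by auto
      have "W y y' powr \<epsilon> \<le> 1"
        using W_bounds[OF y] \<epsilon> by (intro powr_le1) auto
      then have "H \<epsilon> n0 y y' \<le> (n0 + M * L y y') powr b"
        unfolding H by (intro mult_left_le) auto
      also have "\<dots> \<le> ((n0 + M) * L y y') powr b"
      proof (intro powr_mono2)
        show "n0 + M * L y y' \<le> (n0 + M) * L y y'"
          using L n0 mult_left_mono[of 1 "L y y'" n0] by (simp add: algebra_simps)
      qed (use b n0 L M_pos in auto)
      also have "\<dots> = (n0 + M) powr b * V y y' powr (\<eta> / \<kappa>)"
        using \<kappa>_gt \<gamma> by (simp add: powr_mult L_def powr_powr \<beta>_def b_def)
      also have "\<dots> \<le> (n0 + M) powr b * (w y powr (\<eta> / \<kappa>) + w y' powr (\<eta> / \<kappa>))"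
        unfolding V_def using w_pos yy \<eta> by (intro mult_left_mono powr_add_le) auto
      finally show "H \<epsilon> n0 y y' \<le> (n0 + M) powr b * (w y powr (\<eta> / \<kappa>) + w y' powr (\<eta> / \<kappa>))" .
    qed (simp add: a_def)
    also have "a = (real k powr (- 1 / (\<gamma> - 1))) powr \<eta>"
      by (simp add: a_def b_def powr_powr)
    finally have *: "(Q ^^ k) W y y' \<le> (real k powr (- 1 / (\<gamma> - 1))) powr \<eta>
        * ((n0 + M) powr b * (w y powr (\<eta> / \<kappa>) + w y' powr (\<eta> / \<kappa>)))" .
    have "w u powr (\<eta> / \<kappa>) = (1 - \<bar>u\<bar>) powr (- \<eta>)" for u
      using \<eta> by (auto simp: w_def powr_powr)
    with * show "(Q ^^ k) W y y' \<le> (n0 + M) powr b * (real k powr (- 1 / (\<gamma> - 1))) powr \<eta>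
        * ((1 - \<bar>y\<bar>) powr (- \<eta>) + (1 - \<bar>y'\<bar>) powr (- \<eta>))"
      by (simp add: mult_ac)
  qed (use n0 M_pos in auto)
qed

text \<open>With \<open>\<delta> = real k powr (- 1 / (\<gamma> - 1))\<close>, this is a continuous
  substitute, up to the factor \<open>2 powr \<eta>\<close>, for the minimum of 1 and
  \<open>(\<delta> / (1 - \<bar>y\<bar>)) powr \<eta>\<close>.\<close>

definition \<theta> :: "nat \<Rightarrow> real \<Rightarrow> real" where
  "\<theta> k y = (real k powr (- 1 / (\<gamma> - 1)) / (real k powr (- 1 / (\<gamma> - 1)) + (1 - \<bar>y\<bar>))) powr \<eta>"

text \<open>If both points are at least \<open>\<delta>\<close> away from the endpoints, the decay
  estimate applies. Otherwise \<open>W <= 1\<close> suffices, because \<open>\<theta> k\<close> is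
  bounded below near the endpoints.\<close>

lemma Q_iter_W:
  obtains C where "0 < C"
    "\<And>k y y'. 1 \<le> k \<Longrightarrow> -1 < y \<Longrightarrow> y \<le> y' \<Longrightarrow> y' < 1 \<Longrightarrow> (Q ^^ k) W y y' \<le> C * (\<theta> k y + \<theta> k y')"
proof -
  obtain C where C: "0 < C"
    "\<And>k y y'. 1 \<le> k \<Longrightarrow> -1 < y \<Longrightarrow> y \<le> y' \<Longrightarrow> y' < 1 \<Longrightarrow>
      (Q ^^ k) W y y' \<le> C * (real k powr (- 1 / (\<gamma> - 1))) powr \<eta>
        * ((1 - \<bar>y\<bar>) powr (- \<eta>) + (1 - \<bar>y'\<bar>) powr (- \<eta>))"
    using Q_iter_W_le by metis
  define C' where "C' = 2 powr \<eta> * max C 1"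
  have C': "0 < C'" using C by (simp add: C'_def)
  show ?thesis
  proof (rule that[OF C'])
    fix k :: nat and y y' :: real
    assume k: "1 \<le> k" and y: "-1 < y" "y \<le> y'" "y' < 1"
    define \<delta> where "\<delta> = real k powr (- 1 / (\<gamma> - 1))"
    have \<delta>: "0 < \<delta>" using k by (simp add: \<delta>_def)
    have \<theta>: "\<theta> k u = (\<delta> / (\<delta> + (1 - \<bar>u\<bar>))) powr \<eta>" for u by (simp add: \<theta>_def \<delta>_def)
    have \<theta>0: "0 \<le> \<theta> k u" for u by (simp add: \<theta>)
    have far: "\<delta> powr \<eta> * (1 - \<bar>u\<bar>) powr (- \<eta>) \<le> 2 powr \<eta> * \<theta> k u"
      if u: "u \<in> {-1<..<1}" "\<delta> \<le> 1 - \<bar>u\<bar>" for u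
    proof -
      have "\<delta> powr \<eta> * (1 - \<bar>u\<bar>) powr (- \<eta>) = (\<delta> / (1 - \<bar>u\<bar>)) powr \<eta>"
        by (simp add: powr_divide powr_minus_divide)
      also have "\<dots> \<le> (2 * (\<delta> / (\<delta> + (1 - \<bar>u\<bar>)))) powr \<eta>"
      proof (intro powr_mono2)
        have "2 * \<delta> / (2 * (1 - \<bar>u\<bar>)) \<le> 2 * \<delta> / (\<delta> + (1 - \<bar>u\<bar>))"
          using u \<delta> by (intro divide_left_mono mult_pos_pos add_pos_pos) auto
        moreover have "2 * \<delta> / (2 * (1 - \<bar>u\<bar>)) = \<delta> / (1 - \<bar>u\<bar>)"
          by (rule mult_divide_mult_cancel_left) simp
        ultimately show "\<delta> / (1 - \<bar>u\<bar>) \<le> 2 * (\<delta> / (\<delta> + (1 - \<bar>u\<bar>)))"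
          by (simp only: times_divide_eq_right)
      qed (use u \<delta> \<eta> in auto)
      finally show ?thesis by (simp only: powr_mult \<theta>)
    qed
    have near: "1 \<le> 2 powr \<eta> * \<theta> k u" if u: "u \<in> {-1<..<1}" "1 - \<bar>u\<bar> < \<delta>" for u
    proof -
      have "1 powr \<eta> \<le> (2 * (\<delta> / (\<delta> + (1 - \<bar>u\<bar>)))) powr \<eta>"
        using u \<delta> \<eta> by (intro powr_mono2) (auto simp: field_simps)
      then show ?thesis by (simp only: powr_mult \<theta> powr_one_eq_one)
    qed
    show "(Q ^^ k) W y y' \<le> C' * (\<theta> k y + \<theta> k y')"
    proof (cases "\<delta> \<le> 1 - \<bar>y\<bar> \<and> \<delta> \<le> 1 - \<bar>y'\<bar>")
      case True
      have "(Q ^^ k) W y y' \<le> C * (\<delta> powr \<eta> * (1 - \<bar>y\<bar>) powr (- \<eta>) + \<delta> powr \<eta> * (1 - \<bar>y'\<bar>) powr (- \<eta>))"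
        using C(2)[OF k y] by (simp add: \<delta>_def algebra_simps)
      also have "\<dots> \<le> C * (2 powr \<eta> * \<theta> k y + 2 powr \<eta> * \<theta> k y')"
        using C True y by (intro mult_left_mono add_mono far) auto
      also have "\<dots> = C * (2 powr \<eta> * (\<theta> k y + \<theta> k y'))"
        by (simp add: distrib_left)
      also have "\<dots> \<le> max C 1 * (2 powr \<eta> * (\<theta> k y + \<theta> k y'))"
        using \<theta>0 by (intro mult_right_mono) auto
      finally show ?thesis by (simp add: C'_def mult_ac)
    next
      case False
      have "(Q ^^ k) W y y' \<le> (Q ^^ k) (\<lambda>_ _. 1) y y'"
        by (intro Q_iter_mono W_le_1 y)
      also have "\<dots> = 1" by (rule Q_iter_const)
      also have "1 \<le> 2 powr \<eta> * (\<theta> k y + \<theta> k y')"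
      proof -
        have nn: "0 \<le> 2 powr \<eta> * \<theta> k u" for u using \<theta>0 by simp
        have "1 \<le> 2 powr \<eta> * \<theta> k y \<or> 1 \<le> 2 powr \<eta> * \<theta> k y'"
          using False near[of y] near[of y'] y by auto
        then have "1 \<le> 2 powr \<eta> * \<theta> k y + 2 powr \<eta> * \<theta> k y'"
          using nn[of y] nn[of y'] by linarith
        then show ?thesis by (simp only: distrib_left)
      qed
      also have "\<dots> \<le> max C 1 * (2 powr \<eta> * (\<theta> k y + \<theta> k y'))"
        using \<theta>0 mult_right_mono[of 1 "max C 1" "2 powr \<eta> * (\<theta> k y + \<theta> k y')"] by simp
      finally show ?thesis by (simp add: C'_def mult_ac)
    qed
  qed
qed

end

section \<open>Functionals of the orbit\<close>

lemma abs_convex_combination_le: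
  fixes a x y e :: real
  assumes "0 \<le> a" "a \<le> 1" "\<bar>x\<bar> \<le> e" "\<bar>y\<bar> \<le> e"
  shows "\<bar>a * x + (1 - a) * y\<bar> \<le> e"
proof -
  have "\<bar>a * x + (1 - a) * y\<bar> \<le> \<bar>a * x\<bar> + \<bar>(1 - a) * y\<bar>" by (rule abs_triangle_ineq)
  also have "\<dots> = a * \<bar>x\<bar> + (1 - a) * \<bar>y\<bar>" using assms by (simp add: abs_mult)
  also have "\<dots> \<le> a * e + (1 - a) * e" using assms by (intro add_mono mult_left_mono) auto
  also have "\<dots> = e" by (simp add: algebra_simps)
  finally show ?thesis .
qed

section \<open>Iterates of P as averages over preimages, compared through the coupling\<close>

context pikovsky_map
begin

lemma pikovsky_iter_maps:
  assumes "x \<in> {-1..1}"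
  shows "(pikovsky \<gamma> ^^ i) x \<in> {-1..1}"
proof (induction i)
  case (Suc i)
  then show ?case using pikovsky_maps[OF \<gamma> Suc.IH] by simp
qed (use assms in simp)

text \<open>\<open>(P ^^ n) h z\<close> is a weighted mean of \<open>h\<close> over the preimages of
  order \<open>n\<close> of \<open>z\<close>, so only values at these points enter.\<close>

lemma P_iter_diff_le:
  assumes "z \<in> {-1<..<1}"
    and "\<And>x. x \<in> {-1<..<1} \<Longrightarrow> (pikovsky \<gamma> ^^ n) x = z \<Longrightarrow> \<bar>h x - h' x\<bar> \<le> e"
  shows "\<bar>(P ^^ n) h z - (P ^^ n) h' z\<bar> \<le> e"
  using assms
proof (induction n arbitrary: z)
  case (Suc n)
  have z: "gR z \<in> {-1<..<1}" "gL z \<in> {-1<..<1}"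
    using gR_range[of z] gL_range[of z] Suc.prems(1) by auto
  have T: "pikovsky \<gamma> (gR z) = z" "pikovsky \<gamma> (gL z) = z"
    using pikovsky_gR[of z] pikovsky_gL[of z] Suc.prems(1) by auto
  have R: "\<bar>(P ^^ n) h (gR z) - (P ^^ n) h' (gR z)\<bar> \<le> e"
    using z T by (intro Suc.IH Suc.prems(2)) auto
  have L: "\<bar>(P ^^ n) h (gL z) - (P ^^ n) h' (gL z)\<bar> \<le> e"
    using z T by (intro Suc.IH Suc.prems(2)) auto
  have pz: "0 \<le> p z" "p z \<le> 1" using p_bounds[of z] Suc.prems(1) by auto
  have "(P ^^ Suc n) h z - (P ^^ Suc n) h' z
      = p z * ((P ^^ n) h (gR z) - (P ^^ n) h' (gR z))
        + (1 - p z) * ((P ^^ n) h (gL z) - (P ^^ n) h' (gL z))"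
    by (simp only: funpow.simps o_apply P_def) (simp add: algebra_simps)
  also have "\<bar>\<dots>\<bar> \<le> e"
    using pz R L by (rule abs_convex_combination_le)
  finally show ?case .
qed simp

lemma P_iter_cong:
  assumes "z \<in> {-1<..<1}"
    and "\<And>x. x \<in> {-1<..<1} \<Longrightarrow> (pikovsky \<gamma> ^^ n) x = z \<Longrightarrow> h x = h' x"
  shows "(P ^^ n) h z = (P ^^ n) h' z"
  using P_iter_diff_le[OF assms(1), of n h h' 0] assms(2) by simp

lemma P_iter_const: "(P ^^ n) (\<lambda>_. a) z = a"
proof (induction n arbitrary: z)
  case (Suc n)
  then have "(P ^^ n) (\<lambda>_. a) = (\<lambda>_. a)" by blast
  moreover have "P (\<lambda>_. a) z = a" by (simp add: P_def algebra_simps)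
  ultimately show ?case by simp
qed simp

lemma P_iter_bound:
  assumes "z \<in> {-1<..<1}" "\<And>x. x \<in> {-1<..<1} \<Longrightarrow> \<bar>h x\<bar> \<le> S"
  shows "\<bar>(P ^^ n) h z\<bar> \<le> S"
  using P_iter_diff_le[of z n h "\<lambda>_. 0" S] assms by (simp add: P_iter_const)

text \<open>The difference is split into the three outcomes of a coupled step: both right, both
  left, or separated.\<close>

lemma P_diff_le:
  assumes y: "-1 < y" "y \<le> y'" "y' < 1"
    and G: "\<And>a b. -1 < a \<Longrightarrow> a \<le> b \<Longrightarrow> b < 1 \<Longrightarrow> \<bar>K a - K b\<bar> \<le> G a b"
  shows "\<bar>P K y - P K y'\<bar> \<le> Q G y y'"
proof -
  have yy: "y \<in> {-1<..<1}" "y' \<in> {-1<..<1}" using y by auto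
  have pp: "0 \<le> p y" "p y \<le> p y'" "p y' \<le> 1"
    using p_bounds[of y] p_bounds[of y'] p_mono[of y y'] y by auto
  have ranges: "-1 < gR y" "gR y \<le> gR y'" "gR y' < 1" "-1 < gL y" "gL y \<le> gL y'" "gL y' < 1"
    "gL y \<le> gR y'"
    using gR_range[OF yy(1)] gR_range[OF yy(2)] gL_range[OF yy(1)] gL_range[OF yy(2)]
      gR_mono[of y y'] gL_mono[of y y'] y by auto
  have "P K y - P K y' = p y * (K (gR y) - K (gR y')) + (1 - p y') * (K (gL y) - K (gL y'))
      + (p y' - p y) * (K (gL y) - K (gR y'))"
    by (simp add: P_def algebra_simps)
  also have "\<bar>\<dots>\<bar> \<le> \<bar>p y * (K (gR y) - K (gR y'))\<bar> + \<bar>(1 - p y') * (K (gL y) - K (gL y'))\<bar>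
      + \<bar>(p y' - p y) * (K (gL y) - K (gR y'))\<bar>"
    by linarith
  also have "\<dots> = p y * \<bar>K (gR y) - K (gR y')\<bar> + (1 - p y') * \<bar>K (gL y) - K (gL y')\<bar>
      + (p y' - p y) * \<bar>K (gL y) - K (gR y')\<bar>"
    using pp by (simp add: abs_mult)
  also have "\<dots> \<le> Q G y y'"
    unfolding Q_def using pp ranges by (intro add_mono mult_left_mono G) auto
  finally show ?thesis .
qed

lemma P_iter_Q_iter:
  assumes G: "\<And>a b. -1 < a \<Longrightarrow> a \<le> b \<Longrightarrow> b < 1 \<Longrightarrow> \<bar>K a - K b\<bar> \<le> G a b"
  shows "-1 < y \<Longrightarrow> y \<le> y' \<Longrightarrow> y' < 1 \<Longrightarrow> \<bar>(P ^^ k) K y - (P ^^ k) K y'\<bar> \<le> (Q ^^ k) G y y'"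
proof (induction k arbitrary: y y')
  case (Suc k)
  then show ?case using P_diff_le[of y y' "(P ^^ k) K" "(Q ^^ k) G"] by simp
qed (use G in auto)

end

section \<open>Functionals of a finite orbit segment\<close>

context pikovsky_weight
begin

text \<open>One entry of the maximum for each case of \<open>absorb_increment\<close>:
  \<open>W >= 1 - exp (-1)\<close> when the scaled distance exceeds 1, and the gain factor
  \<open>(\<gamma> - 1) * exp (-1)\<close> otherwise.\<close>

definition D :: real where
  "D = max (2 / (1 - exp (-1))) (exp 1 / (\<gamma> - 1))"

lemma D_ge: "2 \<le> D * (1 - exp (-1))" "1 \<le> D * ((\<gamma> - 1) * exp (-1))" "2 \<le> D"
proof -
  have e: "0 < 1 - exp (-1::real)" by simp
  have "2 / (1 - exp (-1)) \<le> D" by (simp add: D_def)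
  then show 1: "2 \<le> D * (1 - exp (-1))" using e by (simp add: pos_divide_le_eq)
  have "exp 1 / (\<gamma> - 1) \<le> D" by (simp add: D_def)
  then have "exp 1 \<le> D * (\<gamma> - 1)" using \<gamma> by (simp add: pos_divide_le_eq)
  then have "exp 1 * exp (-1) \<le> D * (\<gamma> - 1) * exp (-1::real)" by (intro mult_right_mono) auto
  then show "1 \<le> D * ((\<gamma> - 1) * exp (-1))" by (simp add: mult.assoc flip: exp_add)
  have "0 \<le> D"
    using 1 e by (smt (verit) mult_nonpos_nonneg)
  then have "D * (1 - exp (-1)) \<le> D * 1" by (intro mult_left_mono) auto
  with 1 show "2 \<le> D" by simp
qed

text \<open>If \<open>A (\<phi> y' - \<phi> y) \<le> 1\<close>, the gain in the coupling inequality absorbs the increment of the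
  last coordinate; otherwise \<open>W y y'\<close> is bounded below and the trivial bound suffices.\<close>

lemma absorb_increment:
  assumes y: "-1 < y" "y \<le> y'" "y' < 1" and nonneg: "0 \<le> S" "0 \<le> \<Lambda>"
    and d: "d \<le> 2 * S"
      "d \<le> \<Lambda> * (y' - y) + D * (S + \<Lambda>) * (W y y' - (\<gamma> - 1) * (y' - y) * exp (- A * (\<phi> y' - \<phi> y)))"
  shows "d \<le> D * (S + \<Lambda>) * W y y'"
proof (cases "A * (\<phi> y' - \<phi> y) \<le> 1")
  case True
  then have "exp (-1) \<le> exp (- A * (\<phi> y' - \<phi> y))" by simp
  then have "(\<gamma> - 1) * exp (-1) \<le> (\<gamma> - 1) * exp (- A * (\<phi> y' - \<phi> y))"
    using \<gamma> by (intro mult_left_mono) auto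
  then have "1 \<le> D * ((\<gamma> - 1) * exp (- A * (\<phi> y' - \<phi> y)))"
    using D_ge mult_left_mono[of "(\<gamma> - 1) * exp (-1)" "(\<gamma> - 1) * exp (- A * (\<phi> y' - \<phi> y))" D] by linarith
  then have "((S + \<Lambda>) * (y' - y)) * 1 \<le> ((S + \<Lambda>) * (y' - y)) * (D * ((\<gamma> - 1) * exp (- A * (\<phi> y' - \<phi> y))))"
    using nonneg y by (intro mult_left_mono) auto
  moreover have "\<Lambda> * (y' - y) \<le> (S + \<Lambda>) * (y' - y)"
    using nonneg y by (intro mult_right_mono) auto
  ultimately have "\<Lambda> * (y' - y) \<le> D * (S + \<Lambda>) * ((\<gamma> - 1) * (y' - y) * exp (- A * (\<phi> y' - \<phi> y)))"
    by (simp add: mult_ac)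
  then show ?thesis using d(2) by (simp add: right_diff_distrib)
next
  case False
  then have "1 - exp (-1) \<le> W y y'" by (simp add: W_def)
  then have "D * (1 - exp (-1)) \<le> D * W y y'" using D_ge by (intro mult_left_mono) auto
  then have "2 \<le> D * W y y'" using D_ge by linarith
  then have "(S + \<Lambda>) * 2 \<le> (S + \<Lambda>) * (D * W y y')" using nonneg by (intro mult_left_mono) auto
  then show ?thesis using d(1) nonneg by (simp add: mult_ac)
qed

text \<open>The constant must not grow with \<open>m\<close>. In each induction step the last orbit
  point, which is \<open>y\<close> or \<open>y'\<close> itself, costs
  \<open>\<Lambda> * (y' - y)\<close>, and the gain in \<open>W_step\<close> absorbs this cost. The
  remaining coordinates are handled after one coupled step by the induction hypothesis.\<close>

lemma path_bound:
  fixes G :: "(nat \<Rightarrow> real) \<Rightarrow> real"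
  assumes dep: "\<And>u v. (\<And>i. i \<le> m \<Longrightarrow> u i = v i) \<Longrightarrow> G u = G v"
    and bd: "\<And>u. (\<And>i. u i \<in> {-1..1}) \<Longrightarrow> \<bar>G u\<bar> \<le> S"
    and lip: "\<And>u i a. (\<And>i. u i \<in> {-1..1}) \<Longrightarrow> a \<in> {-1..1} \<Longrightarrow> \<bar>G (u(i := a)) - G u\<bar> \<le> \<Lambda> * \<bar>a - u i\<bar>"
    and nonneg: "0 \<le> S" "0 \<le> \<Lambda>" and y: "-1 < y" "y \<le> y'" "y' < 1"
  shows "\<bar>(P ^^ m) (\<lambda>x. G (\<lambda>i. (pikovsky \<gamma> ^^ i) x)) y - (P ^^ m) (\<lambda>x. G (\<lambda>i. (pikovsky \<gamma> ^^ i) x)) y'\<bar>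
    \<le> D * (S + \<Lambda>) * W y y'"
  using dep bd lip y
proof (induction m arbitrary: G y y')
  case 0
  note orb = pikovsky_iter_maps
  let ?o = "\<lambda>x i. (pikovsky \<gamma> ^^ i) x"
  have yy: "y \<in> {-1..1}" "y' \<in> {-1..1}" using "0.prems"(4-6) by auto
  have "G (?o y) = G ((?o y')(0 := y))" by (intro "0.prems"(1)) auto
  moreover have "\<bar>G ((?o y')(0 := y)) - G (?o y')\<bar> \<le> \<Lambda> * \<bar>y - ?o y' 0\<bar>"
    using orb yy by (intro "0.prems"(3)) auto
  ultimately have "\<bar>G (?o y) - G (?o y')\<bar> \<le> \<Lambda> * (y' - y)"
    using "0.prems"(5) by simp
  \<comment> \<open>By \<open>W_step\<close> the last factor dominates a sum of nonnegative
    terms.\<close>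
  moreover have "0 \<le> D * (S + \<Lambda>) * (W y y' - (\<gamma> - 1) * (y' - y) * exp (- A * (\<phi> y' - \<phi> y)))"
  proof -
    have "0 \<le> p y * W (gR y) (gR y') + (1 - p y') * W (gL y) (gL y') + (p y' - p y)"
      using p_bounds[of y] p_bounds[of y'] p_mono[of y y'] gR_range[of y] gR_range[of y'] "0.prems"(4-6)
        gL_range[of y] gL_range[of y'] gR_mono[of y y'] gL_mono[of y y']
      by (intro add_nonneg_nonneg mult_nonneg_nonneg W_bounds) auto
    then show ?thesis
      using W_step[OF "0.prems"(4-6)] nonneg D_ge(3) by (intro mult_nonneg_nonneg) auto
  qed
  moreover have "\<bar>G (?o y) - G (?o y')\<bar> \<le> 2 * S"
    using "0.prems"(2)[of "?o y"] "0.prems"(2)[of "?o y'"] orb yy by fastforce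
  ultimately show ?case
    using nonneg "0.prems"(4-6) by (intro absorb_increment) auto
next
  case (Suc m)
  note orb = pikovsky_iter_maps
  let ?o = "\<lambda>x i. (pikovsky \<gamma> ^^ i) x"
  have y: "-1 < y" "y \<le> y'" "y' < 1" using Suc.prems(4-6) by auto
  have yy: "y \<in> {-1<..<1}" "y' \<in> {-1<..<1}" "y \<in> {-1..1}" "y' \<in> {-1..1}" using y by auto
  \<comment> \<open>The last coordinate is frozen at \<open>y'\<close> for both copies, which leaves
    a functional of the coordinates up to \<open>m\<close>.\<close>
  define G1 where "G1 u = G (u(Suc m := y'))" for u
  define K where "K = (P ^^ m) (\<lambda>x. G1 (?o x))"
  have G1_dep: "G1 u = G1 v" if "\<And>i. i \<le> m \<Longrightarrow> u i = v i" for u v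
    unfolding G1_def using that by (intro Suc.prems(1)) auto
  have G1_bd: "\<bar>G1 u\<bar> \<le> S" if "\<And>i. u i \<in> {-1..1}" for u
    unfolding G1_def using that yy by (intro Suc.prems(2)) auto
  have G1_lip: "\<bar>G1 (u(i := a)) - G1 u\<bar> \<le> \<Lambda> * \<bar>a - u i\<bar>"
    if "\<And>i. u i \<in> {-1..1}" "a \<in> {-1..1}" for u i a
  proof (cases "i = Suc m")
    case True
    then show ?thesis using nonneg by (simp add: G1_def)
  next
    case False
    then have "G1 (u(i := a)) = G ((u(Suc m := y'))(i := a))" "u i = (u(Suc m := y')) i"
      by (auto simp: G1_def fun_upd_twist)
    then show ?thesis
      using that yy by (simp only: G1_def[of u]) (intro Suc.prems(3), auto)
  qed
  have K: "\<bar>K a - K b\<bar> \<le> D * (S + \<Lambda>) * W a b" if "-1 < a" "a \<le> b" "b < 1" for a b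
    unfolding K_def by (rule Suc.IH[OF G1_dep G1_bd G1_lip that])
  have KS: "\<bar>K a\<bar> \<le> S" if "a \<in> {-1<..<1}" for a
    unfolding K_def
  proof (rule P_iter_bound[OF that])
    fix x :: real assume "x \<in> {-1<..<1}"
    then show "\<bar>G1 (?o x)\<bar> \<le> S" by (intro G1_bd orb) auto
  qed
  have S: "\<bar>(P ^^ Suc m) (\<lambda>x. G (?o x)) z\<bar> \<le> S" if "z \<in> {-1<..<1}" for z
  proof (rule P_iter_bound[OF that])
    fix x :: real assume "x \<in> {-1<..<1}"
    then show "\<bar>G (?o x)\<bar> \<le> S" by (intro Suc.prems(2) orb) auto
  qed
  \<comment> \<open>Over \<open>y'\<close> freezing changes nothing: orbits of its preimages of
    order \<open>Suc m\<close> pass through \<open>y'\<close> at that time.\<close>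
  have eq: "(P ^^ Suc m) (\<lambda>x. G (?o x)) y' = P K y'"
  proof -
    have "(P ^^ Suc m) (\<lambda>x. G (?o x)) y' = (P ^^ Suc m) (\<lambda>x. G1 (?o x)) y'"
    proof (rule P_iter_cong[OF yy(2)])
      fix x assume "(pikovsky \<gamma> ^^ Suc m) x = y'"
      then have "(?o x)(Suc m := y') = ?o x" by (auto simp: fun_eq_iff)
      then show "G (?o x) = G1 (?o x)" by (simp add: G1_def)
    qed
    then show ?thesis by (simp add: K_def)
  qed
  have le: "\<bar>(P ^^ Suc m) (\<lambda>x. G (?o x)) y - P K y\<bar> \<le> \<Lambda> * (y' - y)"
  proof -
    have "\<bar>(P ^^ Suc m) (\<lambda>x. G (?o x)) y - (P ^^ Suc m) (\<lambda>x. G1 (?o x)) y\<bar> \<le> \<Lambda> * (y' - y)"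
    proof (rule P_iter_diff_le[OF yy(1)])
      fix x assume x: "x \<in> {-1<..<1}" "(pikovsky \<gamma> ^^ Suc m) x = y"
      have "\<bar>G ((?o x)(Suc m := y')) - G (?o x)\<bar> \<le> \<Lambda> * \<bar>y' - ?o x (Suc m)\<bar>"
        using orb[of x] x yy by (intro Suc.prems(3)) auto
      then show "\<bar>G (?o x) - G1 (?o x)\<bar> \<le> \<Lambda> * (y' - y)"
        using x y by (simp add: G1_def abs_minus_commute)
    qed
    then show ?thesis by (simp add: K_def)
  qed
  have "\<bar>P K y - P K y'\<bar> \<le> D * (S + \<Lambda>) * (W y y' - (\<gamma> - 1) * (y' - y) * exp (- A * (\<phi> y' - \<phi> y)))"
  proof -
    have pp: "0 \<le> p y" "p y \<le> p y'" "p y' \<le> 1"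
      using p_bounds[of y] p_bounds[of y'] p_mono[of y y'] y by auto
    have gg: "gR y \<in> {-1<..<1}" "gR y' \<in> {-1<..<1}" "gL y \<in> {-1<..<1}" "gL y' \<in> {-1<..<1}"
      "gR y \<le> gR y'" "gL y \<le> gL y'"
      using gR_range[of y] gL_range[of y] gR_range[of y'] gL_range[of y'] yy
        gR_mono[of y y'] gL_mono[of y y'] y by auto
    \<comment> \<open>Separated copies are compared by the sup bound only; \<open>D >= 2\<close>
      makes it fit with \<open>W\<close> replaced by 1.\<close>
    have "\<bar>K (gL y) - K (gR y')\<bar> \<le> D * (S + \<Lambda>) * 1"
    proof -
      have "2 * (S + \<Lambda>) \<le> D * (S + \<Lambda>)" using D_ge nonneg by (intro mult_right_mono) auto
      moreover have "\<bar>K (gL y) - K (gR y')\<bar> \<le> S + S"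
        by (rule order_trans[OF abs_triangle_ineq4 add_mono[OF KS KS]]) (use gg in auto)
      ultimately show ?thesis using nonneg by simp
    qed
    then have "p y * \<bar>K (gR y) - K (gR y')\<bar> + (1 - p y') * \<bar>K (gL y) - K (gL y')\<bar>
        + (p y' - p y) * \<bar>K (gL y) - K (gR y')\<bar>
      \<le> p y * (D * (S + \<Lambda>) * W (gR y) (gR y')) + (1 - p y') * (D * (S + \<Lambda>) * W (gL y) (gL y'))
        + (p y' - p y) * (D * (S + \<Lambda>) * 1)"
      using pp gg by (intro add_mono mult_left_mono K) auto
    also have "\<dots> = D * (S + \<Lambda>) * (p y * W (gR y) (gR y') + (1 - p y') * W (gL y) (gL y') + (p y' - p y))"
      by (simp add: algebra_simps)
    also have "\<dots> \<le> D * (S + \<Lambda>) * (W y y' - (\<gamma> - 1) * (y' - y) * exp (- A * (\<phi> y' - \<phi> y)))"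
      using W_step[OF y] D_ge(3) nonneg by (intro mult_left_mono) auto
    moreover have "P K y - P K y' = p y * (K (gR y) - K (gR y')) + (1 - p y') * (K (gL y) - K (gL y'))
      + (p y' - p y) * (K (gL y) - K (gR y'))"
      by (simp add: P_def algebra_simps)
    moreover have "\<bar>p y * (K (gR y) - K (gR y'))\<bar> = p y * \<bar>K (gR y) - K (gR y')\<bar>"
        "\<bar>(1 - p y') * (K (gL y) - K (gL y'))\<bar> = (1 - p y') * \<bar>K (gL y) - K (gL y')\<bar>"
        "\<bar>(p y' - p y) * (K (gL y) - K (gR y'))\<bar> = (p y' - p y) * \<bar>K (gL y) - K (gR y')\<bar>"
      using pp by (auto simp: abs_mult)
    ultimately show ?thesis by linarith
  qed
  moreover have "\<bar>(P ^^ Suc m) (\<lambda>x. G (?o x)) y - (P ^^ Suc m) (\<lambda>x. G (?o x)) y'\<bar> \<le> 2 * S"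
    using S[OF yy(1)] S[OF yy(2)] by linarith
  ultimately show ?case
    using le eq nonneg y by (intro absorb_increment) auto
qed

definition orbit_functional :: "nat \<Rightarrow> ((nat \<Rightarrow> real) \<Rightarrow> real) \<Rightarrow> real \<Rightarrow> real \<Rightarrow> bool" where
  "orbit_functional m G S \<Lambda> \<longleftrightarrow> 0 \<le> S \<and> 0 \<le> \<Lambda> \<and>
     (\<forall>u v. (\<forall>i\<le>m. u i = v i) \<longrightarrow> G u = G v) \<and>
     (\<forall>u. (\<forall>i. u i \<in> {-1..1}) \<longrightarrow> \<bar>G u\<bar> \<le> S) \<and>
     (\<forall>u i a. (\<forall>i. u i \<in> {-1..1}) \<longrightarrow> a \<in> {-1..1} \<longrightarrow> \<bar>G (u(i := a)) - G u\<bar> \<le> \<Lambda> * \<bar>a - u i\<bar>)"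

text \<open>The functional occupies the \<open>m\<close> steps farthest from \<open>y\<close>; by
  \<open>path_bound\<close> they yield a function with modulus
  \<open>D * (S + \<Lambda>) * W\<close>. The \<open>k\<close> steps of the gap then shrink
  \<open>W\<close> through the coupling.\<close>

lemma decorrelation:
  "\<exists>C>0. \<forall>m G S \<Lambda> k. \<forall>y\<in>{-1<..<1}. \<forall>y'\<in>{-1<..<1}. orbit_functional m G S \<Lambda> \<longrightarrow> 1 \<le> k \<longrightarrow>
    \<bar>(P ^^ (k + m)) (\<lambda>x. G (\<lambda>i. (pikovsky \<gamma> ^^ i) x)) y
      - (P ^^ (k + m)) (\<lambda>x. G (\<lambda>i. (pikovsky \<gamma> ^^ i) x)) y'\<bar>
    \<le> C * (S + \<Lambda>) * (\<theta> k y + \<theta> k y')"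
proof -
  obtain C where C: "0 < C"
    "\<And>k y y'. 1 \<le> k \<Longrightarrow> -1 < y \<Longrightarrow> y \<le> y' \<Longrightarrow> y' < 1 \<Longrightarrow> (Q ^^ k) W y y' \<le> C * (\<theta> k y + \<theta> k y')"
    using Q_iter_W by metis
  have D: "0 < D" using D_ge(3) by linarith
  show ?thesis
  proof (intro exI[of _ "D * C"] conjI allI ballI impI)
    fix G :: "(nat \<Rightarrow> real) \<Rightarrow> real" and S \<Lambda> :: real and m k :: nat and y y' :: real
    assume orb: "orbit_functional m G S \<Lambda>"
      and k: "1 \<le> k" and yy: "y \<in> {-1<..<1}" "y' \<in> {-1<..<1}"
    have nonneg: "0 \<le> S" "0 \<le> \<Lambda>" using orb by (auto simp: orbit_functional_def)
    let ?\<Phi> = "\<lambda>x. G (\<lambda>i. (pikovsky \<gamma> ^^ i) x)"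
    have *: "\<bar>(P ^^ (k + m)) ?\<Phi> y - (P ^^ (k + m)) ?\<Phi> y'\<bar> \<le> D * C * (S + \<Lambda>) * (\<theta> k y + \<theta> k y')"
      if y: "-1 < y" "y \<le> y'" "y' < 1" for y y'
    proof -
      have "\<bar>(P ^^ k) ((P ^^ m) ?\<Phi>) y - (P ^^ k) ((P ^^ m) ?\<Phi>) y'\<bar>
          \<le> (Q ^^ k) (\<lambda>a b. D * (S + \<Lambda>) * W a b) y y'"
      proof (rule P_iter_Q_iter[OF path_bound y])
        show "G u = G v" if "\<And>i. i \<le> m \<Longrightarrow> u i = v i" for u v
          using orb that unfolding orbit_functional_def by blast
        show "\<bar>G u\<bar> \<le> S" if "\<And>i. u i \<in> {-1..1}" for u
          using orb that unfolding orbit_functional_def by blast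
        show "\<bar>G (u(i := a)) - G u\<bar> \<le> \<Lambda> * \<bar>a - u i\<bar>" if "\<And>i. u i \<in> {-1..1}" "a \<in> {-1..1}" for u i a
          using orb that unfolding orbit_functional_def by blast
      qed (use nonneg in auto)
      also have "(Q ^^ k) (\<lambda>a b. r * W a b) y y' = r * (Q ^^ k) W y y'" for r
      proof (induction k arbitrary: y y')
        case (Suc k)
        then have "(Q ^^ k) (\<lambda>a b. r * W a b) = (\<lambda>a b. r * (Q ^^ k) W a b)" by blast
        then show ?case by (simp add: Q_cmult)
      qed simp
      also have "D * (S + \<Lambda>) * (Q ^^ k) W y y' \<le> D * (S + \<Lambda>) * (C * (\<theta> k y + \<theta> k y'))"
        using D nonneg by (intro mult_left_mono C(2) k y) auto
      finally show ?thesis by (simp add: funpow_add mult_ac)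
    qed
    show "\<bar>(P ^^ (k + m)) ?\<Phi> y - (P ^^ (k + m)) ?\<Phi> y'\<bar> \<le> D * C * (S + \<Lambda>) * (\<theta> k y + \<theta> k y')"
      using *[of y y'] *[of y' y] yy
      by (cases "y \<le> y'") (auto simp: abs_minus_commute add.commute)
  qed (use D C in simp)
qed

end

section \<open>The transfer operator and Lebesgue measure\<close>

lemma space_pikovsky_space [simp]: "space pikovsky_space = {-1..1}"
  by (simp add: pikovsky_space_def space_scale_measure space_restrict_space)

lemma sets_pikovsky_space [measurable_cong]:
  "sets pikovsky_space = sets (restrict_space borel {-1..1})"
  by (simp add: pikovsky_space_def sets_restrict_space)

interpretation pikovsky_space: prob_space pikovsky_space
  by (rule prob_space_pikovsky_space)

lemma borel_measurable_pikovsky_space_iff: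
  "f \<in> borel_measurable pikovsky_space \<longleftrightarrow> f \<in> borel_measurable (restrict_space lborel {-1..1})"
  by (intro arg_cong2[where f = "(\<in>)"] refl measurable_cong_sets)
    (auto simp: sets_pikovsky_space sets_restrict_space)

lemma integral_pikovsky_space:
  fixes f :: "real \<Rightarrow> real"
  assumes f: "f \<in> borel_measurable pikovsky_space"
  shows "integral\<^sup>L pikovsky_space f = (LBINT x:{-1..1}. f x) / 2"
proof -
  let ?R = "restrict_space lborel {-1..1::real}"
  have eq: "pikovsky_space = density ?R (\<lambda>_. ennreal (1 / 2))"
  proof (rule measure_eqI)
    have "ennreal (1 / 2) = 1 / 2" using divide_ennreal[of 1 2] by simp
    moreover fix A assume "A \<in> sets pikovsky_space"
    ultimately show "emeasure pikovsky_space A = emeasure (density ?R (\<lambda>_. ennreal (1 / 2))) A"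
      by (simp only: pikovsky_space_def emeasure_density_const emeasure_scale_measure sets_scale_measure)
  qed (simp add: pikovsky_space_def)
  have "integral\<^sup>L pikovsky_space f = integral\<^sup>L ?R (\<lambda>x. (1 / 2) *\<^sub>R f x)"
    unfolding eq using f by (intro integral_density) (auto simp: borel_measurable_pikovsky_space_iff)
  also have "\<dots> = (LBINT x:{-1..1}. f x) / 2"
    by (simp add: integral_restrict_space set_lebesgue_integral_def)
  finally show ?thesis .
qed

lemma pikovsky_space_integrable:
  fixes f :: "real \<Rightarrow> real"
  assumes "f \<in> borel_measurable pikovsky_space" "\<And>x. x \<in> {-1..1} \<Longrightarrow> \<bar>f x\<bar> \<le> S"
  shows "integrable pikovsky_space f"
  using assms by (intro pikovsky_space.integrable_const_bound[where B = S]) auto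

lemma AE_pikovsky_space: "AE x in pikovsky_space. x \<in> {-1<..<1}"
proof -
  have "{-1, 1::real} \<in> null_sets pikovsky_space"
  proof
    show m: "{-1, 1} \<in> sets pikovsky_space"
      by (auto simp: sets_pikovsky_space sets_restrict_space image_iff intro!: bexI[of _ "{-1, 1}"])
    show "emeasure pikovsky_space {-1, 1} = 0"
      by (simp add: pikovsky_space_def emeasure_restrict_space emeasure_lborel_countable)
  qed
  then show ?thesis by (rule AE_I') auto
qed

lemma continuous_on_measurable_pikovsky_space:
  fixes f :: "real \<Rightarrow> real"
  assumes "continuous_on {-1..1} f"
  shows "f \<in> borel_measurable pikovsky_space"
  using borel_measurable_continuous_on_restrict[OF assms]
  by (simp add: measurable_cong_sets[OF sets_pikovsky_space refl])

lemma measurable_pikovsky_spaceI: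
  assumes "f \<in> borel_measurable M" "\<And>x. x \<in> space M \<Longrightarrow> f x \<in> {-1..1}"
  shows "f \<in> measurable M pikovsky_space"
proof -
  have "f \<in> measurable M (restrict_space borel {-1..1})"
    using assms by (intro measurable_restrict_space2) auto
  then show ?thesis by (simp add: measurable_cong_sets[OF refl sets_pikovsky_space])
qed

section \<open>Integrals under P and measurability of the map\<close>

context pikovsky_map
begin

lemma gR_cont: "continuous_on {-1..1} gR"
  by (rule DERIV_continuous_on[OF has_field_derivative_at_within[OF gR_deriv]])

lemma gL_cont: "continuous_on {-1..1} gL"
  by (rule DERIV_continuous_on[OF has_field_derivative_at_within[OF gL_deriv]])

lemma measurable_p [measurable]: "p \<in> borel_measurable pikovsky_space"
  by (rule continuous_on_measurable_pikovsky_space[OF p_cont])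

lemma measurable_gR [measurable]: "gR \<in> measurable pikovsky_space pikovsky_space"
proof (rule measurable_pikovsky_spaceI)
  fix x assume "x \<in> space pikovsky_space"
  then show "gR x \<in> {-1..1}" using gR_range_closed[of x] by auto
qed (rule continuous_on_measurable_pikovsky_space[OF gR_cont])

lemma measurable_gL [measurable]: "gL \<in> measurable pikovsky_space pikovsky_space"
proof (rule measurable_pikovsky_spaceI)
  fix x assume "x \<in> space pikovsky_space"
  then show "gL x \<in> {-1..1}" using gL_range_closed[of x] by auto
qed (rule continuous_on_measurable_pikovsky_space[OF gL_cont])

lemma measurable_P [measurable]:
  assumes [measurable]: "f \<in> borel_measurable pikovsky_space"
  shows "P f \<in> borel_measurable pikovsky_space"
  unfolding P_def[abs_def] by measurable

lemma P_bound:
  assumes "\<And>x. x \<in> {-1..1} \<Longrightarrow> \<bar>f x\<bar> \<le> S" "x \<in> {-1..1}"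
  shows "\<bar>P f x\<bar> \<le> S"
  unfolding P_def
  using assms p_bounds[of x] gR_range_closed[of x] gL_range_closed[of x]
  by (intro abs_convex_combination_le assms(1)) auto

text \<open>Change of variables: \<open>gR\<close> and \<open>gL\<close> map [-1, 1] onto [0, 1] and
  [-1, 0] with Jacobians \<open>p\<close> and \<open>1 - p\<close>.\<close>

lemma integral_P:
  assumes f: "f \<in> borel_measurable pikovsky_space" and S: "\<And>x. x \<in> {-1..1} \<Longrightarrow> \<bar>f x\<bar> \<le> S"
  shows "integral\<^sup>L pikovsky_space (P f) = integral\<^sup>L pikovsky_space f"
proof -
  have "integrable pikovsky_space f"
    by (rule pikovsky_space_integrable[OF f S])
  have f': "set_borel_measurable lborel {-1..1} f"
    using f by (simp add: borel_measurable_pikovsky_space_iff borel_measurable_restrict_space_iff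
        set_borel_measurable_def)
  have int: "set_integrable lborel {-1..1} f"
    unfolding set_integrable_def
  proof (rule Bochner_Integration.integrable_bound)
    show "integrable lborel (\<lambda>x. indicator {-1..1::real} x *\<^sub>R S)"
      by simp
    show "AE x in lborel. norm (indicator {-1..1} x *\<^sub>R f x) \<le> norm (indicator {-1..1} x *\<^sub>R S)"
      by (intro AE_I2) (auto simp: indicator_def intro!: order_trans[OF S abs_ge_self])
  qed (use f' in \<open>simp add: set_borel_measurable_def\<close>)
  have intR: "set_integrable lborel {0..1} f" and intL: "set_integrable lborel {-1..0} f"
    by (auto intro: set_integrable_subset[OF int])
  have R: "set_integrable lborel {-1..1} (\<lambda>x. f (gR x) * p x)"
      "(LBINT x. f x * indicator {0..1} x) = (LBINT x. f (gR x) * p x * indicator {-1..1} x)"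
    using integral_substitution[of gR "-1" 1 f p] intR gR_deriv p_cont p_bounds by auto
  have L: "set_integrable lborel {-1..1} (\<lambda>x. f (gL x) * (1 - p x))"
      "(LBINT x. f x * indicator {-1..0} x) = (LBINT x. f (gL x) * (1 - p x) * indicator {-1..1} x)"
    using integral_substitution[of gL "-1" 1 f "\<lambda>x. 1 - p x"] intL gL_deriv p_bounds
      continuous_on_diff[OF continuous_on_const p_cont] by auto
  have "(LBINT x:{-1..1}. f x) = (LBINT x:{-1..0} \<union> {0..1}. f x)"
    by (intro arg_cong[where f = "\<lambda>A. LBINT x:A. f x"]) auto
  also have "\<dots> = (LBINT x:{-1..0}. f x) + (LBINT x:{0..1}. f x)"
  proof (rule set_integral_Un_AE)
    have "AE x in lborel. x \<noteq> (0::real)" by (rule AE_lborel_singleton)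
    then show "AE x in lborel. \<not> (x \<in> {-1..0} \<and> x \<in> {0..1::real})" by eventually_elim auto
  qed (use intL intR in auto)
  also have "\<dots> = (LBINT x:{-1..1}. f (gL x) * (1 - p x)) + (LBINT x:{-1..1}. f (gR x) * p x)"
    using R(2) L(2) by (simp add: set_lebesgue_integral_def mult.commute)
  also have "\<dots> = (LBINT x:{-1..1}. f (gL x) * (1 - p x) + f (gR x) * p x)"
    by (rule set_integral_add(2)[symmetric, OF L(1) R(1)])
  also have "\<dots> = (LBINT x:{-1..1}. P f x)"
    by (simp add: P_def mult.commute add.commute)
  finally show ?thesis
    using f by (simp add: integral_pikovsky_space)
qed

lemma P_iter_measurable_bound:
  assumes "f \<in> borel_measurable pikovsky_space" "\<And>x. x \<in> {-1..1} \<Longrightarrow> \<bar>f x\<bar> \<le> S"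
  shows "(P ^^ n) f \<in> borel_measurable pikovsky_space \<and> (\<forall>x\<in>{-1..1}. \<bar>(P ^^ n) f x\<bar> \<le> S)"
  by (induction n) (use assms P_bound in auto)

lemma integral_P_iter:
  assumes "f \<in> borel_measurable pikovsky_space" "\<And>x. x \<in> {-1..1} \<Longrightarrow> \<bar>f x\<bar> \<le> S"
  shows "integral\<^sup>L pikovsky_space ((P ^^ n) f) = integral\<^sup>L pikovsky_space f"
proof (induction n)
  case (Suc n)
  then show ?case
    using integral_P[of "(P ^^ n) f" S] P_iter_measurable_bound[OF assms, of n] by simp
qed simp

lemma gR_pikovsky:
  assumes "x \<in> {0..1}"
  shows "gR (pikovsky \<gamma> x) = x"
proof -
  have "\<exists>y\<ge>-1. y \<le> 1 \<and> gR y = x"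
    using assms gR_cont by (intro IVT') auto
  then show ?thesis using pikovsky_gR by auto
qed

lemma pikovsky_mono:
  assumes "0 \<le> x" "x \<le> y" "y \<le> 1"
  shows "pikovsky \<gamma> x \<le> pikovsky \<gamma> y"
proof (rule ccontr)
  assume "\<not> ?thesis"
  then have "gR (pikovsky \<gamma> y) < gR (pikovsky \<gamma> x)"
    using assms pikovsky_maps[OF \<gamma>, of x] pikovsky_maps[OF \<gamma>, of y] by (intro gR_strict_mono) auto
  then show False using assms by (simp add: gR_pikovsky)
qed

lemma measurable_pikovsky [measurable]: "pikovsky \<gamma> \<in> measurable pikovsky_space pikovsky_space"
proof (rule measurable_pikovsky_spaceI)
  \<comment> \<open>Extended by 0, the map is monotone on each of four intervals that cover the
    line.\<close>
  let ?T = "\<lambda>x. if x \<in> {-1..1} then pikovsky \<gamma> x else 0"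
  have "?T \<in> borel_measurable borel"
  proof (rule borel_measurable_piecewise_mono)
    show "countable {{..<-1}, {-1..<0}, {0..1}, {1<..}::real set}" by simp
    show "\<Union> {{..<-1}, {-1..<0}, {0..1}, {1<..}::real set} = UNIV" by auto
    fix s assume s: "s \<in> {{..<-1}, {-1..<0}, {0..1}, {1<..}::real set}"
    then show "s \<in> sets borel" by auto
    show "mono_on s ?T"
      using s pikovsky_mono by (auto intro!: mono_onI simp: pikovsky_odd)
  qed
  then have "?T \<in> borel_measurable (restrict_space borel {-1..1})"
    by (rule measurable_restrict_space1)
  then have "?T \<in> borel_measurable pikovsky_space"
    by (simp add: measurable_cong_sets[OF sets_pikovsky_space refl])
  then show "pikovsky \<gamma> \<in> borel_measurable pikovsky_space"
    by (rule measurable_cong[THEN iffD1, rotated]) simp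
qed (use pikovsky_maps[OF \<gamma>] in simp)

lemma measurable_pikovsky_iter [measurable]:
  "pikovsky \<gamma> ^^ n \<in> measurable pikovsky_space pikovsky_space"
  by (induction n) auto

end

section \<open>The mean of the error term\<close>

context pikovsky_weight
begin

lemma \<theta>_cont: "1 \<le> k \<Longrightarrow> continuous_on {-1..1} (\<theta> k)"
  unfolding \<theta>_def[abs_def]
  by (intro continuous_intros continuous_on_powr) (auto simp: add_nonneg_eq_0_iff)

lemma \<theta>_measurable [measurable]: "1 \<le> k \<Longrightarrow> \<theta> k \<in> borel_measurable pikovsky_space"
  by (rule continuous_on_measurable_pikovsky_space[OF \<theta>_cont])

lemma \<theta>_bounds:
  assumes "x \<in> {-1..1}"
  shows "0 \<le> \<theta> k x" "\<theta> k x \<le> 1"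
proof -
  have frac: "\<bar>a / (a + b)\<bar> \<le> 1" if "0 \<le> a" "0 \<le> b" for a b :: real
    using that by (auto simp: divide_le_eq_1 less_le)
  show "0 \<le> \<theta> k x" by (simp add: \<theta>_def)
  show "\<theta> k x \<le> 1"
    unfolding \<theta>_def using \<eta> assms by (intro powr_le1 frac) auto
qed

text \<open>An explicit primitive exists on each half. Its value at 1 is exactly
  \<open>\<delta> / (\<eta> - 1)\<close>, and its value at 0 is nonnegative since
  \<open>\<eta> > 1\<close>.\<close>

lemma integral_\<theta>:
  assumes k: "1 \<le> k"
  shows "integral\<^sup>L pikovsky_space (\<theta> k) \<le> real k powr (- 1 / (\<gamma> - 1)) / (\<eta> - 1)"
proof -
  define \<delta> where "\<delta> = real k powr (- 1 / (\<gamma> - 1))"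
  have \<delta>: "0 < \<delta>" using k by (simp add: \<delta>_def)
  have \<theta>: "\<theta> k u = (\<delta> / (\<delta> + (1 - \<bar>u\<bar>))) powr \<eta>" for u by (simp add: \<theta>_def \<delta>_def)
  define f where "f u = \<delta> powr \<eta> * (\<delta> + 1 - u) powr (- \<eta>)" for u
  define F where "F u = \<delta> powr \<eta> * ((\<delta> + 1 - u) powr (1 - \<eta>) / (\<eta> - 1))" for u
  have F: "(F has_real_derivative f u) (at u)" if "0 \<le> u" "u \<le> 1" for u
  proof -
    have "((\<lambda>u. (\<delta> + 1 - u) powr (1 - \<eta>)) has_real_derivative (\<eta> - 1) * (\<delta> + 1 - u) powr (- \<eta>)) (at u)"
      using that \<delta> by (auto intro!: derivative_eq_intros simp: algebra_simps)
    from DERIV_cmult[OF DERIV_cdivide[OF this, of "\<eta> - 1"], of "\<delta> powr \<eta>"] show ?thesis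
      using \<eta> unfolding F_def f_def by simp
  qed
  have fc: "isCont f u" if "0 \<le> u" "u \<le> 1" for u
    unfolding f_def using that \<delta> by (intro continuous_intros) auto
  have f\<theta>: "\<theta> k u = f \<bar>u\<bar>" if "\<bar>u\<bar> \<le> 1" for u
    using that \<delta> by (simp add: \<theta> f_def powr_divide powr_minus_divide add_diff_eq)
  have F1: "F 1 - F 0 \<le> \<delta> / (\<eta> - 1)"
  proof -
    have "F 1 = \<delta> / (\<eta> - 1)" using \<delta> by (simp add: F_def flip: powr_add)
    moreover have "0 \<le> F 0" using \<eta> by (simp add: F_def)
    ultimately show ?thesis by simp
  qed
  have R: "(LBINT x:{0..1}. \<theta> k x) = F 1 - F 0"
  proof -
    have "(LBINT x:{0..1}. \<theta> k x) = (LBINT x. f x * indicator {0..1} x)"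
      unfolding set_lebesgue_integral_def
      by (intro Bochner_Integration.integral_cong) (auto simp: indicator_def f\<theta>)
    also have "\<dots> = F 1 - F 0"
      using F fc by (intro integral_FTC_Icc_real) auto
    finally show ?thesis .
  qed
  have L: "(LBINT x:{-1..0}. \<theta> k x) = F 1 - F 0"
  proof -
    have "(LBINT x:{-1..0}. \<theta> k x) = (LBINT x. f (- x) * indicator {-1..0} x)"
      unfolding set_lebesgue_integral_def
      by (intro Bochner_Integration.integral_cong) (auto simp: indicator_def f\<theta>)
    also have "\<dots> = - F (- 0) - - F (- (-1))"
    proof (rule integral_FTC_Icc_real[where F = "\<lambda>x. - F (- x)"])
      fix x :: real assume x: "-1 \<le> x" "x \<le> 0"
      have "((\<lambda>x. F (- x)) has_real_derivative f (- x) * (-1)) (at x)"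
        using x by (intro DERIV_chain2[OF F]) (auto intro!: derivative_eq_intros)
      from DERIV_minus[OF this] show "((\<lambda>x. - F (- x)) has_real_derivative f (- x)) (at x)" by simp
      show "isCont (\<lambda>x. f (- x)) x"
        unfolding f_def using x \<delta> by (intro continuous_intros) auto
    qed simp
    finally show ?thesis by simp
  qed
  have int: "set_integrable lborel {-1..1} (\<theta> k)"
    by (rule borel_integrable_atLeastAtMost'[OF \<theta>_cont[OF k]])
  have "(LBINT x:{-1..1}. \<theta> k x) = (LBINT x:{-1..0} \<union> {0..1}. \<theta> k x)"
    by (intro arg_cong[where f = "\<lambda>A. LBINT x:A. \<theta> k x"]) auto
  also have "\<dots> = (LBINT x:{-1..0}. \<theta> k x) + (LBINT x:{0..1}. \<theta> k x)"
  proof (rule set_integral_Un_AE)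
    have "AE x in lborel. x \<noteq> (0::real)" by (rule AE_lborel_singleton)
    then show "AE x in lborel. \<not> (x \<in> {-1..0} \<and> x \<in> {0..1::real})" by eventually_elim auto
  qed (auto intro: set_integrable_subset[OF int])
  finally have "(LBINT x:{-1..1}. \<theta> k x) = 2 * (F 1 - F 0)" using R L by simp
  then have "integral\<^sup>L pikovsky_space (\<theta> k) = F 1 - F 0"
    by (simp add: integral_pikovsky_space[OF \<theta>_measurable[OF k]])
  then show ?thesis using F1 by (simp add: \<delta>_def)
qed

end

section \<open>The functional correlation bound\<close>

text \<open>Telescoping: the coordinates of \<open>x\<close> are exchanged for those of
  \<open>y\<close> one at a time, without leaving the box.\<close>

lemma box_lipschitz_sum:
  fixes F :: "('i \<Rightarrow> real) \<Rightarrow> real"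
  assumes I: "finite I"
    and lip: "\<And>x i a a'. x \<in> I \<rightarrow>\<^sub>E B \<Longrightarrow> i \<in> I \<Longrightarrow> a \<in> B \<Longrightarrow> a' \<in> B \<Longrightarrow>
      \<bar>F (x(i := a)) - F (x(i := a'))\<bar> \<le> \<Lambda> * \<bar>a - a'\<bar>"
    and x: "x \<in> I \<rightarrow>\<^sub>E B" and y: "y \<in> I \<rightarrow>\<^sub>E B"
  shows "\<bar>F x - F y\<bar> \<le> \<Lambda> * (\<Sum>i\<in>I. \<bar>x i - y i\<bar>)"
proof -
  define z where "z J i = (if i \<in> J then y i else x i)" for J i
  have zI: "z J \<in> I \<rightarrow>\<^sub>E B" if "J \<subseteq> I" for J
    using x y that by (auto simp: z_def PiE_iff extensional_def)
  have "\<bar>F x - F (z J)\<bar> \<le> \<Lambda> * (\<Sum>i\<in>J. \<bar>x i - y i\<bar>)" if "finite J" "J \<subseteq> I" for J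
    using that
  proof (induction J)
    case empty
    then show ?case by (simp add: z_def[abs_def])
  next
    case (insert j J)
    have "(z J)(j := x j) = z J" "(z J)(j := y j) = z (insert j J)"
      using insert.hyps by (auto simp: z_def)
    moreover have "\<bar>F ((z J)(j := x j)) - F ((z J)(j := y j))\<bar> \<le> \<Lambda> * \<bar>x j - y j\<bar>"
      using insert.prems x y zI[of J] by (intro lip) auto
    ultimately have "\<bar>F (z J) - F (z (insert j J))\<bar> \<le> \<Lambda> * \<bar>x j - y j\<bar>" by simp
    moreover have "\<bar>F x - F (z J)\<bar> \<le> \<Lambda> * (\<Sum>i\<in>J. \<bar>x i - y i\<bar>)"
      using insert by simp
    ultimately show ?case using insert.hyps by (simp add: distrib_left)
  qed
  from this[OF I order.refl] have "\<bar>F x - F (z I)\<bar> \<le> \<Lambda> * (\<Sum>i\<in>I. \<bar>x i - y i\<bar>)" .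
  moreover have "z I = y" using x y by (auto simp: z_def fun_eq_iff PiE_iff extensional_def)
  ultimately show ?thesis by simp
qed

text \<open>The correlation bound only assumes \<open>F\<close> separately Lipschitz, whereas
  rewriting integrals over image measures calls for measurability.\<close>

lemma separately_lipschitz_measurable:
  fixes F :: "('i \<Rightarrow> real) \<Rightarrow> real"
  assumes I: "finite I" and L: "0 \<le> L"
    and lip: "\<And>x i a a'. x \<in> I \<rightarrow>\<^sub>E {-L..L} \<Longrightarrow> i \<in> I \<Longrightarrow> a \<in> {-L..L} \<Longrightarrow> a' \<in> {-L..L} \<Longrightarrow>
      \<bar>F (x(i := a)) - F (x(i := a'))\<bar> \<le> \<Lambda> * \<bar>a - a'\<bar>"
    and \<Lambda>: "0 \<le> \<Lambda>"
  shows "F \<in> borel_measurable (\<Pi>\<^sub>M i\<in>I. restrict_space borel {-L..L})" (is "_ \<in> borel_measurable ?M")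
proof (rule borel_measurable_LIMSEQ_real)
  text \<open>\<open>F\<close> is the pointwise limit of its compositions with coordinatewise rounding.\<close>
  define d where "d k t = max (- L) (of_int \<lfloor>real (Suc k) * t\<rfloor> / real (Suc k))" for k t
  have d_in: "d k t \<in> {-L..L}" and d_close: "\<bar>d k t - t\<bar> \<le> 1 / real (Suc k)"
    if t: "t \<in> {-L..L}" for k t
  proof -
    have "real (Suc k) * t - 1 \<le> of_int \<lfloor>real (Suc k) * t\<rfloor>" "of_int \<lfloor>real (Suc k) * t\<rfloor> \<le> real (Suc k) * t"
      by linarith+
    then have "(real (Suc k) * t - 1) / real (Suc k) \<le> of_int \<lfloor>real (Suc k) * t\<rfloor> / real (Suc k)"
      "of_int \<lfloor>real (Suc k) * t\<rfloor> / real (Suc k) \<le> (real (Suc k) * t) / real (Suc k)"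
      by (intro divide_right_mono; simp)+
    then have "t - 1 / real (Suc k) \<le> of_int \<lfloor>real (Suc k) * t\<rfloor> / real (Suc k)"
      "of_int \<lfloor>real (Suc k) * t\<rfloor> / real (Suc k) \<le> t"
      by (auto simp: diff_divide_distrib)
    then show "d k t \<in> {-L..L}" "\<bar>d k t - t\<bar> \<le> 1 / real (Suc k)"
      using t L by (auto simp: d_def)
  qed
  show "(\<lambda>k. F (\<lambda>i\<in>I. d k (x i))) \<longlonglongrightarrow> F x" if "x \<in> space ?M" for x
  proof -
    have x: "x \<in> I \<rightarrow>\<^sub>E {-L..L}"
      using that by (simp add: space_PiM space_restrict_space)
    then have xi: "x i \<in> {-L..L}" if "i \<in> I" for i using that by blast
    have le: "norm (F (\<lambda>i\<in>I. d k (x i)) - F x) \<le> \<Lambda> * real (card I) * inverse (real (Suc k))" for k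
    proof -
      have "\<bar>F (\<lambda>i\<in>I. d k (x i)) - F x\<bar> \<le> \<Lambda> * (\<Sum>i\<in>I. \<bar>(\<lambda>i\<in>I. d k (x i)) i - x i\<bar>)"
        using x d_in[OF xi] by (intro box_lipschitz_sum[OF I lip]) auto
      also have "(\<Sum>i\<in>I. \<bar>(\<lambda>i\<in>I. d k (x i)) i - x i\<bar>) \<le> (\<Sum>i\<in>I. inverse (real (Suc k)))"
        using d_close[OF xi] by (intro sum_mono) (auto simp: inverse_eq_divide)
      finally show ?thesis using \<Lambda> by (simp add: mult.assoc mult_left_mono)
    qed
    have lim: "(\<lambda>k. \<Lambda> * real (card I) * inverse (real (Suc k))) \<longlonglongrightarrow> 0"
      by (rule tendsto_mult_right_zero[OF LIMSEQ_inverse_real_of_nat])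
    have "(\<lambda>k. F (\<lambda>i\<in>I. d k (x i)) - F x) \<longlonglongrightarrow> 0"
      by (rule Lim_null_comparison[OF _ lim]) (simp only: le eventually_True)
    then show ?thesis by (simp add: LIM_zero_iff)
  qed
  show "(\<lambda>x. F (\<lambda>i\<in>I. d k (x i))) \<in> borel_measurable ?M" for k
  proof -
    \<comment> \<open>Rounded vectors take countably many values, so composing with \<open>F\<close>
      preserves measurability whatever \<open>F\<close> is.\<close>
    define Z where "Z = range (\<lambda>j::int. max (- L) (of_int j / real (Suc k)))"
    have Z: "countable (I \<rightarrow>\<^sub>E Z)" using I by (intro countable_PiE) (auto simp: Z_def)
    have [measurable]: "d k \<in> borel_measurable borel" unfolding d_def by measurable
    have [measurable]: "(\<lambda>x. x i) \<in> borel_measurable ?M" if "i \<in> I" for i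
      using measurable_component_singleton[OF that, of "\<lambda>_. restrict_space borel {-L..L}"]
      by (simp add: measurable_restrict_space2_iff)
    have "(\<lambda>x. \<lambda>i\<in>I. d k (x i)) -` {a} \<inter> space ?M \<in> sets ?M" if a: "a \<in> I \<rightarrow>\<^sub>E Z" for a
    proof -
      have "(\<lambda>x. \<lambda>i\<in>I. d k (x i)) -` {a} \<inter> space ?M = {x \<in> space ?M. \<forall>i\<in>I. d k (x i) = a i}"
        using a by (auto simp: fun_eq_iff PiE_iff extensional_def)
      also have "\<dots> \<in> sets ?M"
        using I by measurable
      finally show ?thesis .
    qed
    moreover have "(\<lambda>x. \<lambda>i\<in>I. d k (x i)) \<in> space ?M \<rightarrow> (I \<rightarrow>\<^sub>E Z)"
      by (auto simp: d_def Z_def)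
    ultimately have "(\<lambda>x. \<lambda>i\<in>I. d k (x i)) \<in> measurable ?M (count_space (I \<rightarrow>\<^sub>E Z))"
      unfolding measurable_count_space_eq_countable[OF Z] by blast
    then show ?thesis
      by (rule measurable_compose) simp
  qed
qed

lemma pikovsky_space_pair: "pair_sigma_finite pikovsky_space pikovsky_space"
  by unfold_locales

definition lip_bounded :: "(real \<Rightarrow> real) \<Rightarrow> real \<Rightarrow> real \<Rightarrow> bool" where
  "lip_bounded f L \<Lambda> \<longleftrightarrow> 0 \<le> \<Lambda> \<and> (\<forall>x\<in>{-1..1}. \<bar>f x\<bar> \<le> L) \<and>
     (\<forall>x\<in>{-1..1}. \<forall>y\<in>{-1..1}. \<bar>f x - f y\<bar> \<le> \<Lambda> * \<bar>x - y\<bar>)"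

definition sep_lip_bounded :: "real \<Rightarrow> nat set \<Rightarrow> ((nat \<Rightarrow> real) \<Rightarrow> real) \<Rightarrow> real \<Rightarrow> real \<Rightarrow> bool" where
  "sep_lip_bounded L I F S \<Lambda> \<longleftrightarrow> 0 \<le> S \<and> 0 \<le> \<Lambda> \<and> (\<forall>x\<in>I \<rightarrow>\<^sub>E {-L..L}. \<bar>F x\<bar> \<le> S) \<and>
     (\<forall>x\<in>I \<rightarrow>\<^sub>E {-L..L}. \<forall>i\<in>I. \<forall>a\<in>{-L..L}. \<forall>a'\<in>{-L..L}.
        \<bar>F (x(i := a)) - F (x(i := a'))\<bar> \<le> \<Lambda> * \<bar>a - a'\<bar>)"

section \<open>The estimate with explicit real constants\<close>

context pikovsky_weight
begin

text \<open>Both integrals are conditioned on \<open>z\<close>, the orbit at time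
  \<open>n = Min I2\<close>: applying \<open>P ^^ n\<close> preserves them. The joint law then gives
  a value \<open>g z\<close> and the product law the mean of \<open>g\<close>, and
  \<open>decorrelation\<close> bounds their difference.\<close>

lemma correlation_estimate:
  "\<exists>C>0. \<forall>f L \<Lambda>f I1 I2 F S \<Lambda>F.
      lip_bounded f L \<Lambda>f \<longrightarrow> sep_lip_bounded L (I1 \<union> I2) F S \<Lambda>F \<longrightarrow>
      finite I1 \<longrightarrow> finite I2 \<longrightarrow> I1 \<noteq> {} \<longrightarrow> I2 \<noteq> {} \<longrightarrow> Max I1 < Min I2 \<longrightarrow>
      \<bar>(\<integral>x. F x \<partial>joint_law pikovsky_space L (\<lambda>n. f \<circ> (pikovsky \<gamma> ^^ n)) (I1 \<union> I2))
        - (\<integral>q. F (merge I1 I2 q) \<partial>(joint_law pikovsky_space L (\<lambda>n. f \<circ> (pikovsky \<gamma> ^^ n)) I1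
            \<Otimes>\<^sub>M joint_law pikovsky_space L (\<lambda>n. f \<circ> (pikovsky \<gamma> ^^ n)) I2))\<bar>
      \<le> C * (S + \<Lambda>F * \<Lambda>f) * real (Min I2 - Max I1) powr (- 1 / (\<gamma> - 1))"
proof -
  obtain C where C: "0 < C"
    "\<forall>m G S \<Lambda> k. \<forall>y\<in>{-1<..<1}. \<forall>y'\<in>{-1<..<1}. orbit_functional m G S \<Lambda> \<longrightarrow> 1 \<le> k \<longrightarrow>
      \<bar>(P ^^ (k + m)) (\<lambda>x. G (\<lambda>i. (pikovsky \<gamma> ^^ i) x)) y
        - (P ^^ (k + m)) (\<lambda>x. G (\<lambda>i. (pikovsky \<gamma> ^^ i) x)) y'\<bar>
      \<le> C * (S + \<Lambda>) * (\<theta> k y + \<theta> k y')"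
    using decorrelation by (elim exE conjE)
  show ?thesis
  proof (intro exI[of _ "2 * C / (\<eta> - 1)"] conjI allI impI)
    show "0 < 2 * C / (\<eta> - 1)" using C \<eta> by simp
    fix f :: "real \<Rightarrow> real" and L \<Lambda>f S \<Lambda>F :: real and I1 I2 :: "nat set" and F :: "(nat \<Rightarrow> real) \<Rightarrow> real"
    assume fb: "lip_bounded f L \<Lambda>f" and Fb: "sep_lip_bounded L (I1 \<union> I2) F S \<Lambda>F"
      and I: "finite I1" "finite I2" "I1 \<noteq> {}" "I2 \<noteq> {}" "Max I1 < Min I2"
    have f: "\<bar>f x\<bar> \<le> L" if "x \<in> {-1..1}" for x
      using fb that by (auto simp: lip_bounded_def)
    have f_lip: "\<bar>f x - f y\<bar> \<le> \<Lambda>f * \<bar>x - y\<bar>" if "x \<in> {-1..1}" "y \<in> {-1..1}" for x y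
      using fb that by (auto simp: lip_bounded_def)
    have F: "\<bar>F x\<bar> \<le> S" if "x \<in> (I1 \<union> I2) \<rightarrow>\<^sub>E {-L..L}" for x
      using Fb that unfolding sep_lip_bounded_def by blast
    have F_lip: "\<bar>F (x(i := a)) - F (x(i := a'))\<bar> \<le> \<Lambda>F * \<bar>a - a'\<bar>"
      if "x \<in> (I1 \<union> I2) \<rightarrow>\<^sub>E {-L..L}" "i \<in> I1 \<union> I2" "a \<in> {-L..L}" "a' \<in> {-L..L}" for x i a a'
      using Fb that unfolding sep_lip_bounded_def by blast
    have S: "0 \<le> S" and \<Lambda>F: "0 \<le> \<Lambda>F" and \<Lambda>f: "0 \<le> \<Lambda>f"
      using fb Fb by (auto simp: lip_bounded_def sep_lip_bounded_def)
    define m where "m = Max I1"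
    define n where "n = Min I2"
    define k where "k = n - m"
    have k: "1 \<le> k" "k + m = n" using I(5) by (simp_all add: k_def n_def m_def)
    have I1m: "i \<le> m" if "i \<in> I1" for i using that I by (simp add: m_def)
    have I2n: "n \<le> i" if "i \<in> I2" for i using that I by (simp add: n_def)
    have disj: "i \<notin> I1" if "i \<in> I2" for i using I1m[of i] I2n[of i] that k by auto
    have L: "0 \<le> L" using f[of 0] by simp
    let ?I = "I1 \<union> I2" and ?M = pikovsky_space and ?B = "restrict_space borel {-L..L}"
    define X where "X i = f \<circ> (pikovsky \<gamma> ^^ i)" for i
    have X_in: "X i x \<in> {-L..L}" if "x \<in> {-1..1}" for i x
      using f[OF pikovsky_iter_maps[OF that, of i]] by (auto simp: X_def abs_le_iff)
    have f_cont: "continuous_on {-1..1} f"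
    proof (rule lipschitz_on_continuous_on)
      show "\<Lambda>f-lipschitz_on {-1..1} f"
        using f_lip \<Lambda>f by (intro lipschitz_onI) (auto simp: dist_real_def)
    qed
    have [measurable]: "X i \<in> measurable ?M ?B" for i
    proof (rule measurable_restrict_space2)
      show "X i \<in> space ?M \<rightarrow> {-L..L}" using X_in by auto
      show "X i \<in> borel_measurable ?M"
        unfolding X_def
        by (rule measurable_comp[OF measurable_pikovsky_iter continuous_on_measurable_pikovsky_space[OF f_cont]])
    qed
    have [measurable]: "F \<in> borel_measurable (\<Pi>\<^sub>M i\<in>?I. ?B)"
      by (rule separately_lipschitz_measurable[OF _ L F_lip \<Lambda>F]) (use I in auto)
    have Xvec [measurable]: "(\<lambda>x. \<lambda>i\<in>J. X i x) \<in> measurable ?M (\<Pi>\<^sub>M i\<in>J. ?B)" for J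
      by (intro measurable_restrict) measurable

    define \<Phi> where "\<Phi> x = F (\<lambda>i\<in>?I. X i x)" for x
    \<comment> \<open>The integrand for the product law: \<open>x'\<close> supplies the coordinates
      in \<open>I1\<close>, an independent \<open>x\<close> those in \<open>I2\<close>.\<close>
    define \<Xi> where "\<Xi> x' x = F (merge I1 I2 (\<lambda>i\<in>I1. X i x', \<lambda>i\<in>I2. X i x))" for x' x
    \<comment> \<open>For fixed \<open>z\<close> the coordinates in \<open>I2\<close> are constants,
      and \<open>G z\<close> is a functional of the earlier trajectory \<open>u\<close>
      alone.\<close>
    define G where "G z u = F (\<lambda>i\<in>?I. if i \<in> I1 then f (u i) else X (i - n) z)" for z u
    let ?o = "\<lambda>x i. (pikovsky \<gamma> ^^ i) x"

    have int1: "(\<integral>x. F x \<partial>joint_law ?M L X ?I) = (\<integral>x. \<Phi> x \<partial>?M)"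
      unfolding joint_law_def \<Phi>_def by (rule integral_distr) measurable
    have \<Xi>_meas [measurable]: "(\<lambda>(x', x). \<Xi> x' x) \<in> borel_measurable (?M \<Otimes>\<^sub>M ?M)"
      unfolding \<Xi>_def by measurable
    have \<Xi>_bd: "\<bar>\<Xi> x' x\<bar> \<le> S" if "x' \<in> {-1..1}" "x \<in> {-1..1}" for x' x
      unfolding \<Xi>_def using X_in that by (intro F) (auto simp: merge_def PiE_iff extensional_def)
    have int2: "(\<integral>q. F (merge I1 I2 q) \<partial>(joint_law ?M L X I1 \<Otimes>\<^sub>M joint_law ?M L X I2))
        = (\<integral>x. (\<integral>x'. \<Xi> x' x \<partial>?M) \<partial>?M)"
    proof -
      interpret pair_sigma_finite ?M ?M by (rule pikovsky_space_pair)
      interpret pair: pair_prob_space ?M ?M by unfold_locales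
      have "prob_space (distr ?M (\<Pi>\<^sub>M i\<in>I2. ?B) (\<lambda>x. \<lambda>i\<in>I2. X i x))"
        by (intro pikovsky_space.prob_space_distr Xvec)
      then have "joint_law ?M L X I1 \<Otimes>\<^sub>M joint_law ?M L X I2
          = distr (?M \<Otimes>\<^sub>M ?M) ((\<Pi>\<^sub>M i\<in>I1. ?B) \<Otimes>\<^sub>M (\<Pi>\<^sub>M i\<in>I2. ?B)) (\<lambda>(x', x). (\<lambda>i\<in>I1. X i x', \<lambda>i\<in>I2. X i x))"
        unfolding joint_law_def
        by (intro pair_measure_distr Xvec prob_space_imp_sigma_finite)
      then have "(\<integral>q. F (merge I1 I2 q) \<partial>(joint_law ?M L X I1 \<Otimes>\<^sub>M joint_law ?M L X I2))
          = (\<integral>p. \<Xi> (fst p) (snd p) \<partial>(?M \<Otimes>\<^sub>M ?M))"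
        by (simp add: integral_distr \<Xi>_def case_prod_beta')
      also have "\<dots> = (\<integral>x. (\<integral>x'. \<Xi> x' x \<partial>?M) \<partial>?M)"
      proof (subst integral_snd)
        show "integrable (?M \<Otimes>\<^sub>M ?M) (case_prod \<Xi>)"
          using \<Xi>_meas \<Xi>_bd by (intro pair.integrable_const_bound[where B = S] AE_I2)
            (auto simp: space_pair_measure)
      qed (simp add: case_prod_beta')
      finally show ?thesis .
    qed

    have G_in: "(\<lambda>i\<in>?I. if i \<in> I1 then f (u i) else X (i - n) z) \<in> ?I \<rightarrow>\<^sub>E {-L..L}"
      if "z \<in> {-1..1}" "\<And>i. u i \<in> {-1..1}" for z u
      using X_in[OF that(1)] f[OF that(2)] by (auto simp: abs_le_iff minus_le_iff)
    have G_dep: "G z u = G z v" if "\<And>i. i \<le> m \<Longrightarrow> u i = v i" for z u v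
    proof -
      have "(\<lambda>i\<in>?I. if i \<in> I1 then f (u i) else X (i - n) z) = (\<lambda>i\<in>?I. if i \<in> I1 then f (v i) else X (i - n) z)"
        using that I1m by (intro restrict_ext) auto
      then show ?thesis by (simp only: G_def)
    qed
    have G_bd: "\<bar>G z u\<bar> \<le> S" if "z \<in> {-1..1}" "\<And>i. u i \<in> {-1..1}" for z u
      unfolding G_def by (intro F G_in that)
    have G_lip: "\<bar>G z (u(i := a)) - G z u\<bar> \<le> \<Lambda>F * \<Lambda>f * \<bar>a - u i\<bar>"
      if z: "z \<in> {-1..1}" and u: "\<And>i. u i \<in> {-1..1}" and a: "a \<in> {-1..1}" for z u i a
    proof (cases "i \<in> I1")
      case True
      let ?v = "\<lambda>j\<in>?I. if j \<in> I1 then f (u j) else X (j - n) z"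
      have "(\<lambda>j\<in>?I. if j \<in> I1 then f ((u(i := a)) j) else X (j - n) z) = ?v(i := f a)"
        "?v = ?v(i := f (u i))"
        using True by (auto simp: fun_eq_iff)
      moreover have "\<bar>F (?v(i := f a)) - F (?v(i := f (u i)))\<bar> \<le> \<Lambda>F * \<bar>f a - f (u i)\<bar>"
        using True f[OF a] f[OF u] by (intro F_lip G_in[OF z u]) (auto simp: abs_le_iff minus_le_iff)
      ultimately have "\<bar>G z (u(i := a)) - G z u\<bar> \<le> \<Lambda>F * \<bar>f a - f (u i)\<bar>"
        unfolding G_def by metis
      also have "\<dots> \<le> \<Lambda>F * (\<Lambda>f * \<bar>a - u i\<bar>)"
        using \<Lambda>F f_lip[OF a u] by (intro mult_left_mono)
      finally show ?thesis by (simp add: mult.assoc)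
    next
      case False
      then have "(\<lambda>j\<in>?I. if j \<in> I1 then f ((u(i := a)) j) else X (j - n) z)
          = (\<lambda>j\<in>?I. if j \<in> I1 then f (u j) else X (j - n) z)"
        by (intro restrict_ext) auto
      then have "G z (u(i := a)) = G z u" by (simp only: G_def)
      then show ?thesis using \<Lambda>F \<Lambda>f by simp
    qed

    have \<Phi>_bd: "\<bar>\<Phi> x\<bar> \<le> S" if "x \<in> {-1..1}" for x
      unfolding \<Phi>_def using X_in[OF that] by (intro F) auto
    have \<Phi>_meas: "\<Phi> \<in> borel_measurable ?M"
      unfolding \<Phi>_def by measurable
    define J where "J x = (\<integral>x'. \<Xi> x' x \<partial>?M)" for x
    have J_meas: "J \<in> borel_measurable ?M"
      unfolding J_def by measurable
    have J_bd: "\<bar>J x\<bar> \<le> S" if "x \<in> {-1..1}" for x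
    proof -
      have "(\<lambda>x'. \<Xi> x' x) \<in> borel_measurable ?M"
        using measurable_Pair2[OF \<Xi>_meas, of x] that by simp
      then have "\<bar>J x\<bar> \<le> (\<integral>x'. S \<partial>?M)"
        unfolding J_def using \<Xi>_bd that
        by (intro order_trans[OF integral_abs_bound] integral_mono integrable_abs pikovsky_space_integrable) auto
      then show ?thesis using pikovsky_space.prob_space by simp
    qed

    have shift: "X i x = X (i - n) z" if "i \<in> I2" "(pikovsky \<gamma> ^^ n) x = z" for i x z
    proof -
      have "(pikovsky \<gamma> ^^ i) x = (pikovsky \<gamma> ^^ (i - n)) ((pikovsky \<gamma> ^^ n) x)"
        using I2n[OF that(1)] by (simp flip: funpow_add comp_apply[of "pikovsky \<gamma> ^^ (i - n)"])
      then show ?thesis using that by (simp add: X_def)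
    qed
    have \<Phi>_eq: "\<Phi> x = G z (?o x)" if "(pikovsky \<gamma> ^^ n) x = z" for x z
      unfolding \<Phi>_def G_def using shift[OF _ that] disj
      by (intro arg_cong[where f = F] restrict_ext) (auto simp: X_def)
    have \<Xi>_eq: "\<Xi> x' x = G z (?o x')" if "(pikovsky \<gamma> ^^ n) x = z" for x' x z
      unfolding \<Xi>_def G_def using shift[OF _ that] disj
      by (intro arg_cong[where f = F]) (auto simp: merge_def fun_eq_iff X_def)

    have G_meas: "(\<lambda>x'. G z (?o x')) \<in> borel_measurable ?M" if z: "z \<in> {-1..1}" for z
    proof -
      have "(\<lambda>x'. \<lambda>i\<in>?I. if i \<in> I1 then X i x' else X (i - n) z) \<in> measurable ?M (\<Pi>\<^sub>M i\<in>?I. ?B)"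
        using X_in[OF z]
        by (intro measurable_restrict) (auto simp: space_restrict_space)
      then have "(\<lambda>x'. F (\<lambda>i\<in>?I. if i \<in> I1 then X i x' else X (i - n) z)) \<in> borel_measurable ?M"
        by measurable
      then show ?thesis by (simp add: G_def X_def cong: if_cong)
    qed

    let ?K = "C * (S + \<Lambda>F * \<Lambda>f)"
    have K: "0 \<le> ?K" using C S \<Lambda>F \<Lambda>f by simp
    let ?int = "integral\<^sup>L ?M (\<theta> k)"
    have point: "\<bar>(P ^^ n) \<Phi> z - (P ^^ n) J z\<bar> \<le> ?K * (\<theta> k z + ?int)" if z: "z \<in> {-1<..<1}" for z
    proof -
      have z': "z \<in> {-1..1}" using z by auto
      have bd: "\<bar>G z (?o x)\<bar> \<le> S" if "x \<in> {-1..1}" for x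
        by (intro G_bd z' pikovsky_iter_maps that)
      define g where "g = (P ^^ n) (\<lambda>x'. G z (?o x'))"
      have 1: "(P ^^ n) \<Phi> z = g z"
        unfolding g_def by (rule P_iter_cong[OF z]) (rule \<Phi>_eq)
      \<comment> \<open>On the preimages of \<open>z\<close> the inner integral \<open>J\<close> is
        constant, and \<open>P\<close> fixes constants.\<close>
      have "(P ^^ n) J z = (P ^^ n) (\<lambda>_. \<integral>x'. G z (?o x') \<partial>?M) z"
        by (rule P_iter_cong[OF z]) (simp add: J_def \<Xi>_eq)
      also have "\<dots> = (\<integral>x'. G z (?o x') \<partial>?M)" by (rule P_iter_const)
      \<comment> \<open>Since \<open>P\<close> preserves integrals, the mean over starting points
        \<open>x'\<close> becomes a mean of \<open>g\<close> over independent values at time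
        \<open>n\<close>.\<close>
      also have "\<dots> = integral\<^sup>L ?M g"
        unfolding g_def by (rule integral_P_iter[OF G_meas[OF z'] bd, symmetric])
      finally have 2: "(P ^^ n) J z = integral\<^sup>L ?M g" .
      have g: "integrable ?M g"
        using P_iter_measurable_bound[OF G_meas[OF z'] bd, of n]
        unfolding g_def by (intro pikovsky_space_integrable[of _ S]) auto
      have \<theta>: "integrable ?M (\<theta> k)"
        using \<theta>_bounds k by (intro pikovsky_space_integrable[of _ 1]) auto
      have "\<bar>g z - integral\<^sup>L ?M g\<bar> = \<bar>\<integral>z'. g z - g z' \<partial>?M\<bar>"
        using g pikovsky_space.prob_space by simp
      also have "\<dots> \<le> (\<integral>z'. \<bar>g z - g z'\<bar> \<partial>?M)"
        by (rule integral_abs_bound)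
      also have "\<dots> \<le> (\<integral>z'. ?K * (\<theta> k z + \<theta> k z') \<partial>?M)"
      proof (rule integral_mono_AE)
        show "AE z' in ?M. \<bar>g z - g z'\<bar> \<le> ?K * (\<theta> k z + \<theta> k z')"
          using AE_pikovsky_space
        proof eventually_elim
          case (elim z')
          have "orbit_functional m (G z) S (\<Lambda>F * \<Lambda>f)"
            unfolding orbit_functional_def
          proof (intro conjI allI impI)
            fix u v :: "nat \<Rightarrow> real" assume "\<forall>i\<le>m. u i = v i"
            then show "G z u = G z v" by (intro G_dep) blast
          next
            fix u :: "nat \<Rightarrow> real" assume "\<forall>i. u i \<in> {-1..1}"
            then show "\<bar>G z u\<bar> \<le> S" by (intro G_bd z') blast
          next
            fix u :: "nat \<Rightarrow> real" and i :: nat and a :: real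
            assume "\<forall>i. u i \<in> {-1..1}" "a \<in> {-1..1}"
            then show "\<bar>G z (u(i := a)) - G z u\<bar> \<le> \<Lambda>F * \<Lambda>f * \<bar>a - u i\<bar>"
              by (intro G_lip z') blast+
          qed (use S \<Lambda>F \<Lambda>f in simp_all)
          then show ?case
            unfolding g_def k(2)[symmetric] by (rule C(2)[rule_format, OF z elim _ k(1)])
        qed
      qed (use g \<theta> in auto)
      also have "\<dots> = ?K * (\<theta> k z + ?int)"
        using \<theta> pikovsky_space.prob_space by simp
      finally show ?thesis by (simp only: 1 2)
    qed
    have int\<Phi>: "integrable ?M ((P ^^ n) \<Phi>)"
      using P_iter_measurable_bound[OF \<Phi>_meas \<Phi>_bd, of n]
      by (intro pikovsky_space_integrable[of _ S]) auto
    have intJ: "integrable ?M ((P ^^ n) J)"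
      using P_iter_measurable_bound[OF J_meas J_bd, of n]
      by (intro pikovsky_space_integrable[of _ S]) auto
    have \<theta>: "integrable ?M (\<theta> k)"
      using \<theta>_bounds k by (intro pikovsky_space_integrable[of _ 1]) auto
    have eq: "integral\<^sup>L ?M \<Phi> - integral\<^sup>L ?M J = (\<integral>z. (P ^^ n) \<Phi> z - (P ^^ n) J z \<partial>?M)"
      using int\<Phi> intJ integral_P_iter[OF \<Phi>_meas \<Phi>_bd, of n] integral_P_iter[OF J_meas J_bd, of n] by simp
    have "\<bar>integral\<^sup>L ?M \<Phi> - integral\<^sup>L ?M J\<bar> \<le> (\<integral>z. \<bar>(P ^^ n) \<Phi> z - (P ^^ n) J z\<bar> \<partial>?M)"
      unfolding eq by (rule integral_abs_bound)
    also have "\<dots> \<le> (\<integral>z. ?K * (\<theta> k z + ?int) \<partial>?M)"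
    proof (rule integral_mono_AE)
      show "AE z in ?M. \<bar>(P ^^ n) \<Phi> z - (P ^^ n) J z\<bar> \<le> ?K * (\<theta> k z + ?int)"
        by (rule eventually_mono[OF AE_pikovsky_space point])
      show "integrable ?M (\<lambda>z. \<bar>(P ^^ n) \<Phi> z - (P ^^ n) J z\<bar>)"
        by (rule integrable_abs[OF Bochner_Integration.integrable_diff[OF int\<Phi> intJ]])
      show "integrable ?M (\<lambda>z. ?K * (\<theta> k z + ?int))"
        using \<theta> by simp
    qed
    \<comment> \<open>Integration over \<open>z\<close> turns \<open>\<theta> k z\<close> into a
      second copy of \<open>?int\<close>.\<close>
    also have "\<dots> = ?K * (2 * ?int)"
      using \<theta> pikovsky_space.prob_space by simp
    also have "\<dots> \<le> ?K * (2 * (real k powr (- 1 / (\<gamma> - 1)) / (\<eta> - 1)))"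
      using K integral_\<theta>[OF k(1)] by (intro mult_left_mono) auto
    also have "a * t * (2 * (r / e)) = 2 * a / e * t * r" for a t r e :: real
      by simp
    finally have "\<bar>integral\<^sup>L ?M \<Phi> - integral\<^sup>L ?M J\<bar>
        \<le> 2 * C / (\<eta> - 1) * (S + \<Lambda>F * \<Lambda>f) * real k powr (- 1 / (\<gamma> - 1))" .
    then show "\<bar>(\<integral>x. F x \<partial>joint_law ?M L (\<lambda>n. f \<circ> (pikovsky \<gamma> ^^ n)) ?I)
        - (\<integral>q. F (merge I1 I2 q) \<partial>(joint_law ?M L (\<lambda>n. f \<circ> (pikovsky \<gamma> ^^ n)) I1
            \<Otimes>\<^sub>M joint_law ?M L (\<lambda>n. f \<circ> (pikovsky \<gamma> ^^ n)) I2))\<bar>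
      \<le> 2 * C / (\<eta> - 1) * (S + \<Lambda>F * \<Lambda>f) * real (Min I2 - Max I1) powr (- 1 / (\<gamma> - 1))"
      using int1 int2 by (simp add: X_def[abs_def] J_def[abs_def] k_def n_def m_def)
  qed
qed

end

section \<open>Passage to the extended-real norms of the theorem\<close>

lemma SUP_lipschitz:
  fixes f :: "real \<Rightarrow> real"
  assumes "(SUP x\<in>A. SUP y\<in>A - {x}. ennreal (\<bar>f x - f y\<bar> / \<bar>x - y\<bar>)) \<le> ennreal K" "0 \<le> K"
    and xy: "x \<in> A" "y \<in> A"
  shows "\<bar>f x - f y\<bar> \<le> K * \<bar>x - y\<bar>"
proof (cases "x = y")
  case False
  have "ennreal (\<bar>f x - f y\<bar> / \<bar>x - y\<bar>) \<le> (SUP y\<in>A - {x}. ennreal (\<bar>f x - f y\<bar> / \<bar>x - y\<bar>))"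
    using xy False by (intro SUP_upper) auto
  also have "\<dots> \<le> (SUP x\<in>A. SUP y\<in>A - {x}. ennreal (\<bar>f x - f y\<bar> / \<bar>x - y\<bar>))"
    using xy by (intro SUP_upper2[where f = "\<lambda>x. SUP y\<in>A - {x}. ennreal (\<bar>f x - f y\<bar> / \<bar>x - y\<bar>)"]) auto
  also have "\<dots> \<le> ennreal K" by fact
  finally have "\<bar>f x - f y\<bar> / \<bar>x - y\<bar> \<le> K" using assms(2) by simp
  then show ?thesis using False by (simp add: pos_divide_le_eq)
qed simp

theorem lemma3p1:
  fixes \<gamma> :: real
  assumes "\<gamma> > 1"
  shows "\<exists>C>0. \<forall>(f :: real \<Rightarrow> real) (N :: nat).
           (\<exists>K. K-lipschitz_on {-1..1} f) \<longrightarrow> N \<ge> 1 \<longrightarrow>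
           functional_correlation_bound pikovsky_space N
             (enn2real (sup_norm_on {-1..1} f))
             (\<lambda>n. f \<circ> (pikovsky \<gamma> ^^ n))
             (\<lambda>n. real n powr (- 1 / (\<gamma> - 1)))
             ((enn2real (lip_norm_on {-1..1} f) + 1) * C)"
proof -
  \<comment> \<open>The midpoint of the admissible interval for \<open>\<kappa>\<close>; it depends
    on \<open>\<gamma>\<close> only, and hence so does \<open>C\<close>.\<close>
  interpret pikovsky_weight \<gamma> "(\<gamma> + max 1 (\<gamma> - 1)) / 2"
    using assms by unfold_locales (auto simp: max_def)
  obtain C where C: "0 < C" "\<forall>f L \<Lambda>f I1 I2 F S \<Lambda>F.
      lip_bounded f L \<Lambda>f \<longrightarrow> sep_lip_bounded L (I1 \<union> I2) F S \<Lambda>F \<longrightarrow>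
      finite I1 \<longrightarrow> finite I2 \<longrightarrow> I1 \<noteq> {} \<longrightarrow> I2 \<noteq> {} \<longrightarrow> Max I1 < Min I2 \<longrightarrow>
      \<bar>(\<integral>x. F x \<partial>joint_law pikovsky_space L (\<lambda>n. f \<circ> (pikovsky \<gamma> ^^ n)) (I1 \<union> I2))
        - (\<integral>q. F (merge I1 I2 q) \<partial>(joint_law pikovsky_space L (\<lambda>n. f \<circ> (pikovsky \<gamma> ^^ n)) I1
            \<Otimes>\<^sub>M joint_law pikovsky_space L (\<lambda>n. f \<circ> (pikovsky \<gamma> ^^ n)) I2))\<bar>
      \<le> C * (S + \<Lambda>F * \<Lambda>f) * real (Min I2 - Max I1) powr (- 1 / (\<gamma> - 1))"
    using correlation_estimate by (elim exE conjE)
  show ?thesis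
  proof (intro exI[of _ C] conjI allI impI C(1))
    fix f :: "real \<Rightarrow> real" and N :: nat
    assume "\<exists>K. K-lipschitz_on {-1..1} f"
    then obtain K where K: "K-lipschitz_on {-1..1} f" by blast
    define L where "L = enn2real (sup_norm_on {-1..1} f)"
    define lip where "lip = (SUP x\<in>{-1..1}. SUP y\<in>{-1..1} - {x}. ennreal (\<bar>f x - f y\<bar> / \<bar>x - y\<bar>))"
    define \<Lambda>f where "\<Lambda>f = enn2real lip"
    have K_lip: "\<bar>f x - f y\<bar> \<le> K * \<bar>x - y\<bar>" if "x \<in> {-1..1}" "y \<in> {-1..1}" for x y
      using lipschitz_onD[OF K that] by (simp add: dist_real_def)
    have "sup_norm_on {-1..1} f \<le> ennreal (\<bar>f 0\<bar> + K)"
      unfolding sup_norm_on_def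
    proof (intro SUP_least ennreal_leI)
      fix x :: real assume x: "x \<in> {-1..1}"
      have "K * \<bar>x - 0\<bar> \<le> K * 1"
        using x lipschitz_on_nonneg[OF K] by (intro mult_left_mono) auto
      then show "\<bar>f x\<bar> \<le> \<bar>f 0\<bar> + K" using K_lip[OF x, of 0] by auto
    qed
    then have sup: "sup_norm_on {-1..1} f = ennreal L"
      unfolding L_def by (metis ennreal_enn2real ennreal_less_top le_less_trans)
    have "lip \<le> ennreal K"
      unfolding lip_def
    proof (intro SUP_least ennreal_leI)
      fix x y :: real assume xy: "x \<in> {-1..1}" "y \<in> {-1..1} - {x}"
      then show "\<bar>f x - f y\<bar> / \<bar>x - y\<bar> \<le> K"
        using K_lip[of x y] by (simp add: pos_divide_le_eq)
    qed
    then have lip: "lip = ennreal \<Lambda>f"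
      unfolding \<Lambda>f_def by (metis ennreal_enn2real ennreal_less_top le_less_trans)
    have \<Lambda>f: "0 \<le> \<Lambda>f" and L: "0 \<le> L" by (auto simp: \<Lambda>f_def L_def)
    have norm: "enn2real (lip_norm_on {-1..1} f) = L + \<Lambda>f"
      unfolding lip_norm_on_def lip_def[symmetric] sup lip using \<Lambda>f L by (simp flip: ennreal_plus)
    have f_bd: "\<bar>f x\<bar> \<le> L" if "x \<in> {-1..1}" for x
    proof -
      have "ennreal \<bar>f x\<bar> \<le> ennreal L"
        unfolding sup[symmetric] sup_norm_on_def using that by (intro SUP_upper) auto
      then show ?thesis using L by simp
    qed
    have f_lip: "\<bar>f x - f y\<bar> \<le> \<Lambda>f * \<bar>x - y\<bar>" if "x \<in> {-1..1}" "y \<in> {-1..1}" for x y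
      using lip \<Lambda>f that unfolding lip_def by (intro SUP_lipschitz[where A = "{-1..1}"]) auto
    show "functional_correlation_bound pikovsky_space N (enn2real (sup_norm_on {-1..1} f))
        (\<lambda>n. f \<circ> (pikovsky \<gamma> ^^ n)) (\<lambda>n. real n powr (- 1 / (\<gamma> - 1)))
        ((enn2real (lip_norm_on {-1..1} f) + 1) * C)"
      unfolding functional_correlation_bound_def L_def[symmetric] norm
    proof (intro conjI allI impI)
      fix n
      show "f \<circ> (pikovsky \<gamma> ^^ n) \<in> measurable pikovsky_space (restrict_space borel {-L..L})"
      proof (rule measurable_restrict_space2)
        show "f \<circ> (pikovsky \<gamma> ^^ n) \<in> space pikovsky_space \<rightarrow> {-L..L}"
        proof
          fix x assume "x \<in> space pikovsky_space"
          then have "\<bar>f ((pikovsky \<gamma> ^^ n) x)\<bar> \<le> L"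
            by (intro f_bd pikovsky_iter_maps) simp
          then show "(f \<circ> (pikovsky \<gamma> ^^ n)) x \<in> {-L..L}" by (simp add: abs_le_iff minus_le_iff)
        qed
        show "f \<circ> (pikovsky \<gamma> ^^ n) \<in> borel_measurable pikovsky_space"
          by (rule measurable_comp[OF measurable_pikovsky_iter continuous_on_measurable_pikovsky_space])
            (rule lipschitz_on_continuous_on[OF K])
      qed
    next
      fix I1 I2 and F :: "(nat \<Rightarrow> real) \<Rightarrow> real"
      assume *: "I1 \<noteq> {} \<and> I2 \<noteq> {} \<and> I1 \<union> I2 \<subseteq> {..<N} \<and> Max I1 < Min I2 \<and>
        separately_lipschitz L (I1 \<union> I2) F"
      then have I: "finite I1" "finite I2" "I1 \<noteq> {}" "I2 \<noteq> {}" "Max I1 < Min I2"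
        by (auto intro: finite_subset)
      let ?I = "I1 \<union> I2"
      let ?lhs = "\<bar>(\<integral>x. F x \<partial>joint_law pikovsky_space L (\<lambda>n. f \<circ> (pikovsky \<gamma> ^^ n)) ?I)
           - (\<integral>q. F (merge I1 I2 q) \<partial>(joint_law pikovsky_space L (\<lambda>n. f \<circ> (pikovsky \<gamma> ^^ n)) I1
              \<Otimes>\<^sub>M joint_law pikovsky_space L (\<lambda>n. f \<circ> (pikovsky \<gamma> ^^ n)) I2))\<bar>"
      define R where "R = real (Min I2 - Max I1) powr (- 1 / (\<gamma> - 1))"
      have R: "0 < R" using I(5) by (simp add: R_def)
      have Cp: "0 < (L + \<Lambda>f + 1) * C" using C(1) L \<Lambda>f by simp
      show "ennreal ?lhs \<le> ennreal ((L + \<Lambda>f + 1) * C) * sep_lip_norm L ?I F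
          * ennreal (real (Min I2 - Max I1) powr (- 1 / (\<gamma> - 1)))"
        unfolding R_def[symmetric]
      proof (cases "sup_norm_on (?I \<rightarrow>\<^sub>E {-L..L}) F = \<infinity>")
        case True
        then have "sep_lip_norm L ?I F = \<infinity>" by (simp add: sep_lip_norm_def)
        then show "ennreal ?lhs \<le> ennreal ((L + \<Lambda>f + 1) * C) * sep_lip_norm L ?I F * ennreal R"
        proof -
          \<comment> \<open>If the norm is infinite, so is the right-hand side, because the other
            two factors are positive.\<close>
          have "ennreal a * \<infinity> * ennreal R = \<infinity>" if "0 < a" for a
            using that R by (simp add: ennreal_mult_top ennreal_top_mult)
          from this[OF Cp] \<open>sep_lip_norm L ?I F = \<infinity>\<close> show ?thesis by (simp only: top_greatest infinity_ennreal_def)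
        qed
      next
        case False
        define S where "S = enn2real (sup_norm_on (?I \<rightarrow>\<^sub>E {-L..L}) F)"
        define \<Lambda>F where "\<Lambda>F = enn2real (sep_lip L ?I F)"
        have nonneg: "0 \<le> S" "0 \<le> \<Lambda>F" by (auto simp: S_def \<Lambda>F_def)
        have S: "sup_norm_on (?I \<rightarrow>\<^sub>E {-L..L}) F = ennreal S"
          using False by (simp add: S_def less_top)
        have \<Lambda>F: "sep_lip L ?I F = ennreal \<Lambda>F"
          using * by (simp add: separately_lipschitz_def \<Lambda>F_def)
        have F_bd: "\<bar>F x\<bar> \<le> S" if "x \<in> ?I \<rightarrow>\<^sub>E {-L..L}" for x
        proof -
          have "ennreal \<bar>F x\<bar> \<le> ennreal S"
            unfolding S[symmetric] sup_norm_on_def using that by (intro SUP_upper) auto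
          then show ?thesis using nonneg by simp
        qed
        have F_lip: "\<bar>F (x(i := a)) - F (x(i := a'))\<bar> \<le> \<Lambda>F * \<bar>a - a'\<bar>"
          if "x \<in> ?I \<rightarrow>\<^sub>E {-L..L}" "i \<in> ?I" "a \<in> {-L..L}" "a' \<in> {-L..L}" for x i a a'
        proof (rule SUP_lipschitz[where f = "\<lambda>a. F (x(i := a))" and A = "{-L..L}"])
          show "(SUP a\<in>{-L..L}. SUP a'\<in>{-L..L} - {a}. ennreal (\<bar>F (x(i := a)) - F (x(i := a'))\<bar> / \<bar>a - a'\<bar>))
              \<le> ennreal \<Lambda>F"
            unfolding \<Lambda>F[symmetric] sep_lip_def
            by (rule SUP_upper2[OF that(2)], rule SUP_upper2[OF that(1)]) simp
        qed (use that nonneg in auto)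
        have "?lhs \<le> C * (S + \<Lambda>F * \<Lambda>f) * R"
          unfolding R_def
        proof (rule C(2)[rule_format])
          show "lip_bounded f L \<Lambda>f" using f_bd f_lip \<Lambda>f by (auto simp: lip_bounded_def)
          show "sep_lip_bounded L ?I F S \<Lambda>F"
            unfolding sep_lip_bounded_def using F_bd F_lip nonneg by blast
        qed (fact I)+
        also have "\<dots> \<le> (L + \<Lambda>f + 1) * C * (S + \<Lambda>F) * R"
        proof (intro mult_right_mono)
          \<comment> \<open>In the expanded product, the summand 1 of the constant supplies
            \<open>S\<close> and the summand \<open>\<Lambda>f\<close> supplies
            \<open>\<Lambda>F * \<Lambda>f\<close>; the remaining terms are nonnegative.\<close>
          have "0 \<le> L * (S + \<Lambda>F)" "0 \<le> \<Lambda>f * S" using L \<Lambda>f nonneg by simp_all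
          then have "S + \<Lambda>F * \<Lambda>f \<le> (L + \<Lambda>f + 1) * (S + \<Lambda>F)"
            using nonneg by (simp add: algebra_simps)
          then have "C * (S + \<Lambda>F * \<Lambda>f) \<le> C * ((L + \<Lambda>f + 1) * (S + \<Lambda>F))"
            using C(1) by (intro mult_left_mono) auto
          then show "C * (S + \<Lambda>F * \<Lambda>f) \<le> (L + \<Lambda>f + 1) * C * (S + \<Lambda>F)" by (simp add: mult_ac)
        qed (use R in simp)
        finally have "ennreal ?lhs \<le> ennreal ((L + \<Lambda>f + 1) * C * (S + \<Lambda>F) * R)"
          by (rule ennreal_leI)
        also have "\<dots> = ennreal ((L + \<Lambda>f + 1) * C) * sep_lip_norm L ?I F * ennreal R"
          using nonneg Cp R by (simp add: sep_lip_norm_def S \<Lambda>F ennreal_mult ennreal_plus[symmetric] del: ennreal_plus)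
        finally show "ennreal ?lhs \<le> ennreal ((L + \<Lambda>f + 1) * C) * sep_lip_norm L ?I F * ennreal R" .
      qed
    qed
  qed
qed

end
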